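(* Let $V$ be a finite-dimensional complex vector space and let $l,r\ge 0$ be integers. Then the configuration map $$\mathrm{config}_{B^2}\colon \mathrm{Poly}_{V,S^1}^{l,r}\to \mathrm{Conf}_{V,B^2}^{r}$$ is continuous.
   Context: Notation: $B^2=\{z\in\mathbb{C}: |z|<1\}$, $S^1=\{z\in\mathbb{C}:|z|=1\}$. Configuration spaces. For an open set $U\subset\mathbb{C}$ and $r\ge 0$, let $\widetilde{\mathrm{Conf}}_{V,U}^r$ be the set of pairs $(A,\iota)$ with $A\in M_r(\mathbb{C})$ and $\iota\colon V\to\mathbb{C}^r$ linear, such that all eigenvalues of $A$ lie in $U$ and the map $\sum_{i=0}^{r-1}A^i\iota\colon V^{\oplus r}\to\mathbb{C}^r$, $(v_i)_i\mapsto\sum_i A^i\iota(v_i)$, is surjective. It has the subspace topology from $M_r(\mathbb{C})\times\mathrm{Hom}_{\mathbb{C}}(V,\mathbb{C}^r)$. The group $\mathrm{GL}_r(\mathbb{C})$ acts on the left by $g\cdot(A,\iota)=(gAg^{-1},g\iota)$, and $\mathrm{Conf}_{V,U}^r=\mathrm{GL}_r(\mathbb{C})\backslash\widetilde{\mathrm{Conf}}_{V,U}^r$ with the quotient topology. The class of $(A,\iota)$ is written $[A,\iota]$. Polynomial spaces. $\mathrm{Poly}_V^l$ is the space of polynomials $f(z)=\sum_{j=0}^l a_jz^j$ with $a_j\in\mathrm{End}_{\mathbb{C}}(V)$ (degree at most $l$), topologized as $\mathrm{End}_{\mathbb{C}}(V)^{l+1}$. $\mathrm{Poly}_{V,S^1}^{l,r}\subset\mathrm{Poly}_V^l$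 is the subspace of those $f$ such that $f(\lambda)\in\mathrm{GL}_{\mathbb{C}}(V)$ for every $\lambda\in S^1$ and $\det f(z)$ has exactly $r$ roots in $B^2$, counted with multiplicity. Configuration map. For $f\in\mathrm{Poly}_{V,S^1}^{l,r}$, let $\mathcal{O}_{B^2}(-;V)$ be the sheaf of $V$-valued holomorphic functions on $B^2$ and let $\tilde f\colon\mathcal{O}_{B^2}(-;V)\to\mathcal{O}_{B^2}(-;V)$ be the homomorphism $s(z)\mapsto f(z)s(z)$. The global sections $H^0(\mathrm{Coker}\,\tilde f)$ form an $r$-dimensional complex vector space. Let $\pi\colon\mathcal{O}_{B^2}(B^2;V)\to H^0(\mathrm{Coker}\,\tilde f)$ be induced by the projection, let $\bar z$ be the endomorphism of $H^0(\mathrm{Coker}\,\tilde f)$ induced by multiplication by $z$, let $\mathrm{const}\colon V\to\mathcal{O}_{B^2}(B^2;V)$ send a vector to the constant function, and choose an isomorphism $\varphi\colon H^0(\mathrm{Coker}\,\tilde f)\to\mathbb{C}^r$. Then $\mathrm{config}_{B^2}(f)=[\varphi\bar z\varphi^{-1},\ \varphi\circ\pi\circ\mathrm{const}]$, which is an element of $\mathrm{Conf}_{V,B^2}^r$ independent of $\varphi$. *)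

theory Defs
  imports "HOL-Analysis.Analysis" "Jordan_Normal_Form.Char_Poly"
begin

(* HOL-Analysis and Jordan_Normal_Form both use these names and notations; here they
   always refer to Jordan_Normal_Form, whose dimensions are natural numbers (0 included). *)
hide_const (open) Determinants.det Finite_Cartesian_Product.mat Finite_Cartesian_Product.vec
no_notation Finite_Cartesian_Product.vec_nth (infixl \<open>$\<close> 90)

section \<open>Quotient topology\<close>

definition quotient_topology :: "'a topology \<Rightarrow> ('a \<Rightarrow> 'b) \<Rightarrow> 'b topology" where
  "quotient_topology X q =
     topology (\<lambda>W. W \<subseteq> q ` topspace X \<and> openin X {x \<in> topspace X. q x \<in> W})"

lemma openin_quotient_topology:
  "openin (quotient_topology X q) W \<longleftrightarrow>
     W \<subseteq> q ` topspace X \<and> openin X {x \<in> topspace X. q x \<in> W}"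
proof -
  have "istopology (\<lambda>W. W \<subseteq> q ` topspace X \<and> openin X {x \<in> topspace X. q x \<in> W})"
    unfolding istopology_def
  proof (intro conjI allI impI; (elim conjE)?)
    fix S T
    assume *: "openin X {x \<in> topspace X. q x \<in> S}" "openin X {x \<in> topspace X. q x \<in> T}"
    have "{x \<in> topspace X. q x \<in> S \<inter> T}
        = {x \<in> topspace X. q x \<in> S} \<inter> {x \<in> topspace X. q x \<in> T}" by auto
    then show "openin X {x \<in> topspace X. q x \<in> S \<inter> T}" using * by auto
  next
    fix \<K>
    assume *: "\<forall>K\<in>\<K>. K \<subseteq> q ` topspace X \<and> openin X {x \<in> topspace X. q x \<in> K}"
    have "{x \<in> topspace X. q x \<in> \<Union>\<K>} = (\<Union>K\<in>\<K>. {x \<in> topspace X. q x \<in> K})" by auto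
    then show "openin X {x \<in> topspace X. q x \<in> \<Union>\<K>}" using * by auto
  qed auto
  then show ?thesis
    by (simp add: quotient_topology_def topology_inverse')
qed

lemma topspace_quotient_topology: "topspace (quotient_topology X q) = q ` topspace X"
proof -
  have "{x \<in> topspace X. q x \<in> q ` topspace X} = topspace X" by auto
  then have "openin (quotient_topology X q) (q ` topspace X)"
    by (simp add: openin_quotient_topology)
  then show ?thesis
    by (metis openin_quotient_topology openin_subset openin_topspace subset_antisym)
qed

lemma quotient_map_quotient_topology: "quotient_map X (quotient_topology X q) q"
  by (simp add: quotient_map_def topspace_quotient_topology openin_quotient_topology)

section \<open>Matrices\<close>

definition mat_topology :: "nat \<Rightarrow> complex mat topology" where
  "mat_topology r = pullback_topology (carrier_mat r r) (\<lambda>A. \<lambda>(i, j)\<in>{..<r} \<times> {..<r}. A $$ (i, j))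
     (product_topology (\<lambda>_. euclidean) ({..<r} \<times> {..<r}))"

section \<open>A finite-dimensional complex vector space\<close>

(* V is the whole type 'v. Basis only supplies coordinates; none of the notions below
   depends on which basis is used. Basis = {} (that is, V = 0) is allowed. *)
locale complex_fd_space = finite_dimensional_vector_space scale Basis
  for scale :: "complex \<Rightarrow> 'v::ab_group_add \<Rightarrow> 'v" and Basis :: "'v set"
begin

definition End :: "('v \<Rightarrow> 'v) set" where
  "End = {h. Vector_Spaces.linear scale scale h}"

definition End_topology :: "('v \<Rightarrow> 'v) topology" where
  "End_topology = pullback_topology End
     (\<lambda>h. \<lambda>(b, c)\<in>Basis \<times> Basis. representation Basis (h b) c)
     (product_topology (\<lambda>_. euclidean) (Basis \<times> Basis))"

definition holomorphic :: "(complex \<Rightarrow> 'v) \<Rightarrow> complex set \<Rightarrow> bool" where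
  "holomorphic g U \<longleftrightarrow> (\<forall>b\<in>Basis. (\<lambda>z. representation Basis (g z) b) holomorphic_on U)"

definition basis_enum :: "nat \<Rightarrow> 'v" where
  "basis_enum = (SOME e. bij_betw e {..<card Basis} Basis)"

definition End_det :: "('v \<Rightarrow> 'v) \<Rightarrow> complex" where
  "End_det h = det (mat (card Basis) (card Basis)
     (\<lambda>(i, j). representation Basis (h (basis_enum j)) (basis_enum i)))"

section \<open>Configuration spaces\<close>

definition Hom_vec :: "nat \<Rightarrow> ('v \<Rightarrow> complex vec) set" where
  "Hom_vec r = {\<iota>. (\<forall>v. \<iota> v \<in> carrier_vec r) \<and> (\<forall>v w. \<iota> (v + w) = \<iota> v + \<iota> w) \<and>
     (\<forall>c v. \<iota> (scale c v) = c \<cdot>\<^sub>v \<iota> v)}"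

definition Hom_vec_topology :: "nat \<Rightarrow> ('v \<Rightarrow> complex vec) topology" where
  "Hom_vec_topology r = pullback_topology (Hom_vec r) (\<lambda>\<iota>. \<lambda>(i, b)\<in>{..<r} \<times> Basis. \<iota> b $ i)
     (product_topology (\<lambda>_. euclidean) ({..<r} \<times> Basis))"

definition Conf_tilde :: "complex set \<Rightarrow> nat \<Rightarrow> (complex mat \<times> ('v \<Rightarrow> complex vec)) set" where
  "Conf_tilde U r = {(A, \<iota>). A \<in> carrier_mat r r \<and> \<iota> \<in> Hom_vec r \<and>
     (\<forall>k. eigenvalue A k \<longrightarrow> k \<in> U) \<and>
     (\<forall>w\<in>carrier_vec r. \<exists>v :: nat \<Rightarrow> 'v.
        finsum_vec TYPE(complex) r (\<lambda>i. (A ^\<^sub>m i) *\<^sub>v \<iota> (v i)) {..<r} = w)}"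

definition Conf_tilde_topology ::
    "complex set \<Rightarrow> nat \<Rightarrow> (complex mat \<times> ('v \<Rightarrow> complex vec)) topology" where
  "Conf_tilde_topology U r =
     subtopology (prod_topology (mat_topology r) (Hom_vec_topology r)) (Conf_tilde U r)"

(* The class [A, \<iota>], as the orbit under GL_r; g' is the inverse of g. *)
definition Conf_class ::
    "nat \<Rightarrow> complex mat \<times> ('v \<Rightarrow> complex vec) \<Rightarrow> (complex mat \<times> ('v \<Rightarrow> complex vec)) set" where
  "Conf_class r = (\<lambda>(A, \<iota>). {(g * A * g', \<lambda>v. g *\<^sub>v \<iota> v) | g g'.
     g \<in> carrier_mat r r \<and> g' \<in> carrier_mat r r \<and> g * g' = 1\<^sub>m r \<and> g' * g = 1\<^sub>m r})"

definition Conf_topology ::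
    "complex set \<Rightarrow> nat \<Rightarrow> (complex mat \<times> ('v \<Rightarrow> complex vec)) set topology" where
  "Conf_topology U r = quotient_topology (Conf_tilde_topology U r) (Conf_class r)"

lemma topspace_Conf_topology: "topspace (Conf_topology U r) = Conf_class r ` Conf_tilde U r"
proof -
  have "topspace (Conf_tilde_topology U r) = Conf_tilde U r"
    by (auto simp: Conf_tilde_topology_def mat_topology_def Hom_vec_topology_def
        topspace_pullback_topology Conf_tilde_def)
  then show ?thesis by (simp add: Conf_topology_def topspace_quotient_topology)
qed

section \<open>Polynomial spaces\<close>

(* A polynomial of degree at most l is the family (a 0, ..., a l) of its coefficients. *)
definition Poly_topology :: "nat \<Rightarrow> (nat \<Rightarrow> 'v \<Rightarrow> 'v) topology" where
  "Poly_topology l = product_topology (\<lambda>_. End_topology) {..l}"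

definition eval :: "nat \<Rightarrow> (nat \<Rightarrow> 'v \<Rightarrow> 'v) \<Rightarrow> complex \<Rightarrow> 'v \<Rightarrow> 'v" where
  "eval l a z v = (\<Sum>j\<le>l. scale (z ^ j) (a j v))"

(* det f(z) as an element of C[z]; see poly_det_poly. *)
definition det_poly :: "nat \<Rightarrow> (nat \<Rightarrow> 'v \<Rightarrow> 'v) \<Rightarrow> complex poly" where
  "det_poly l a = det (mat (card Basis) (card Basis)
     (\<lambda>(i, j). \<Sum>k\<le>l. monom (representation Basis (a k (basis_enum j)) (basis_enum i)) k))"

lemma representation_eval:
  assumes "a \<in> {..l} \<rightarrow>\<^sub>E End"
  shows "representation Basis (eval l a z v) c =
    (\<Sum>j\<le>l. z ^ j * representation Basis (a j v) c)"
proof -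
  have "representation Basis (\<Sum>j\<le>m. scale (z ^ j) (a j v)) c =
    (\<Sum>j\<le>m. z ^ j * representation Basis (a j v) c)" for m
    by (induction m)
      (simp_all add: representation_add representation_scale independent_Basis span_Basis)
  then show ?thesis by (simp add: eval_def)
qed

lemma poly_det_poly:
  assumes "a \<in> {..l} \<rightarrow>\<^sub>E End"
  shows "poly (det_poly l a) z = End_det (eval l a z)"
  unfolding det_poly_def End_det_def
  by (rule poly_det_cong[where n = "card Basis"])
    (auto simp: representation_eval[OF assms] poly_sum poly_monom mult.commute)

definition Poly_S1 :: "nat \<Rightarrow> nat \<Rightarrow> (nat \<Rightarrow> 'v \<Rightarrow> 'v) set" where
  "Poly_S1 l r = {a \<in> {..l} \<rightarrow>\<^sub>E End.
     (\<forall>z\<in>sphere 0 1. bij (eval l a z)) \<and>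
     (\<Sum>z | poly (det_poly l a) z = 0 \<and> z \<in> ball 0 1. order z (det_poly l a)) = r}"

lemma topspace_End_topology: "topspace End_topology = End"
  by (auto simp: End_topology_def topspace_pullback_topology)

definition Poly_S1_topology :: "nat \<Rightarrow> nat \<Rightarrow> (nat \<Rightarrow> 'v \<Rightarrow> 'v) topology" where
  "Poly_S1_topology l r = subtopology (Poly_topology l) (Poly_S1 l r)"

lemma topspace_Poly_S1_topology: "topspace (Poly_S1_topology l r) = Poly_S1 l r"
  by (auto simp: Poly_S1_topology_def Poly_topology_def topspace_End_topology Poly_S1_def)

section \<open>The cokernel sheaf\<close>

(* F z is an endomorphism of V depending holomorphically on z. Coker F is the sheafification
   of the presheaf U \<mapsto> O(U;V) / F O(U;V) on the unit disc, constructed in the usual way: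
   its sections are the functions into the stalks of the presheaf that locally come from
   sections of the presheaf. A germ at y is represented by a pair (U, g) with g holomorphic
   on the open neighbourhood U of y; the values of g outside U play no role. *)
definition local_sections :: "complex \<Rightarrow> (complex set \<times> (complex \<Rightarrow> 'v)) set" where
  "local_sections y = {(U, g). open U \<and> y \<in> U \<and> U \<subseteq> ball 0 1 \<and> holomorphic g U}"

definition coker_rel :: "(complex \<Rightarrow> 'v \<Rightarrow> 'v) \<Rightarrow> complex \<Rightarrow>
    ((complex set \<times> (complex \<Rightarrow> 'v)) \<times> (complex set \<times> (complex \<Rightarrow> 'v))) set" where
  "coker_rel F y = {((U, g), (U', g')). (U, g) \<in> local_sections y \<and> (U', g') \<in> local_sections y \<and>
     (\<exists>W h. open W \<and> y \<in> W \<and> W \<subseteq> U \<inter> U' \<and> holomorphic h W \<and>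
        (\<forall>z\<in>W. g z - g' z = F z (h z)))}"

lemma holomorphic_add: "holomorphic g U \<Longrightarrow> holomorphic h U \<Longrightarrow> holomorphic (\<lambda>z. g z + h z) U"
  by (auto simp: holomorphic_def representation_add independent_Basis span_Basis
      intro: holomorphic_on_add)

lemma holomorphic_minus: "holomorphic g U \<Longrightarrow> holomorphic (\<lambda>z. - g z) U"
  by (auto simp: holomorphic_def representation_neg independent_Basis span_Basis
      intro: holomorphic_on_minus)

lemma holomorphic_subset: "holomorphic g U \<Longrightarrow> W \<subseteq> U \<Longrightarrow> holomorphic g W"
  by (auto simp: holomorphic_def intro: holomorphic_on_subset)

lemma equiv_coker_rel:
  assumes "\<And>z. F z \<in> End"
  shows "equiv (local_sections y) (coker_rel F y)"
proof -
  have lin: "module_hom scale scale (F z)" for z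
    using assms by (simp add: End_def module_hom_iff_linear)
  show ?thesis
  proof (rule equivI)
    show "coker_rel F y \<subseteq> local_sections y \<times> local_sections y"
      by (auto simp: coker_rel_def)
    show "refl_on (local_sections y) (coker_rel F y)"
    proof (rule refl_onI)
      fix p assume p: "p \<in> local_sections y"
      obtain U g where Ug: "p = (U, g)" by (cases p)
      have "\<exists>h. holomorphic h U \<and> (\<forall>z\<in>U. g z - g z = F z (h z))"
        by (rule exI[of _ "\<lambda>_. 0"])
          (simp add: holomorphic_def representation_zero module_hom.zero[OF lin])
      then show "(p, p) \<in> coker_rel F y"
        using p unfolding coker_rel_def local_sections_def Ug by blast
    qed
    show "sym (coker_rel F y)"
    proof (rule symI)
      fix p q assume pq: "(p, q) \<in> coker_rel F y"
      obtain U g U' g' where eq: "p = (U, g)" "q = (U', g')" by (metis surj_pair)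
      from pq obtain W h where W: "open W" "y \<in> W" "W \<subseteq> U \<inter> U'" "holomorphic h W"
          "\<forall>z\<in>W. g z - g' z = F z (h z)"
        by (auto simp: coker_rel_def eq)
      have "g' z - g z = F z (- h z)" if "z \<in> W" for z
        using W(5) that by (metis minus_diff_eq module_hom.neg[OF lin])
      then show "(q, p) \<in> coker_rel F y"
        using pq W(1-3) holomorphic_minus[OF W(4)] unfolding coker_rel_def eq by blast
    qed
    show "trans (coker_rel F y)"
    proof (rule transI)
      fix p q s assume pq: "(p, q) \<in> coker_rel F y" and qs: "(q, s) \<in> coker_rel F y"
      obtain U g U' g' U'' g'' where eq: "p = (U, g)" "q = (U', g')" "s = (U'', g'')"
        by (metis surj_pair)
      from pq obtain W h where W: "open W" "y \<in> W" "W \<subseteq> U \<inter> U'" "holomorphic h W"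
          "\<forall>z\<in>W. g z - g' z = F z (h z)"
        by (auto simp: coker_rel_def eq)
      from qs obtain X k where X: "open X" "y \<in> X" "X \<subseteq> U' \<inter> U''" "holomorphic k X"
          "\<forall>z\<in>X. g' z - g'' z = F z (k z)"
        by (auto simp: coker_rel_def eq)
      have "g z - g'' z = F z (h z + k z)" if "z \<in> W \<inter> X" for z
      proof -
        have "g z - g'' z = (g z - g' z) + (g' z - g'' z)" by simp
        also have "\<dots> = F z (h z) + F z (k z)" using W(5) X(5) that by (metis IntD1 IntD2)
        finally show ?thesis by (simp add: module_hom.add[OF lin])
      qed
      moreover have "holomorphic (\<lambda>z. h z + k z) (W \<inter> X)"
        by (intro holomorphic_add holomorphic_subset[OF W(4)] holomorphic_subset[OF X(4)]) auto
      moreover have "open (W \<inter> X)" "y \<in> W \<inter> X" "W \<inter> X \<subseteq> U \<inter> U''" using W X by auto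
      ultimately show "(p, s) \<in> coker_rel F y"
        using pq qs unfolding coker_rel_def eq by blast
    qed
  qed
qed

definition coker_germ :: "(complex \<Rightarrow> 'v \<Rightarrow> 'v) \<Rightarrow> complex \<Rightarrow>
    complex set \<times> (complex \<Rightarrow> 'v) \<Rightarrow> (complex set \<times> (complex \<Rightarrow> 'v)) set" where
  "coker_germ F y Ug = coker_rel F y `` {Ug}"

definition coker_stalk :: "(complex \<Rightarrow> 'v \<Rightarrow> 'v) \<Rightarrow> complex \<Rightarrow>
    (complex set \<times> (complex \<Rightarrow> 'v)) set set" where
  "coker_stalk F y = local_sections y // coker_rel F y"

definition H0_coker :: "(complex \<Rightarrow> 'v \<Rightarrow> 'v) \<Rightarrow>
    (complex \<Rightarrow> (complex set \<times> (complex \<Rightarrow> 'v)) set) set" where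
  "H0_coker F = {s \<in> (\<Pi>\<^sub>E y\<in>ball 0 1. coker_stalk F y).
     \<forall>x\<in>ball 0 1. \<exists>U g. (U, g) \<in> local_sections x \<and> (\<forall>y\<in>U. s y = coker_germ F y (U, g))}"

definition H0_add :: "(complex \<Rightarrow> 'v \<Rightarrow> 'v) \<Rightarrow>
    (complex \<Rightarrow> (complex set \<times> (complex \<Rightarrow> 'v)) set) \<Rightarrow>
    (complex \<Rightarrow> (complex set \<times> (complex \<Rightarrow> 'v)) set) \<Rightarrow>
    (complex \<Rightarrow> (complex set \<times> (complex \<Rightarrow> 'v)) set)" where
  "H0_add F s t = (\<lambda>y\<in>ball 0 1.
     \<Union>(U, g)\<in>s y. \<Union>(U', g')\<in>t y. coker_germ F y (U \<inter> U', \<lambda>z. g z + g' z))"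

(* Multiplication by a scalar holomorphic function p; for constant p this is the scalar
   multiplication of the complex vector space of global sections. *)
definition H0_mult :: "(complex \<Rightarrow> 'v \<Rightarrow> 'v) \<Rightarrow> (complex \<Rightarrow> complex) \<Rightarrow>
    (complex \<Rightarrow> (complex set \<times> (complex \<Rightarrow> 'v)) set) \<Rightarrow>
    (complex \<Rightarrow> (complex set \<times> (complex \<Rightarrow> 'v)) set)" where
  "H0_mult F p s = (\<lambda>y\<in>ball 0 1. \<Union>(U, g)\<in>s y. coker_germ F y (U, \<lambda>z. scale (p z) (g z)))"

section \<open>The configuration map\<close>

definition coker_proj :: "(complex \<Rightarrow> 'v \<Rightarrow> 'v) \<Rightarrow> (complex \<Rightarrow> 'v) \<Rightarrow>
    (complex \<Rightarrow> (complex set \<times> (complex \<Rightarrow> 'v)) set)" where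
  "coker_proj F g = (\<lambda>y\<in>ball 0 1. coker_germ F y (ball 0 1, g))"

definition H0_iso :: "(complex \<Rightarrow> 'v \<Rightarrow> 'v) \<Rightarrow> nat \<Rightarrow>
    ((complex \<Rightarrow> (complex set \<times> (complex \<Rightarrow> 'v)) set) \<Rightarrow> complex vec) \<Rightarrow> bool" where
  "H0_iso F r \<phi> \<longleftrightarrow> bij_betw \<phi> (H0_coker F) (carrier_vec r) \<and>
     (\<forall>s\<in>H0_coker F. \<forall>t\<in>H0_coker F. \<phi> (H0_add F s t) = \<phi> s + \<phi> t) \<and>
     (\<forall>c. \<forall>s\<in>H0_coker F. \<phi> (H0_mult F (\<lambda>_. c) s) = c \<cdot>\<^sub>v \<phi> s)"

(* The first component is the matrix of \<phi> zbar \<phi>^-1 in the standard basis of C^r. *)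
definition config_pair :: "(complex \<Rightarrow> 'v \<Rightarrow> 'v) \<Rightarrow> nat \<Rightarrow>
    ((complex \<Rightarrow> (complex set \<times> (complex \<Rightarrow> 'v)) set) \<Rightarrow> complex vec) \<Rightarrow>
    complex mat \<times> ('v \<Rightarrow> complex vec)" where
  "config_pair F r \<phi> =
     (mat r r (\<lambda>(i, j). \<phi> (H0_mult F (\<lambda>z. z) (inv_into (H0_coker F) \<phi> (unit_vec r j))) $ i),
      \<lambda>v. \<phi> (coker_proj F (\<lambda>_. v)))"

definition config :: "nat \<Rightarrow> nat \<Rightarrow> (nat \<Rightarrow> 'v \<Rightarrow> 'v) \<Rightarrow>
    (complex mat \<times> ('v \<Rightarrow> complex vec)) set" where
  "config l r a =
     Conf_class r (config_pair (eval l a) r (SOME \<phi>. H0_iso (eval l a) r \<phi>))"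

end

end

theory Submission
  imports Defs "HOL-Complex_Analysis.Complex_Analysis"
begin

text \<open>
  In coordinates \<open>f\<close> is a matrix of polynomials. Fix \<open>\<rho> < 1\<close> such that \<open>f(z)\<close> is invertible for
  \<open>\<rho> \<le> |z| \<le> 1\<close>. For a vector \<open>l\<close> of holomorphic functions, the mean of
  \<open>l(z) \<bullet> f(z)\<^sup>-\<^sup>1 g(z)\<close> over the circle of radius \<open>\<rho>\<close> (with respect to \<open>dz / 2 \<pi> i\<close>) is a functional of
  \<open>g\<close> that vanishes on \<open>f \<O>(B)\<close>, and suitable \<open>l\<^sub>1, \<dots>, l\<^sub>r\<close> identify
  \<open>H\<^sup>0(Coker f) = \<O>(B) / f \<O>(B)\<close> with \<open>\<complex>\<^sup>r\<close>; they are built by splitting off one zero of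
  \<open>det f\<close> at a time. If \<open>f\<close> varies a little while \<open>\<rho>\<close> and the \<open>l\<^sub>t\<close> stay fixed, the functionals vary
  continuously and remain independent, and the quotient still has dimension \<open>r\<close>. Hence they still give
  an isomorphism to \<open>\<complex>\<^sup>r\<close>, and in this coordinate the pair \<open>(A, \<iota>)\<close> is a continuous function of \<open>f\<close>,
  which is a local lift of the configuration map to the space before the quotient by \<open>GL\<^sub>r\<close>.
\<close>

hide_const (open) Determinants.det Finite_Cartesian_Product.mat Finite_Cartesian_Product.vec
no_notation Finite_Cartesian_Product.vec_nth (infixl \<open>$\<close> 90)
no_notation inner (infix \<open>\<bullet>\<close> 70)
no_notation fps_nth (infixl \<open>$\<close> 75)

section \<open>Means over circles\<close>

text \<open>The isomorphism in \<open>config\<close> is picked for every \<open>f\<close> by a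
  choice operator, so it has no continuity in \<open>f\<close>. Only its class is under control, and
  a representative that moves continuously has to be constructed. The integrals provide one because
  \<open>f\<close> enters them only through its values on a fixed compact circle.

  The circle must enclose the zeros of \<open>det f\<close> in the disc for all nearby
  \<open>f\<close> as well. These zeros move, but none can enter the compact annulus between the
  circle and the unit circle as long as \<open>det f\<close> is nonzero there, and their number is
  \<open>r\<close> by the definition of the polynomial space. This keeps the dimension of the
  quotient from jumping.

  A second obstacle is that the cokernel is a sheafification, whose global sections are not by
  definition a quotient of global functions. Two facts close the gap: away from the zeros the stalks
  vanish, and by Cramer's rule \<open>det f\<close> times any vector function lies in the image of
  \<open>f\<close>, so that polynomial interpolation at the zeros reaches every section.\<close>

definition circle_mean :: "real \<Rightarrow> (complex \<Rightarrow> complex) \<Rightarrow> complex" where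
  "circle_mean \<rho> h = contour_integral (circlepath 0 \<rho>) h / (2 * of_real pi * \<i>)"

lemma circle_mean_cong:
  assumes "0 < \<rho>" and "\<And>z. norm z = \<rho> \<Longrightarrow> h z = k z"
  shows "circle_mean \<rho> h = circle_mean \<rho> k"
  unfolding circle_mean_def using assms by (auto intro!: contour_integral_eq simp: path_image_circlepath sphere_def)

lemma circle_mean_add:
  assumes "0 < \<rho>" "continuous_on (sphere 0 \<rho>) h" "continuous_on (sphere 0 \<rho>) k"
  shows "circle_mean \<rho> (\<lambda>z. h z + k z) = circle_mean \<rho> h + circle_mean \<rho> k"
  unfolding circle_mean_def
  using assms by (subst contour_integral_add)
     (auto intro!: contour_integrable_continuous_circlepath simp: add_divide_distrib)

lemma circle_mean_cmul:
  assumes "0 < \<rho>" "continuous_on (sphere 0 \<rho>) h"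
  shows "circle_mean \<rho> (\<lambda>z. c * h z) = c * circle_mean \<rho> h"
  unfolding circle_mean_def
  using assms by (subst contour_integral_lmul)
     (auto intro!: contour_integrable_continuous_circlepath)

lemma circle_mean_0 [simp]: "circle_mean \<rho> (\<lambda>z. 0) = 0"
  by (simp add: circle_mean_def)

lemma circle_mean_diff:
  assumes "0 < \<rho>" "continuous_on (sphere 0 \<rho>) h" "continuous_on (sphere 0 \<rho>) k"
  shows "circle_mean \<rho> (\<lambda>z. h z - k z) = circle_mean \<rho> h - circle_mean \<rho> k"
  using circle_mean_add[OF assms(1,2), of "\<lambda>z. (-1) * k z"] circle_mean_cmul[OF assms(1,3), of "-1"] assms(3)
  by (simp add: continuous_on_minus)

lemma circle_mean_sum:
  assumes "0 < \<rho>" "finite I" "\<And>i. i \<in> I \<Longrightarrow> continuous_on (sphere 0 \<rho>) (h i)"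
  shows "circle_mean \<rho> (\<lambda>z. \<Sum>i\<in>I. c i * h i z) = (\<Sum>i\<in>I. c i * circle_mean \<rho> (h i))"
  using assms(2,3)
proof (induction I rule: finite_induct)
  case (insert i I)
  have "circle_mean \<rho> (\<lambda>z. \<Sum>i\<in>insert i I. c i * h i z) =
      circle_mean \<rho> (\<lambda>z. c i * h i z + (\<Sum>i\<in>I. c i * h i z))"
    using insert by simp
  also have "\<dots> = circle_mean \<rho> (\<lambda>z. c i * h i z) + circle_mean \<rho> (\<lambda>z. \<Sum>i\<in>I. c i * h i z)"
    using insert assms(1) by (intro circle_mean_add continuous_intros) auto
  finally show ?case
    using insert assms(1) by (simp add: circle_mean_cmul)
qed simp

lemma circle_mean_holomorphic:
  assumes "0 < \<rho>" "\<rho> < 1" "h holomorphic_on ball 0 1"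
  shows "circle_mean \<rho> h = 0"
proof -
  have "(h has_contour_integral 0) (circlepath 0 \<rho>)"
    using assms by (intro Cauchy_theorem_disc_simple[of h 0 1]) (auto simp: path_image_circlepath)
  then show ?thesis by (simp add: circle_mean_def contour_integral_unique)
qed

lemma circle_mean_Cauchy:
  assumes "\<rho> < 1" "h holomorphic_on ball 0 1" "norm a < \<rho>"
  shows "circle_mean \<rho> (\<lambda>z. h z / (z - a)) = h a"
proof -
  have "((\<lambda>z. h z / (z - a)) has_contour_integral 2 * of_real pi * \<i> * h a) (circlepath 0 \<rho>)"
    using assms by (intro Cauchy_integral_circlepath_simple holomorphic_on_subset[OF assms(2)]) auto
  then show ?thesis by (simp add: circle_mean_def contour_integral_unique)
qed

text \<open>The parametrisation turns the contour integral into an integral over a compact interval,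
  where joint continuity suffices. The parameter space is only topological because it will consist
  of coefficient arrays with the product topology.\<close>

lemma continuous_on_circle_mean:
  fixes h :: "'a::topological_space \<Rightarrow> complex \<Rightarrow> complex"
  assumes "0 < \<rho>" "continuous_on (S \<times> sphere 0 \<rho>) (\<lambda>(c, z). h c z)"
  shows "continuous_on S (\<lambda>c. circle_mean \<rho> (h c))"
proof -
  have "continuous_on S (\<lambda>c. integral (cbox 0 1) (\<lambda>x. h c (circlepath 0 \<rho> x) *
    (2 * of_real pi * \<i> * \<rho> * exp (2 * of_real pi * \<i> * x))))"
  proof (rule integral_continuous_on_param)
    have "continuous_on (S \<times> cbox 0 1) (\<lambda>p. (\<lambda>(c, z). h c z) (fst p, circlepath 0 \<rho> (snd p)))"
      by (rule continuous_on_compose2[OF assms(2)])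
        (use assms(1) in \<open>auto intro!: continuous_intros simp: circlepath_def part_circlepath_def linepath_def norm_mult\<close>)
    then show "continuous_on (S \<times> cbox 0 1) (\<lambda>(c, x). h c (circlepath 0 \<rho> x) *
      (2 * of_real pi * \<i> * \<rho> * exp (2 * of_real pi * \<i> * x)))"
      by (auto intro!: continuous_intros simp: case_prod_unfold)
  qed
  then have "continuous_on S (\<lambda>c. contour_integral (circlepath 0 \<rho>) (h c))"
    unfolding contour_integral_integral vector_derivative_circlepath by simp
  then show ?thesis
    unfolding circle_mean_def by (intro continuous_intros) simp_all
qed

section \<open>Matrix-valued functions\<close>

text \<open>The adjugate formula makes every entry of the inverse a rational function of the entries
  of \<open>A\<close>, so holomorphy in \<open>z\<close> and continuity in the coefficients both
  follow from ring operations and one division.\<close>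

definition mat_inv :: "complex mat \<Rightarrow> complex mat" where
  "mat_inv A = (1 / det A) \<cdot>\<^sub>m adj_mat A"

lemma mat_inv_carrier [simp]: "A \<in> carrier_mat n n \<Longrightarrow> mat_inv A \<in> carrier_mat n n"
  by (simp add: mat_inv_def adj_mat)

lemma mat_inv_mult:
  assumes "A \<in> carrier_mat n n" "det A \<noteq> 0"
  shows "mat_inv A * A = 1\<^sub>m n" "A * mat_inv A = 1\<^sub>m n"
  using assms adj_mat[OF assms(1)]
  by (auto simp: mat_inv_def mult_smult_assoc_mat[where nr=n and n=n and nc=n] mult_smult_distrib[where nr=n and n=n and nc=n])

lemma mat_inv_solve:
  assumes "A \<in> carrier_mat n n" "det A \<noteq> 0" "y \<in> carrier_vec n"
  shows "mat_inv A *\<^sub>v (A *\<^sub>v y) = y" "A *\<^sub>v (mat_inv A *\<^sub>v y) = y"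
  using assms mat_inv_mult[OF assms(1,2)]
  by (auto simp flip: assoc_mult_mat_vec[where n\<^sub>1=n and n\<^sub>2=n and n\<^sub>3=n])

lemma mult_mat_unit_vec:
  assumes "A \<in> carrier_mat m n" "i < m" "k < n"
  shows "((A :: complex mat) *\<^sub>v unit_vec n k) $ i = A $$ (i, k)"
  using assms by simp

text \<open>Determinant, adjugate and inverse are needed twice: for matrices holomorphic in
  \<open>z\<close> and for matrices continuous in \<open>z\<close> and the coefficients. Both kinds
  of entries are closed under the same four operations, so the entrywise calculus is done
  once.\<close>

locale function_algebra =
  fixes S :: "'a set" and C :: "('a \<Rightarrow> complex) \<Rightarrow> bool"
  assumes const: "C (\<lambda>_. c)"
    and add: "C f \<Longrightarrow> C g \<Longrightarrow> C (\<lambda>x. f x + g x)"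
    and mult: "C f \<Longrightarrow> C g \<Longrightarrow> C (\<lambda>x. f x * g x)"
    and inverse: "C f \<Longrightarrow> (\<And>x. x \<in> S \<Longrightarrow> f x \<noteq> 0) \<Longrightarrow> C (\<lambda>x. 1 / f x)"
begin

text \<open>Dimensions are demanded at every point, also outside \<open>S\<close>, so that carrier
  facts can be used without checking membership; only the regularity of the entries refers to
  \<open>S\<close>.\<close>

definition C_vec :: "nat \<Rightarrow> ('a \<Rightarrow> complex vec) \<Rightarrow> bool" where
  "C_vec n g \<longleftrightarrow> (\<forall>x. g x \<in> carrier_vec n) \<and> (\<forall>i<n. C (\<lambda>x. g x $ i))"

definition C_mat :: "nat \<Rightarrow> ('a \<Rightarrow> complex mat) \<Rightarrow> bool" where
  "C_mat n F \<longleftrightarrow> (\<forall>x. F x \<in> carrier_mat n n) \<and> (\<forall>i<n. \<forall>j<n. C (\<lambda>x. F x $$ (i, j)))"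

lemma sum: "(\<And>i. i \<in> I \<Longrightarrow> C (f i)) \<Longrightarrow> C (\<lambda>x. \<Sum>i\<in>I. f i x)"
  by (induction I rule: infinite_finite_induct) (auto intro: const add)

lemma prod: "(\<And>i. i \<in> I \<Longrightarrow> C (f i)) \<Longrightarrow> C (\<lambda>x. \<Prod>i\<in>I. f i x)"
  by (induction I rule: infinite_finite_induct) (auto intro: const mult)

lemma det:
  assumes "C_mat n F"
  shows "C (\<lambda>x. det (F x))"
proof -
  have "C (\<lambda>x. F x $$ (i, p i))" if "p permutes {0..<n}" "i \<in> {0..<n}" for p i
  proof -
    have "p i < n" using that permutes_in_image[OF that(1), of i] by simp
    then show ?thesis using assms that by (auto simp: C_mat_def)
  qed
  then have "C (\<lambda>x. \<Sum>p\<in>{p. p permutes {0..<n}}. signof p * (\<Prod>i = 0..<n. F x $$ (i, p i)))"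
    by (intro sum mult prod const) auto
  then show ?thesis using assms by (simp add: C_mat_def det_def'[where n=n])
qed

lemma cofactor:
  assumes F: "C_mat n F" and "i < n" "j < n"
  shows "C (\<lambda>x. cofactor (F x) i j)"
proof -
  have dim: "dim_row (F x) = n" "dim_col (F x) = n" for x using F by (auto simp: C_mat_def)
  have "C_mat (n - 1) (\<lambda>x. mat_delete (F x) i j)"
    using F by (auto simp: C_mat_def mat_delete_def dim)
  then show ?thesis unfolding cofactor_def by (intro mult const det)
qed

lemma scalar_prod:
  assumes "C_vec n f" "C_vec n g"
  shows "C (\<lambda>x. f x \<bullet> g x)"
proof -
  have dim: "dim_vec (g x) = n" for x using assms by (auto simp: C_vec_def)
  show ?thesis unfolding scalar_prod_def dim using assms by (auto simp: C_vec_def intro!: sum mult)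
qed

lemma mult_mat_vec:
  assumes "C_mat n F" "C_vec n g"
  shows "C_vec n (\<lambda>x. F x *\<^sub>v g x)"
proof -
  have dim: "dim_row (F x) = n" "dim_col (F x) = n" for x using assms by (auto simp: C_mat_def)
  have "C_vec n (\<lambda>x. row (F x) i)" if "i < n" for i
    using assms(1) that by (auto simp: C_vec_def C_mat_def dim)
  then show ?thesis
    using scalar_prod[OF _ assms(2)] assms(1) by (auto simp: C_vec_def mult_mat_vec_def dim)
qed

lemma adj_mat:
  assumes F: "C_mat n F"
  shows "C_mat n (\<lambda>x. adj_mat (F x))"
  unfolding C_mat_def
proof (intro conjI allI impI)
  have dim: "dim_row (F x) = n" "dim_col (F x) = n" for x using assms by (auto simp: C_mat_def)
  show "adj_mat (F x) \<in> carrier_mat n n" for x by (simp add: adj_mat_def dim)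
  show "C (\<lambda>x. adj_mat (F x) $$ (i, j))" if "i < n" "j < n" for i j
    using cofactor[OF F that(2,1)] that by (simp add: adj_mat_def dim)
qed

lemma mat_inv:
  assumes F: "C_mat n F" and "\<And>x. x \<in> S \<Longrightarrow> det (F x) \<noteq> 0"
  shows "C_mat n (\<lambda>x. mat_inv (F x))"
proof -
  have *: "C (\<lambda>x. 1 / det (F x))" by (intro inverse det[OF F] assms)
  have dim: "dim_row (F x) = n" "dim_col (F x) = n" for x using assms by (auto simp: C_mat_def)
  have dim': "dim_row (adj_mat (F x)) = n" "dim_col (adj_mat (F x)) = n" for x by (auto simp: adj_mat_def dim)
  show ?thesis using adj_mat[OF F] mult[OF *]
    unfolding C_mat_def mat_inv_def by (auto simp: dim')
qed

lemma smult_vec: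
  assumes "C f" "C_vec n g"
  shows "C_vec n (\<lambda>x. f x \<cdot>\<^sub>v g x)"
proof -
  have dim: "dim_vec (g x) = n" for x using assms by (auto simp: C_vec_def)
  show ?thesis using assms by (auto simp: C_vec_def dim intro: mult)
qed

lemma mult_mat:
  assumes "C_mat n F" "C_mat n G"
  shows "C_mat n (\<lambda>x. F x * G x)"
  unfolding C_mat_def
proof (intro conjI allI impI)
  have dim: "dim_row (F x) = n" "dim_col (F x) = n" "dim_row (G x) = n" "dim_col (G x) = n" for x
    using assms by (auto simp: C_mat_def)
  show "F x * G x \<in> carrier_mat n n" for x
    using assms by (intro mult_carrier_mat[where n=n]) (auto simp: C_mat_def)
  fix i j assume ij: "i < n" "j < n"
  have "C_vec n (\<lambda>x. row (F x) i)" "C_vec n (\<lambda>x. col (G x) j)"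
    using assms ij by (auto simp: C_vec_def C_mat_def dim)
  from scalar_prod[OF this] show "C (\<lambda>x. (F x * G x) $$ (i, j))" using ij by (simp add: dim)
qed

end

interpretation holo: function_algebra U "\<lambda>f. f holomorphic_on U" for U
  by unfold_locales (auto intro!: holomorphic_intros)

interpretation cont: function_algebra S "continuous_on S" for S :: "'a::topological_space set"
  by unfold_locales (auto intro!: continuous_intros)

abbreviation "hol_vec \<equiv> holo.C_vec"
abbreviation "hol_mat \<equiv> holo.C_mat"

lemma hol_vec_subset: "hol_vec U n g \<Longrightarrow> W \<subseteq> U \<Longrightarrow> hol_vec W n g"
  by (auto simp: holo.C_vec_def intro: holomorphic_on_subset)

lemma hol_mat_subset: "hol_mat U n g \<Longrightarrow> W \<subseteq> U \<Longrightarrow> hol_mat W n g"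
  unfolding holo.C_mat_def using holomorphic_on_subset by blast

section \<open>Division by linear factors and Newton interpolation\<close>

lemma holomorphic_factor:
  assumes "g holomorphic_on U" "open U"
  obtains q where "q holomorphic_on U" "\<And>z. z \<in> U \<Longrightarrow> g z = g x + (z - x) * q z"
proof
  show "(\<lambda>z. if z = x then deriv g x else (g z - g x) / (z - x)) holomorphic_on U"
    by (rule pole_lemma_open[OF assms])
qed auto

text \<open>Split off \<open>z - x\<close> at the first node and interpolate the quotient at the
  remaining ones. A node may be repeated, which records the multiplicity of a zero. The exact number
  \<open>length xs\<close> of coefficients matters later: it limits the powers of \<open>A\<close>
  in the surjectivity condition of \<open>Conf_tilde\<close> to those below
  \<open>r\<close>.\<close>

lemma Newton_interpolation:
  assumes "g holomorphic_on U" "open U"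
  obtains c q where "q holomorphic_on U"
    "\<And>z. z \<in> U \<Longrightarrow> g z = (\<Sum>i<length xs. c i * z ^ i) + (\<Prod>x\<leftarrow>xs. z - x) * q z"
  using assms(1)
proof (induction xs arbitrary: g thesis)
  case Nil
  show ?case using Nil(1)[of g] Nil(2) by simp
next
  case (Cons x xs)
  obtain h where h: "h holomorphic_on U" "\<And>z. z \<in> U \<Longrightarrow> g z = g x + (z - x) * h z"
    using holomorphic_factor[OF Cons.prems(2) assms(2)] by metis
  obtain c q where q: "q holomorphic_on U"
    "\<And>z. z \<in> U \<Longrightarrow> h z = (\<Sum>i<length xs. c i * z ^ i) + (\<Prod>x\<leftarrow>xs. z - x) * q z"
    using Cons.IH[OF _ h(1)] by metis
  \<comment> \<open>Coefficients of \<open>g x + (z - x) * (\<Sum>i<length xs. c i * z ^ i)\<close>: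
    a shift for the factor \<open>z\<close>, minus \<open>x\<close> times the old ones. The cutoff
    is there because \<open>c\<close> is arbitrary from \<open>length xs\<close> on.\<close>
  let ?d = "\<lambda>i. (case i of 0 \<Rightarrow> g x | Suc k \<Rightarrow> c k) - x * (if i < length xs then c i else 0)"
  show ?case
  proof (rule Cons.prems(1)[OF q(1), of ?d])
    fix z assume z: "z \<in> U"
    have "(\<Sum>i<Suc (length xs). (case i of 0 \<Rightarrow> g x | Suc k \<Rightarrow> c k) * z ^ i)
      = g x + z * (\<Sum>i<length xs. c i * z ^ i)"
      by (subst sum.lessThan_Suc_shift) (simp add: sum_distrib_left mult_ac)
    moreover have "(\<Sum>i<Suc (length xs). x * (if i < length xs then c i else 0) * z ^ i)
      = x * (\<Sum>i<length xs. c i * z ^ i)"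
      by (simp add: sum_distrib_left mult_ac)
    ultimately have S: "(\<Sum>i<Suc (length xs). ?d i * z ^ i) = g x + (z - x) * (\<Sum>i<length xs. c i * z ^ i)"
      by (simp only: left_diff_distrib sum_subtractf) (simp add: algebra_simps)
    then show "g z = (\<Sum>i<length (x # xs). ?d i * z ^ i) + (\<Prod>y\<leftarrow>x # xs. z - y) * q z"
      unfolding length_Cons S h(2)[OF z] q(2)[OF z] by (simp add: algebra_simps)
  qed
qed

section \<open>Dual systems for the quotient by a matrix of holomorphic functions\<close>

text \<open>Both values at \<open>x\<close> are limits along the punctured neighbourhood. This
  recovers identities at a zero of the determinant after cancelling a factor that vanishes
  there.\<close>

lemma continuous_on_eq_at:
  fixes f g :: "complex \<Rightarrow> 'a::t2_space"
  assumes "continuous_on U f" "continuous_on U g" "open U" "x \<in> U"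
    and eq: "\<And>z. z \<in> U \<Longrightarrow> z \<noteq> x \<Longrightarrow> f z = g z"
  shows "f x = g x"
proof -
  have f: "(f \<longlongrightarrow> f x) (at x)" and g: "(g \<longlongrightarrow> g x) (at x)"
    using assms by (simp_all add: continuous_on_eq_continuous_at isCont_def)
  have "eventually (\<lambda>z. f z = g z) (at x)"
    using assms(3,4) eq by (auto simp: eventually_at_topological)
  then have "(g \<longlongrightarrow> f x) (at x)" using f by (simp cong: tendsto_cong)
  then show ?thesis using g by (metis tendsto_unique at_neq_bot)
qed

text \<open>A residue pairing: the sum over \<open>norm z < \<rho>\<close> of the residues of
  \<open>l\<close> times the inverse of \<open>F\<close> times \<open>g\<close>, for holomorphic
  data with \<open>det (F z)\<close> nonzero on the circle. The scalar product is bilinear, without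
  conjugation.\<close>

definition dual_pairing ::
  "real \<Rightarrow> (complex \<Rightarrow> complex mat) \<Rightarrow> (complex \<Rightarrow> complex vec) \<Rightarrow> (complex \<Rightarrow> complex vec) \<Rightarrow> complex" where
  "dual_pairing \<rho> F l g = circle_mean \<rho> (\<lambda>z. l z \<bullet> (mat_inv (F z) *\<^sub>v g z))"

locale regular_on_circle =
  fixes n :: nat and \<rho> :: real and F :: "complex \<Rightarrow> complex mat"
  assumes F: "hol_mat (ball 0 1) n F" and \<rho>: "0 < \<rho>" "\<rho> < 1"
    and det_circle: "\<And>z. norm z = \<rho> \<Longrightarrow> det (F z) \<noteq> 0"
begin

lemma F_carrier [simp]: "F z \<in> carrier_mat n n"
  using F by (simp add: holo.C_mat_def)

lemma F_dim [simp]: "dim_row (F z) = n" "dim_col (F z) = n"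
  using carrier_matD[OF F_carrier] by simp_all

lemma sphere_subset: "sphere 0 \<rho> \<subseteq> ball (0::complex) 1"
  using \<rho> by auto

text \<open>The holomorphic calculus is applied on the circle itself, the place where
  \<open>F\<close> is known to be invertible. On this set, which is not open,
  \<open>holomorphic_on\<close> means differentiability within the set, and that is enough for
  continuity.\<close>

lemma integrand_continuous:
  assumes "hol_vec (ball 0 1) n l" "hol_vec (ball 0 1) n g"
  shows "continuous_on (sphere 0 \<rho>) (\<lambda>z. l z \<bullet> (mat_inv (F z) *\<^sub>v g z))"
  by (intro holomorphic_on_imp_continuous_on holo.scalar_prod[where n=n] holo.mult_mat_vec holo.mat_inv
     hol_vec_subset[OF _ sphere_subset] hol_mat_subset[OF _ sphere_subset] assms F) (simp add: det_circle)

lemma dual_pairing_cong: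
  assumes "\<And>z. norm z = \<rho> \<Longrightarrow> g z = h z"
  shows "dual_pairing \<rho> F l g = dual_pairing \<rho> F l h"
  unfolding dual_pairing_def using \<rho> assms by (intro circle_mean_cong) auto

text \<open>On the circle \<open>F\<close> cancels against its inverse, and Cauchy's theorem applies
  to the holomorphic function that remains.\<close>

lemma dual_pairing_image:
  assumes "hol_vec (ball 0 1) n l" "hol_vec (ball 0 1) n h"
  shows "dual_pairing \<rho> F l (\<lambda>z. F z *\<^sub>v h z) = 0"
proof -
  have "dual_pairing \<rho> F l (\<lambda>z. F z *\<^sub>v h z) = circle_mean \<rho> (\<lambda>z. l z \<bullet> h z)"
    unfolding dual_pairing_def using \<rho> det_circle assms(2)
    by (intro circle_mean_cong) (auto simp: mat_inv_solve[where n=n] holo.C_vec_def)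
  also have "\<dots> = 0"
    by (intro circle_mean_holomorphic \<rho> holo.scalar_prod[where n=n] assms)
  finally show ?thesis .
qed

lemma dual_pairing_add:
  assumes "hol_vec (ball 0 1) n l" "hol_vec (ball 0 1) n g" "hol_vec (ball 0 1) n h"
  shows "dual_pairing \<rho> F l (\<lambda>z. g z + h z) = dual_pairing \<rho> F l g + dual_pairing \<rho> F l h"
proof -
  have *: "l z \<bullet> (mat_inv (F z) *\<^sub>v (g z + h z)) = l z \<bullet> (mat_inv (F z) *\<^sub>v g z) + l z \<bullet> (mat_inv (F z) *\<^sub>v h z)" for z
    using assms mult_mat_vec_carrier[OF mat_inv_carrier[OF F_carrier[of z]]]
    by (simp add: holo.C_vec_def mult_add_distrib_mat_vec[where nr=n and nc=n] scalar_prod_add_distrib[where n=n])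
  show ?thesis unfolding dual_pairing_def * by (intro circle_mean_add \<rho> integrand_continuous assms)
qed

lemma dual_pairing_smult:
  assumes "hol_vec (ball 0 1) n l" "hol_vec (ball 0 1) n g"
  shows "dual_pairing \<rho> F l (\<lambda>z. c \<cdot>\<^sub>v g z) = c * dual_pairing \<rho> F l g"
proof -
  have *: "l z \<bullet> (mat_inv (F z) *\<^sub>v (c \<cdot>\<^sub>v g z)) = c * (l z \<bullet> (mat_inv (F z) *\<^sub>v g z))" for z
    using assms mult_mat_vec_carrier[OF mat_inv_carrier[OF F_carrier[of z]]]
    by (simp add: holo.C_vec_def mult_mat_vec[where nr=n and nc=n] scalar_prod_smult_distrib[where n=n])
  show ?thesis unfolding dual_pairing_def * by (intro circle_mean_cmul \<rho> integrand_continuous assms)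
qed

end

text \<open>Induction on the zeros of the determinant: a zero \<open>x\<close> gives a kernel vector \<open>v\<close> of \<open>F x\<close> with
  \<open>v $ j = 1\<close>, and \<open>F = F' E\<close> with \<open>E z = 1 + (z - x - 1) v e\<^sub>j\<^sup>T\<close> and \<open>det (E z) = z - x\<close>.\<close>

locale elementary_factor =
  fixes n j :: nat and v :: "complex vec" and x :: complex
  assumes j: "j < n" and v: "v \<in> carrier_vec n" and vj: "v $ j = 1"
begin

definition E :: "complex \<Rightarrow> complex mat" where
  "E z = mat n n (\<lambda>(i, k). (if i = k then 1 else 0) + (if k = j then (z - x - 1) * v $ i else 0))"

lemma E_carrier [simp]: "E z \<in> carrier_mat n n"
  by (simp add: E_def)

lemma dim_v [simp]: "dim_vec v = n" using v by simp

lemma E_mult_vec: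
  assumes "y \<in> carrier_vec n"
  shows "E z *\<^sub>v y = y + ((z - x - 1) * y $ j) \<cdot>\<^sub>v v"
proof (intro eq_vecI)
  fix i assume "i < dim_vec (y + ((z - x - 1) * y $ j) \<cdot>\<^sub>v v)"
  then have i: "i < n" by simp
  have "(E z *\<^sub>v y) $ i = (\<Sum>k\<in>{0..<n}. (if i = k then y $ k else 0) + (if k = j then (z - x - 1) * v $ i * y $ k else 0))"
    using i assms by (auto simp: E_def scalar_prod_def algebra_simps intro!: sum.cong)
  also have "\<dots> = y $ i + (z - x - 1) * v $ i * y $ j"
    using i j by (simp add: sum.distrib)
  finally show "(E z *\<^sub>v y) $ i = (y + ((z - x - 1) * y $ j) \<cdot>\<^sub>v v) $ i"
    using i assms by simp
qed (simp add: E_def)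

text \<open>Because \<open>v $ j = 1\<close>, row \<open>j\<close> is \<open>z - x\<close> times a
  unit vector, and deleting row and column \<open>j\<close> leaves an identity matrix.\<close>

lemma det_E: "det (E z) = z - x"
proof -
  have "mat_delete (E z) j j = 1\<^sub>m (n - 1)"
    using j by (auto simp: mat_delete_def E_def intro!: eq_matI)
  then have "cofactor (E z) j j = 1" by (simp add: cofactor_def)
  moreover have "det (E z) = (\<Sum>k<n. E z $$ (j, k) * cofactor (E z) j k)"
    by (rule laplace_expansion_row[OF E_carrier j])
  moreover have "(\<Sum>k<n. E z $$ (j, k) * cofactor (E z) j k) = (\<Sum>k<n. if k = j then (z - x) * cofactor (E z) j k else 0)"
    using j vj by (intro sum.cong) (auto simp: E_def)
  ultimately show ?thesis using j by simp
qed

lemma hol_E: "hol_mat U n E"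
proof -
  have "(\<lambda>z. (if i = k then 1 else 0) + (if k = j then (z - x - 1) * v $ i else 0)) holomorphic_on U" for i k
    by (cases "k = j") (auto intro!: holomorphic_intros)
  then show ?thesis by (simp add: holo.C_mat_def E_def)
qed

end

text \<open>The product \<open>F z *\<^sub>v v\<close> vanishes at \<open>x\<close> and is therefore
  divisible by \<open>z - x\<close>. This makes \<open>F\<close> times the inverse of
  \<open>E\<close> extend holomorphically over \<open>x\<close>, although \<open>E x\<close> is
  singular.\<close>

lemma (in regular_on_circle) factor_zero:
  assumes x: "norm x < 1" "det (F x) = 0"
  obtains j v w F' where "elementary_factor n j v" "hol_vec (ball 0 1) n w" "hol_mat (ball 0 1) n F'"
    "\<And>z. z \<in> ball 0 1 \<Longrightarrow> F z *\<^sub>v v = (z - x) \<cdot>\<^sub>v w z"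
    "\<And>z. z \<in> ball 0 1 \<Longrightarrow> F z = F' z * elementary_factor.E n j v x z"
    "\<And>z. z \<in> ball 0 1 \<Longrightarrow> F' z *\<^sub>v v = w z"
proof -
  obtain v0 where v0: "v0 \<in> carrier_vec n" "v0 \<noteq> 0\<^sub>v n" "F x *\<^sub>v v0 = 0\<^sub>v n"
    using det_0_iff_vec_prod_zero_field[OF F_carrier] x(2) by blast
  obtain j where j: "j < n" "v0 $ j \<noteq> 0"
    using v0(1,2) by (metis carrier_vecD eq_vecI index_zero_vec)
  \<comment> \<open>Scaling the kernel vector to \<open>v $ j = 1\<close> turns \<open>v\<close>
    times the \<open>j\<close>-th unit row into a projection; this gives \<open>E\<close> the
    eigenvalue \<open>z - x\<close> on \<open>v\<close>.\<close>
  define v where "v = (1 / v0 $ j) \<cdot>\<^sub>v v0"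
  have v: "v \<in> carrier_vec n" "v $ j = 1" "F x *\<^sub>v v = 0\<^sub>v n"
    using v0 j by (auto simp: v_def mult_mat_vec[where nr=n and nc=n])
  note v1 = v(1) and v3 = v(3)
  interpret elementary_factor n j v x using j v by unfold_locales auto
  have Fv: "hol_vec (ball 0 1) n (\<lambda>z. F z *\<^sub>v v)"
    by (rule holo.mult_mat_vec[OF F]) (simp add: holo.C_vec_def v)
  have "\<exists>q. q holomorphic_on ball 0 1 \<and> (\<forall>z\<in>ball 0 1. (F z *\<^sub>v v) $ i = (z - x) * q z)" if "i < n" for i
  proof -
    have Fvi: "(\<lambda>z. (F z *\<^sub>v v) $ i) holomorphic_on ball 0 1"
      using Fv that unfolding holo.C_vec_def by blast
    obtain q where "q holomorphic_on ball 0 1"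
      "\<And>z. z \<in> ball 0 1 \<Longrightarrow> (F z *\<^sub>v v) $ i = (F x *\<^sub>v v) $ i + (z - x) * q z"
      by (rule holomorphic_factor[of "\<lambda>z. (F z *\<^sub>v v) $ i" "ball 0 1" x])
        (use Fvi in auto)
    then show ?thesis using that v3 by auto
  qed
  then obtain q where q: "\<And>i. i < n \<Longrightarrow> q i holomorphic_on ball 0 1"
    "\<And>i z. i < n \<Longrightarrow> z \<in> ball 0 1 \<Longrightarrow> (F z *\<^sub>v v) $ i = (z - x) * q i z" by metis
  define w where "w z = vec n (\<lambda>i. q i z)" for z
  have w: "hol_vec (ball 0 1) n w" using q(1) by (simp add: holo.C_vec_def w_def)
  have Fw: "F z *\<^sub>v v = (z - x) \<cdot>\<^sub>v w z" if "z \<in> ball 0 1" for z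
    using q(2)[OF _ that] by (intro eq_vecI) (auto simp: w_def)
  \<comment> \<open>The inverse of \<open>E z\<close> is \<open>1\<close> plus
    \<open>1 / (z - x) - 1\<close> times that projection. Multiplying \<open>F\<close> by it changes
    column \<open>j\<close> only, by \<open>w - F v\<close>, and this expression has no
    pole.\<close>
  define F' where "F' z = mat n n (\<lambda>(i, k). F z $$ (i, k) + (if k = j then w z $ i - (F z *\<^sub>v v) $ i else 0))" for z
  have F'c [simp]: "F' z \<in> carrier_mat n n" for z by (simp add: F'_def)
  have "(\<lambda>z. F z $$ (i, k) + (if k = j then w z $ i - (F z *\<^sub>v v) $ i else 0)) holomorphic_on ball 0 1"
    if "i < n" "k < n" for i k
  proof -
    have "(\<lambda>z. F z $$ (i, k)) holomorphic_on ball 0 1" "(\<lambda>z. w z $ i) holomorphic_on ball 0 1"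
      "(\<lambda>z. (F z *\<^sub>v v) $ i) holomorphic_on ball 0 1"
      using F w Fv that unfolding holo.C_mat_def holo.C_vec_def by blast+
    then show ?thesis by (cases "k = j") (auto intro!: holomorphic_intros simp del: index_mult_mat_vec)
  qed
  then have F': "hol_mat (ball 0 1) n F'"
    by (simp add: holo.C_mat_def F'_def del: index_mult_mat_vec)
  have F'_vec: "F' z *\<^sub>v y = F z *\<^sub>v y + y $ j \<cdot>\<^sub>v (w z - F z *\<^sub>v v)" if y: "y \<in> carrier_vec n" for z y
  proof (intro eq_vecI)
    fix i assume "i < dim_vec (F z *\<^sub>v y + y $ j \<cdot>\<^sub>v (w z - F z *\<^sub>v v))"
    then have i: "i < n" using y by simp
    have "(F' z *\<^sub>v y) $ i = (\<Sum>k\<in>{0..<n}. F z $$ (i, k) * y $ k + (if k = j then y $ k * (w z $ i - (F z *\<^sub>v v) $ i) else 0))"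
      using i y by (auto simp: F'_def scalar_prod_def algebra_simps intro!: sum.cong)
    also have "\<dots> = (F z *\<^sub>v y) $ i + y $ j * (w z $ i - (F z *\<^sub>v v) $ i)"
      using i j y by (simp add: sum.distrib scalar_prod_def)
    finally show "(F' z *\<^sub>v y) $ i = (F z *\<^sub>v y + y $ j \<cdot>\<^sub>v (w z - F z *\<^sub>v v)) $ i"
      using i y by simp
  qed (simp add: F'_def)
  have wc: "w z \<in> carrier_vec n" for z by (simp add: w_def)
  have F'v: "F' z *\<^sub>v v = w z" for z
    unfolding F'_vec[OF v1] vj using wc[of z] v by (intro eq_vecI) auto
  have FE: "F z = F' z * E z" if z: "z \<in> ball 0 1" for z
  proof (rule eq_matI)
    fix i k assume "i < dim_row (F' z * E z)" "k < dim_col (F' z * E z)"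
    then have ik: "i < n" "k < n" by (auto simp: F'_def E_def)
    let ?e = "unit_vec n k :: complex vec"
    have "F' z *\<^sub>v (E z *\<^sub>v ?e) = F' z *\<^sub>v ?e + ((z - x - 1) * ?e $ j) \<cdot>\<^sub>v (F' z *\<^sub>v v)"
      by (simp add: E_mult_vec mult_add_distrib_mat_vec[where nr=n and nc=n] mult_mat_vec[where nr=n and nc=n] v)
    also have "\<dots> = F z *\<^sub>v ?e"
      unfolding F'v F'_vec[OF unit_vec_carrier] Fw[OF z] using wc[of z]
      by (intro eq_vecI) (auto simp: algebra_simps)
    finally have "(F z *\<^sub>v ?e) $ i = ((F' z * E z) *\<^sub>v ?e) $ i"
      by (subst assoc_mult_mat_vec[OF F'c E_carrier unit_vec_carrier]) simp
    then show "F z $$ (i, k) = (F' z * E z) $$ (i, k)"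
      using ik by (simp add: mult_mat_unit_vec[OF F_carrier] mult_mat_unit_vec[OF mult_carrier_mat[OF F'c E_carrier]]
         del: assoc_mult_mat_vec index_mult_mat index_mult_mat_vec)
  qed (auto simp: F'_def E_def)
  show thesis
    by (rule that[OF elementary_factor_axioms w F' Fw FE F'v])
qed

text \<open>Linearity in the first argument, in the form needed to correct one functional by
  multiples of others.\<close>

lemma (in regular_on_circle) dual_pairing_comb:
  fixes r :: nat
  assumes "hol_vec (ball 0 1) n l0" "\<And>s. s < r \<Longrightarrow> hol_vec (ball 0 1) n (l s)" "hol_vec (ball 0 1) n g"
  shows "dual_pairing \<rho> F (\<lambda>z. vec n (\<lambda>k. l0 z $ k - (\<Sum>s<r. c s * l s z $ k))) g
    = dual_pairing \<rho> F l0 g - (\<Sum>s<r. c s * dual_pairing \<rho> F (l s) g)"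
proof -
  have gc: "mat_inv (F z) *\<^sub>v g z \<in> carrier_vec n" for z
    using assms(3) mult_mat_vec_carrier[OF mat_inv_carrier[OF F_carrier[of z]]] by (simp add: holo.C_vec_def)
  have *: "vec n (\<lambda>k. l0 z $ k - (\<Sum>s<r. c s * l s z $ k)) \<bullet> y = l0 z \<bullet> y - (\<Sum>s<r. c s * (l s z \<bullet> y))"
    if "y \<in> carrier_vec n" for z y
  proof -
    have "(\<Sum>k = 0..<n. (\<Sum>s<r. c s * l s z $ k) * y $ k) = (\<Sum>s<r. c s * (\<Sum>k = 0..<n. l s z $ k * y $ k))"
      unfolding sum_distrib_left sum_distrib_right by (subst sum.swap) (simp add: mult_ac)
    then show ?thesis using that
      by (simp add: scalar_prod_def left_diff_distrib sum_subtractf)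
  qed
  have "circle_mean \<rho> (\<lambda>z. \<Sum>s<r. c s * (l s z \<bullet> (mat_inv (F z) *\<^sub>v g z)))
    = (\<Sum>s<r. c s * circle_mean \<rho> (\<lambda>z. l s z \<bullet> (mat_inv (F z) *\<^sub>v g z)))"
    using assms \<rho> by (intro circle_mean_sum integrand_continuous) auto
  then show ?thesis
    unfolding dual_pairing_def *[OF gc]
    using assms \<rho> integrand_continuous
    by (subst circle_mean_diff) (auto intro!: continuous_intros)
qed

text \<open>Writing \<open>F = F' E\<close> puts the image of \<open>F\<close> inside the image of
  \<open>F'\<close> with codimension one. The functionals for \<open>F'\<close> are carried over to
  \<open>F\<close>, and one more detects the extra dimension: on \<open>F' h\<close> it reads off
  the value at \<open>x\<close> of the \<open>j\<close>-th coordinate of \<open>h\<close>. That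
  value is zero exactly if \<open>h\<close> is in the image of \<open>E\<close>. Zeros of the
  determinant outside the disc are absorbed in \<open>u\<close>.\<close>

lemma dual_system:
  assumes "0 < \<rho>" "\<rho> < 1" "hol_mat (ball 0 1) n F"
    and u: "u holomorphic_on ball 0 1" "\<And>z. z \<in> ball 0 1 \<Longrightarrow> u z \<noteq> 0"
    and "\<And>z. z \<in> ball 0 1 \<Longrightarrow> det (F z) = (\<Prod>x\<leftarrow>xs. z - x) * u z"
    and "\<And>x. x \<in> set xs \<Longrightarrow> norm x < \<rho>"
  shows "\<exists>l p. (\<forall>s<length xs. hol_vec (ball 0 1) n (l s) \<and> hol_vec (ball 0 1) n (p s)) \<and>
    (\<forall>t<length xs. \<forall>s<length xs. dual_pairing \<rho> F (l t) (p s) = (if s = t then 1 else 0)) \<and>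
    (\<forall>g. hol_vec (ball 0 1) n g \<longrightarrow> (\<forall>t<length xs. dual_pairing \<rho> F (l t) g = 0) \<longrightarrow>
      (\<exists>h. hol_vec (ball 0 1) n h \<and> (\<forall>z\<in>ball 0 1. g z = F z *\<^sub>v h z)))"
  using assms(3,6,7)
proof (induction xs arbitrary: F)
  case Nil
  \<comment> \<open>Without zeros the image is everything: the inverse of \<open>F\<close> is
    holomorphic on the whole disc.\<close>
  have det: "det (F z) \<noteq> 0" if "z \<in> ball 0 1" for z using Nil(2)[OF that] u(2)[OF that] by simp
  have Fc: "F z \<in> carrier_mat n n" for z using Nil(1) by (simp add: holo.C_mat_def)
  have "\<exists>h. hol_vec (ball 0 1) n h \<and> (\<forall>z\<in>ball 0 1. g z = F z *\<^sub>v h z)" if g: "hol_vec (ball 0 1) n g" for g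
  proof (intro exI conjI ballI)
    show "hol_vec (ball 0 1) n (\<lambda>z. mat_inv (F z) *\<^sub>v g z)"
      by (intro holo.mult_mat_vec holo.mat_inv Nil(1) g det)
    show "g z = F z *\<^sub>v (mat_inv (F z) *\<^sub>v g z)" if "z \<in> ball 0 1" for z
      using mat_inv_solve(2)[OF Fc det[OF that]] g by (simp add: holo.C_vec_def)
  qed
  then show ?case by simp
next
  case (Cons x xs)
  let ?B = "ball (0::complex) 1" and ?r = "length xs"
  have x: "norm x < \<rho>" using Cons.prems(3) by simp
  have prod_nz: "(\<Prod>y\<leftarrow>ys. z - y) \<noteq> 0" if "norm z = \<rho>" "set ys \<subseteq> set (x # xs)" for z ys
    using that Cons.prems(3)[of z] by (auto simp: prod_list_zero_iff)
  interpret F: regular_on_circle n \<rho> F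
    using assms(1,2) Cons.prems prod_nz[of _ "x # xs"] u(2) by unfold_locales auto
  have x1: "norm x < 1" using x assms(2) by simp
  have det_x: "det (F x) = 0" using Cons.prems(2)[of x] x assms(2) by simp
  obtain j v w F' where jv: "elementary_factor n j v" and w: "hol_vec ?B n w"
    and F': "hol_mat ?B n F'"
    and Fv: "\<And>z. z \<in> ?B \<Longrightarrow> F z *\<^sub>v v = (z - x) \<cdot>\<^sub>v w z"
    and FE: "\<And>z. z \<in> ?B \<Longrightarrow> F z = F' z * elementary_factor.E n j v x z"
    and F'v: "\<And>z. z \<in> ?B \<Longrightarrow> F' z *\<^sub>v v = w z"
    by (rule F.factor_zero[OF x1 det_x]) blast
  interpret elementary_factor n j v x by (rule jv)
  have F'c: "F' z \<in> carrier_mat n n" for z using F' by (simp add: holo.C_mat_def)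
  have vc: "hol_vec ?B n (\<lambda>z. v)" using v by (simp add: holo.C_vec_def)
  \<comment> \<open>Away from \<open>x\<close> the factor \<open>det (E z) = z - x\<close> cancels;
    at \<open>x\<close> both sides are continuous.\<close>
  have det_F': "det (F' z) = (\<Prod>y\<leftarrow>xs. z - y) * u z" if z: "z \<in> ?B" for z
  proof -
    have off: "det (F' z) = (\<Prod>y\<leftarrow>xs. z - y) * u z" if "z \<in> ?B" "z \<noteq> x" for z
    proof -
      have "det (F' z) * (z - x) = (z - x) * ((\<Prod>y\<leftarrow>xs. z - y) * u z)"
        using Cons.prems(2)[OF that(1)] FE[OF that(1)] det_mult[OF F'c E_carrier] by (simp add: det_E)
      then show ?thesis using that by simp
    qed
    have "det (F' x) = (\<Prod>y\<leftarrow>xs. x - y) * u x"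
    proof (rule continuous_on_eq_at[where U = ?B and f = "\<lambda>z. det (F' z)" and g = "\<lambda>z. (\<Prod>y\<leftarrow>xs. z - y) * u z"])
      show "continuous_on ?B (\<lambda>z. det (F' z))"
        by (intro holomorphic_on_imp_continuous_on holo.det[OF F'])
      have P: "continuous_on ?B (\<lambda>z. \<Prod>y\<leftarrow>ys. z - y)" for ys
        by (induction ys) (auto intro!: continuous_intros)
      show "continuous_on ?B (\<lambda>z. (\<Prod>y\<leftarrow>xs. z - y) * u z)"
        by (intro continuous_on_mult P holomorphic_on_imp_continuous_on[OF u(1)])
    qed (use off x assms(2) in auto)
    with off[OF z] show ?thesis by (cases "z = x") auto
  qed
  interpret F': regular_on_circle n \<rho> F'
    using assms(1,2) F' prod_nz[of _ xs] u(2) det_F' by unfold_locales auto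
  obtain l' p where *: "(\<forall>s<?r. hol_vec ?B n (l' s) \<and> hol_vec ?B n (p s)) \<and>
    (\<forall>t<?r. \<forall>s<?r. dual_pairing \<rho> F' (l' t) (p s) = (if s = t then 1 else 0)) \<and>
    (\<forall>g. hol_vec ?B n g \<longrightarrow> (\<forall>t<?r. dual_pairing \<rho> F' (l' t) g = 0) \<longrightarrow>
      (\<exists>h. hol_vec ?B n h \<and> (\<forall>z\<in>?B. g z = F' z *\<^sub>v h z)))"
    by (rule exE[OF Cons.IH[OF F']], use det_F' Cons.prems(3) in simp, use Cons.prems(3) in simp) blast
  have l': "\<And>s. s < ?r \<Longrightarrow> hol_vec ?B n (l' s)" and p: "\<And>s. s < ?r \<Longrightarrow> hol_vec ?B n (p s)"
    and dual: "\<And>t s. t < ?r \<Longrightarrow> s < ?r \<Longrightarrow> dual_pairing \<rho> F' (l' t) (p s) = (if s = t then 1 else 0)"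
    and sep: "\<And>g. hol_vec ?B n g \<Longrightarrow> (\<And>t. t < ?r \<Longrightarrow> dual_pairing \<rho> F' (l' t) g = 0) \<Longrightarrow>
      \<exists>h. hol_vec ?B n h \<and> (\<forall>z\<in>?B. g z = F' z *\<^sub>v h z)"
    using * by simp_all
  \<comment> \<open>From \<open>F = F' E\<close>, the inverse of \<open>F'\<close> is
    \<open>E\<close> times the inverse of \<open>F\<close> wherever both exist.\<close>
  have inv: "mat_inv (F' z) *\<^sub>v y = E z *\<^sub>v (mat_inv (F z) *\<^sub>v y)"
    if "y \<in> carrier_vec n" "norm z = \<rho>" for y z
  proof -
    have z: "z \<in> ?B" using that assms(2) by simp
    have m: "mat_inv (F z) *\<^sub>v y \<in> carrier_vec n"
      using mult_mat_vec_carrier[OF mat_inv_carrier[OF F.F_carrier] that(1)] .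
    have "F' z *\<^sub>v (E z *\<^sub>v (mat_inv (F z) *\<^sub>v y)) = F z *\<^sub>v (mat_inv (F z) *\<^sub>v y)"
      unfolding FE[OF z] using m FE[OF z] by (simp add: assoc_mult_mat_vec[OF F'c E_carrier])
    also have "\<dots> = y" using mat_inv_solve(2)[OF F.F_carrier F.det_circle] that by blast
    finally show ?thesis
      using mat_inv_solve(1)[OF F'c F'.det_circle[OF that(2)]] mult_mat_vec_carrier[OF E_carrier m] by metis
  qed
  \<comment> \<open>Transposing moves \<open>E\<close> to the other side of the scalar product,
    where together with the inverse of \<open>F\<close> it becomes the inverse of \<open>F'\<close>.
    So \<open>m t\<close> has the same pairing with respect to \<open>F\<close> as
    \<open>l' t\<close> with respect to \<open>F'\<close>.\<close>
  define m where "m t z = transpose_mat (E z) *\<^sub>v l' t z" for t z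
  have m: "hol_vec ?B n (m t)" if "t < ?r" for t
  proof -
    have "hol_mat ?B n (\<lambda>z. transpose_mat (E z))"
      using hol_E[of ?B] by (auto simp: holo.C_mat_def carrier_matD[OF E_carrier])
    then show ?thesis unfolding m_def by (intro holo.mult_mat_vec l' that)
  qed
  have m_pair: "dual_pairing \<rho> F (m t) g = dual_pairing \<rho> F' (l' t) g" if t: "t < ?r" and g: "hol_vec ?B n g" for t g
    unfolding dual_pairing_def
  proof (rule circle_mean_cong[OF assms(1)])
    fix z :: complex assume z: "norm z = \<rho>"
    have gz: "g z \<in> carrier_vec n" and lz: "l' t z \<in> carrier_vec n"
      using g l'[OF t] by (simp_all add: holo.C_vec_def)
    show "m t z \<bullet> (mat_inv (F z) *\<^sub>v g z) = l' t z \<bullet> (mat_inv (F' z) *\<^sub>v g z)"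
      unfolding inv[OF gz z] m_def
      by (rule transpose_vec_mult_scalar[OF E_carrier mult_mat_vec_carrier[OF mat_inv_carrier[OF F.F_carrier] gz] lz])
  qed
  \<comment> \<open>The additional functional comes from the coordinate in which \<open>E\<close>
    acquires its zero.\<close>
  define e :: "complex \<Rightarrow> complex vec" where "e z = unit_vec n j" for z
  have e: "hol_vec ?B n e" by (auto simp: e_def holo.C_vec_def)
  \<comment> \<open>Correction coefficients as in Gram-Schmidt: subtracting \<open>c s\<close> times
    \<open>m s\<close> makes the new functional vanish on the old vectors
    \<open>p s\<close>.\<close>
  define c where "c s = dual_pairing \<rho> F e (p s)" for s
  define l where "l t = (if t < ?r then m t else (\<lambda>z. vec n (\<lambda>k. e z $ k - (\<Sum>s<?r. c s * m s z $ k))))" for t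
  \<comment> \<open>The new vector \<open>w = F' v\<close> spans the image of \<open>F'\<close>
    modulo the image of \<open>F\<close>; it receives the last index \<open>?r\<close>, like the new
    functional.\<close>
  define q where "q s = (if s < ?r then p s else w)" for s
  have hol_l: "hol_vec ?B n (l t)" for t
    using m e by (auto simp: l_def holo.C_vec_def intro!: holomorphic_intros)
  have hol_q: "hol_vec ?B n (q s)" for s using p w by (auto simp: q_def)
  have l_last: "dual_pairing \<rho> F (l ?r) g = dual_pairing \<rho> F e g - (\<Sum>s<?r. c s * dual_pairing \<rho> F (m s) g)"
    if "hol_vec ?B n g" for g
    using F.dual_pairing_comb[OF e m that] by (simp add: l_def)
  \<comment> \<open>The \<open>j\<close>-th coordinate of \<open>E y\<close> is
    \<open>(z - x) * y $ j\<close>, so the integrand is a Cauchy kernel at \<open>x\<close>, which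
    lies inside the circle.\<close>
  have e_pair: "dual_pairing \<rho> F e (\<lambda>z. F' z *\<^sub>v h z) = h x $ j" if h: "hol_vec ?B n h" for h
  proof -
    have hc: "h z \<in> carrier_vec n" for z using h by (simp add: holo.C_vec_def)
    have "e z \<bullet> (mat_inv (F z) *\<^sub>v (F' z *\<^sub>v h z)) = h z $ j / (z - x)" if z: "norm z = \<rho>" for z
    proof -
      let ?y = "mat_inv (F z) *\<^sub>v (F' z *\<^sub>v h z)"
      have y: "?y \<in> carrier_vec n"
        by (rule mult_mat_vec_carrier[OF mat_inv_carrier[OF F.F_carrier] mult_mat_vec_carrier[OF F'c hc]])
      have "h z = E z *\<^sub>v ?y"
        using inv[OF mult_mat_vec_carrier[OF F'c hc] z] mat_inv_solve(1)[OF F'c F'.det_circle[OF z] hc] by metis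
      then have "h z $ j = (E z *\<^sub>v ?y) $ j" by simp
      also have "\<dots> = (z - x) * ?y $ j"
        unfolding E_mult_vec[OF y] using j vj by (simp add: left_diff_distrib del: index_mult_mat_vec)
      finally have "h z $ j = (z - x) * ?y $ j" .
      moreover have "z \<noteq> x" using x z by auto
      moreover have "e z \<bullet> ?y = ?y $ j" unfolding e_def using scalar_prod_left_unit[OF y j] .
      ultimately show ?thesis by simp
    qed
    then have "dual_pairing \<rho> F e (\<lambda>z. F' z *\<^sub>v h z) = circle_mean \<rho> (\<lambda>z. h z $ j / (z - x))"
      unfolding dual_pairing_def by (rule circle_mean_cong[OF assms(1)])
    also have "\<dots> = h x $ j"
      using h j x assms(2) by (intro circle_mean_Cauchy) (auto simp: holo.C_vec_def)
    finally show ?thesis .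
  qed
  \<comment> \<open>The identity \<open>F' v = w\<close> is available on the disc only, but pairings
    see only the circle.\<close>
  have w_eq: "dual_pairing \<rho> G k w = dual_pairing \<rho> G k (\<lambda>z. F' z *\<^sub>v v)" for G k
    unfolding dual_pairing_def using F'v assms(2) by (intro circle_mean_cong[OF assms(1)]) auto
  have dual': "dual_pairing \<rho> F (l t) (q s) = (if s = t then 1 else 0)" if "t < Suc ?r" "s < Suc ?r" for t s
  proof -
    have a: "dual_pairing \<rho> F (m t) (p s) = (if s = t then 1 else 0)" if "t < ?r" "s < ?r" for t s
      using m_pair[OF that(1) p[OF that(2)]] dual[OF that] by simp
    have b: "dual_pairing \<rho> F (m t) w = 0" if "t < ?r" for t
      using m_pair[OF that w] F'.dual_pairing_image[OF l'[OF that] vc] w_eq by simp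
    have c: "dual_pairing \<rho> F (l ?r) (p s) = 0" if "s < ?r" for s
      using that l_last[OF p[OF that]] a by (simp add: c_def if_distrib sum.delta cong: if_cong)
    have d: "dual_pairing \<rho> F (l ?r) w = 1"
      using l_last[OF w] b e_pair[OF vc] w_eq vj by simp
    show ?thesis
      using that a[of t s] b[of t] c[of s] d by (auto simp: q_def l_def less_Suc_eq)
  qed
  have sep': "\<exists>k. hol_vec ?B n k \<and> (\<forall>z\<in>?B. g z = F z *\<^sub>v k z)"
    if g: "hol_vec ?B n g" and zero: "\<And>t. t < Suc ?r \<Longrightarrow> dual_pairing \<rho> F (l t) g = 0" for g
  proof -
    have mz: "dual_pairing \<rho> F (m t) g = 0" if "t < ?r" for t
      using zero[of t] that by (simp add: l_def)
    obtain h where h: "hol_vec ?B n h" and gh: "\<And>z. z \<in> ?B \<Longrightarrow> g z = F' z *\<^sub>v h z"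
      using sep[OF g] mz m_pair[OF _ g] by auto
    have hc: "h z \<in> carrier_vec n" for z using h by (simp add: holo.C_vec_def)
    have "dual_pairing \<rho> F e g = dual_pairing \<rho> F e (\<lambda>z. F' z *\<^sub>v h z)"
      using gh assms(2) by (intro F.dual_pairing_cong) auto
    then have hx: "h x $ j = 0"
      using l_last[OF g] zero[of ?r] mz e_pair[OF h] by simp
    obtain a where a: "a holomorphic_on ?B" "\<And>z. z \<in> ?B \<Longrightarrow> h z $ j = h x $ j + (z - x) * a z"
      by (rule holomorphic_factor[of "\<lambda>z. h z $ j" ?B x]) (use h j in \<open>auto simp: holo.C_vec_def\<close>)
    \<comment> \<open>This is the inverse of \<open>E\<close> applied to \<open>h\<close>. The pole
      at \<open>x\<close> is absent because \<open>h x $ j = 0\<close> lets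
      \<open>h z $ j / (z - x)\<close> extend to \<open>a\<close>.\<close>
    define k where "k z = h z + (a z - h z $ j) \<cdot>\<^sub>v v" for z
    have k: "hol_vec ?B n k"
      using h a(1) j v by (auto simp: k_def holo.C_vec_def intro!: holomorphic_intros)
    have "g z = F z *\<^sub>v k z" if z: "z \<in> ?B" for z
    proof -
      have kc: "k z \<in> carrier_vec n" using k by (simp add: holo.C_vec_def)
      have kj: "k z $ j = a z" using j vj hc[of z] by (simp add: k_def)
      have hj: "h z $ j = (z - x) * a z" using a(2)[OF z] hx by simp
      have "E z *\<^sub>v k z = h z"
        unfolding E_mult_vec[OF kc] kj unfolding k_def hj using hc[of z] v
        by (intro eq_vecI) (auto simp: algebra_simps)
      then show ?thesis
        unfolding gh[OF z] FE[OF z] using assoc_mult_mat_vec[OF F'c E_carrier kc] by simp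
    qed
    with k show ?thesis by blast
  qed
  show ?case
    using hol_l hol_q dual' sep' by (intro exI[of _ l] exI[of _ q]) simp
qed

section \<open>Coordinates on the quotient and Gram matrices\<close>

lemma eq_mult_if_columns_eq:
  assumes "D \<in> carrier_mat r r" "M \<in> carrier_mat r r" "\<And>s. s < r \<Longrightarrow> y s \<in> carrier_vec r"
    and "\<And>s. s < r \<Longrightarrow> col D s = M *\<^sub>v (y s :: complex vec)"
  shows "D = M * mat r r (\<lambda>(i, s). y s $ i)"
proof (rule eq_matI)
  fix i s assume "i < dim_row (M * mat r r (\<lambda>(i, s). y s $ i))" "s < dim_col (M * mat r r (\<lambda>(i, s). y s $ i))"
  then have ij: "i < r" "s < r" using assms by auto
  have "col (mat r r (\<lambda>(i, s). y s $ i)) s = y s" using ij assms(3)[of s] by auto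
  moreover have "D $$ (i, s) = (M *\<^sub>v y s) $ i" using ij assms(1) assms(4)[of s, symmetric] by simp
  ultimately show "D $$ (i, s) = (M * mat r r (\<lambda>(i, s). y s $ i)) $$ (i, s)"
    using ij assms(2) by simp
qed (use assms in auto)

definition lin_comb ::
  "nat \<Rightarrow> nat \<Rightarrow> (nat \<Rightarrow> complex \<Rightarrow> complex vec) \<Rightarrow> complex vec \<Rightarrow> complex \<Rightarrow> complex vec" where
  "lin_comb n r p y z = vec n (\<lambda>k. \<Sum>s<r. y $ s * p s z $ k)"

definition pairing_vec ::
  "real \<Rightarrow> (complex \<Rightarrow> complex mat) \<Rightarrow> nat \<Rightarrow> (nat \<Rightarrow> complex \<Rightarrow> complex vec) \<Rightarrow> (complex \<Rightarrow> complex vec) \<Rightarrow> complex vec" where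
  "pairing_vec \<rho> F r l g = vec r (\<lambda>t. dual_pairing \<rho> F (l t) g)"

definition gram_mat ::
  "real \<Rightarrow> (complex \<Rightarrow> complex mat) \<Rightarrow> nat \<Rightarrow> (nat \<Rightarrow> complex \<Rightarrow> complex vec) \<Rightarrow> (nat \<Rightarrow> complex \<Rightarrow> complex vec) \<Rightarrow> complex mat" where
  "gram_mat \<rho> F r l p = mat r r (\<lambda>(t, s). dual_pairing \<rho> F (l t) (p s))"

lemma pairing_vec_carrier [simp]: "pairing_vec \<rho> F r l g \<in> carrier_vec r"
  by (simp add: pairing_vec_def)

lemma gram_mat_carrier [simp]: "gram_mat \<rho> F r l p \<in> carrier_mat r r"
  by (simp add: gram_mat_def)

lemma col_gram_mat: "s < r \<Longrightarrow> col (gram_mat \<rho> F r l p) s = pairing_vec \<rho> F r l (p s)"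
  by (auto simp: gram_mat_def pairing_vec_def)

lemma hol_lin_comb: "\<forall>s<r. hol_vec U n (p s) \<Longrightarrow> hol_vec U n (lin_comb n r p y)"
  by (auto simp: holo.C_vec_def lin_comb_def intro!: holomorphic_intros)

lemma hol_vec_minus:
  assumes "hol_vec U n g" "hol_vec U n h"
  shows "hol_vec U n (\<lambda>z. g z - h z)"
proof -
  have dim: "dim_vec (h z) = n" for z using assms by (auto simp: holo.C_vec_def)
  have "g z - h z \<in> carrier_vec n" for z using assms by (auto simp: holo.C_vec_def)
  then show ?thesis using assms by (auto simp: holo.C_vec_def dim intro!: holomorphic_intros)
qed

context regular_on_circle
begin

lemma dual_pairing_lin_comb:
  assumes l: "hol_vec (ball 0 1) n l" and "\<forall>s<r. hol_vec (ball 0 1) n (p s)"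
  shows "dual_pairing \<rho> F l (lin_comb n r p y) = (\<Sum>s<r. y $ s * dual_pairing \<rho> F l (p s))"
  using assms(2)
proof (induction r)
  case 0
  have "hol_vec (ball 0 1) n (\<lambda>z. 0\<^sub>v n)" by (simp add: holo.C_vec_def)
  note * = dual_pairing_smult[OF l this, of 0]
  have "(\<lambda>z. 0 \<cdot>\<^sub>v 0\<^sub>v n) = lin_comb n 0 p y" by (auto simp: lin_comb_def fun_eq_iff)
  then show ?case using * by simp
next
  case (Suc r)
  have pr: "hol_vec (ball 0 1) n (p r)" and ps: "\<forall>s<r. hol_vec (ball 0 1) n (p s)" using Suc.prems by auto
  have "lin_comb n (Suc r) p y = (\<lambda>z. lin_comb n r p y z + y $ r \<cdot>\<^sub>v p r z)"
  proof (intro ext eq_vecI)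
    fix z
    have c: "dim_vec (p r z) = n" using pr by (auto simp: holo.C_vec_def)
    show "dim_vec (lin_comb n (Suc r) p y z) = dim_vec (lin_comb n r p y z + y $ r \<cdot>\<^sub>v p r z)"
      by (simp add: lin_comb_def c)
    show "lin_comb n (Suc r) p y z $ i = (lin_comb n r p y z + y $ r \<cdot>\<^sub>v p r z) $ i"
      if "i < dim_vec (lin_comb n r p y z + y $ r \<cdot>\<^sub>v p r z)" for i
      using that by (simp add: lin_comb_def c)
  qed
  moreover have "hol_vec (ball 0 1) n (\<lambda>z. y $ r \<cdot>\<^sub>v p r z)"
    by (intro holo.smult_vec pr) simp
  ultimately show ?case
    using Suc.IH[OF ps] by (simp add: dual_pairing_add[OF l hol_lin_comb[OF ps]] dual_pairing_smult[OF l pr])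
qed

lemma pairing_vec_lin_comb:
  assumes l: "\<forall>s<r. hol_vec (ball 0 1) n (l s)" and p: "\<forall>s<r. hol_vec (ball 0 1) n (p s)"
    and y: "y \<in> carrier_vec r"
  shows "pairing_vec \<rho> F r l (lin_comb n r p y) = gram_mat \<rho> F r l p *\<^sub>v y"
  using y l by (auto simp: pairing_vec_def gram_mat_def dual_pairing_lin_comb[OF _ p] scalar_prod_def atLeast0LessThan
     mult.commute intro!: eq_vecI)

lemma pairing_vec_add:
  assumes "\<forall>s<r. hol_vec (ball 0 1) n (l s)" "hol_vec (ball 0 1) n g" "hol_vec (ball 0 1) n h"
  shows "pairing_vec \<rho> F r l (\<lambda>z. g z + h z) = pairing_vec \<rho> F r l g + pairing_vec \<rho> F r l h"
  using assms by (auto simp: pairing_vec_def dual_pairing_add intro!: eq_vecI)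

lemma pairing_vec_smult:
  assumes "\<forall>s<r. hol_vec (ball 0 1) n (l s)" "hol_vec (ball 0 1) n g"
  shows "pairing_vec \<rho> F r l (\<lambda>z. c \<cdot>\<^sub>v g z) = c \<cdot>\<^sub>v pairing_vec \<rho> F r l g"
  using assms by (auto simp: pairing_vec_def dual_pairing_smult intro!: eq_vecI)

lemma pairing_vec_image:
  assumes "\<forall>s<r. hol_vec (ball 0 1) n (l s)" "hol_vec (ball 0 1) n h"
  shows "pairing_vec \<rho> F r l (\<lambda>z. F z *\<^sub>v h z) = 0\<^sub>v r"
  using assms by (auto simp: pairing_vec_def dual_pairing_image intro!: eq_vecI)

lemma pairing_vec_cong:
  assumes "\<And>z. z \<in> ball 0 1 \<Longrightarrow> g z = h z"
  shows "pairing_vec \<rho> F r l g = pairing_vec \<rho> F r l h"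
  unfolding pairing_vec_def using \<rho> assms by (auto intro!: eq_vecI dual_pairing_cong)

lemma pairing_vec_eq_if_diff_image:
  assumes l: "\<forall>s<r. hol_vec (ball 0 1) n (l s)"
    and g: "hol_vec (ball 0 1) n g" and g': "hol_vec (ball 0 1) n g'" and h: "hol_vec (ball 0 1) n h"
    and eq: "\<And>z. z \<in> ball 0 1 \<Longrightarrow> g z - g' z = F z *\<^sub>v h z"
  shows "pairing_vec \<rho> F r l g = pairing_vec \<rho> F r l g'"
proof -
  have c: "g z \<in> carrier_vec n" "g' z \<in> carrier_vec n" "h z \<in> carrier_vec n" for z
    using g g' h by (auto simp: holo.C_vec_def)
  have "g z = g' z + F z *\<^sub>v h z" if "z \<in> ball 0 1" for z
    unfolding eq[OF that, symmetric] using c[of z] by (intro eq_vecI) auto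
  then have "pairing_vec \<rho> F r l g = pairing_vec \<rho> F r l (\<lambda>z. g' z + F z *\<^sub>v h z)"
    by (rule pairing_vec_cong)
  also have "\<dots> = pairing_vec \<rho> F r l g'"
    using pairing_vec_add[OF l g' holo.mult_mat_vec[OF F h]] pairing_vec_image[OF l h] by simp
  finally show ?thesis .
qed

lemma pairing_vec_minus:
  assumes l: "\<forall>s<r. hol_vec (ball 0 1) n (l s)"
    and g: "hol_vec (ball 0 1) n g" and h: "hol_vec (ball 0 1) n h"
  shows "pairing_vec \<rho> F r l (\<lambda>z. g z - h z) = pairing_vec \<rho> F r l g - pairing_vec \<rho> F r l h"
proof -
  have c: "g z \<in> carrier_vec n" "h z \<in> carrier_vec n" for z
    using g h by (auto simp: holo.C_vec_def)
  have eq: "g z - h z = g z + (-1) \<cdot>\<^sub>v h z" for z using c[of z] by (intro eq_vecI) auto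
  have "hol_vec (ball 0 1) n (\<lambda>z. (-1) \<cdot>\<^sub>v h z)" by (intro holo.smult_vec h) simp
  from pairing_vec_add[OF l g this] pairing_vec_smult[OF l h, where c = "-1"] show ?thesis
    unfolding eq by (auto intro!: eq_vecI simp: pairing_vec_def)
qed

end

text \<open>This is what survives when \<open>F\<close> moves while the families \<open>l\<close>
  and \<open>p\<close> stay fixed: duality weakens to a nonsingular Gram matrix, an open condition
  on \<open>F\<close>. The length of the families is still tied to the number of zeros of
  \<open>det F\<close> in the disc.\<close>

locale dual_basis = regular_on_circle +
  fixes xs :: "complex list" and u :: "complex \<Rightarrow> complex" and l p
  assumes u: "u holomorphic_on ball 0 1" "\<And>z. z \<in> ball 0 1 \<Longrightarrow> u z \<noteq> 0"
    and det_F: "\<And>z. z \<in> ball 0 1 \<Longrightarrow> det (F z) = (\<Prod>x\<leftarrow>xs. z - x) * u z"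
    and xs: "\<And>x. x \<in> set xs \<Longrightarrow> norm x < \<rho>"
    and l: "\<forall>s<length xs. hol_vec (ball 0 1) n (l s)"
    and p: "\<forall>s<length xs. hol_vec (ball 0 1) n (p s)"
    and det_gram: "det (gram_mat \<rho> F (length xs) l p) \<noteq> 0"
begin

abbreviation "rk \<equiv> length xs"

abbreviation "D \<equiv> gram_mat \<rho> F rk l p"

lemma pairing_vec_surj:
  assumes w: "w \<in> carrier_vec rk"
  shows "\<exists>g. hol_vec (ball 0 1) n g \<and> pairing_vec \<rho> F rk l g = w"
proof (intro exI conjI)
  let ?y = "mat_inv D *\<^sub>v w"
  have y: "?y \<in> carrier_vec rk" by (rule mult_mat_vec_carrier[OF mat_inv_carrier[OF gram_mat_carrier] w])
  show "hol_vec (ball 0 1) n (lin_comb n rk p ?y)" by (rule hol_lin_comb[OF p])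
  show "pairing_vec \<rho> F rk l (lin_comb n rk p ?y) = w"
    unfolding pairing_vec_lin_comb[OF l p y] by (rule mat_inv_solve(2)[OF gram_mat_carrier det_gram w])
qed

text \<open>A dimension count. \<open>F\<close> has a dual system of its own with the same number of
  functionals, and these separate the classes. The functionals \<open>l\<close> are combinations of
  them through a square matrix \<open>M\<close>, which is invertible because the Gram matrix of
  \<open>l\<close> is; hence \<open>l\<close> separates classes too.\<close>

lemma pairing_vec_eq_0D:
  assumes g: "hol_vec (ball 0 1) n g" and zero: "pairing_vec \<rho> F rk l g = 0\<^sub>v rk"
  obtains h where "hol_vec (ball 0 1) n h" "\<And>z. z \<in> ball 0 1 \<Longrightarrow> g z = F z *\<^sub>v h z"
proof -
  obtain l' p' where *: "(\<forall>s<rk. hol_vec (ball 0 1) n (l' s) \<and> hol_vec (ball 0 1) n (p' s)) \<and>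
    (\<forall>t<rk. \<forall>s<rk. dual_pairing \<rho> F (l' t) (p' s) = (if s = t then 1 else 0)) \<and>
    (\<forall>g. hol_vec (ball 0 1) n g \<longrightarrow> (\<forall>t<rk. dual_pairing \<rho> F (l' t) g = 0) \<longrightarrow>
      (\<exists>h. hol_vec (ball 0 1) n h \<and> (\<forall>z\<in>ball 0 1. g z = F z *\<^sub>v h z)))"
    using dual_system[OF \<rho> F u] det_F xs by blast
  have l': "\<forall>s<rk. hol_vec (ball 0 1) n (l' s)" and p': "\<forall>s<rk. hol_vec (ball 0 1) n (p' s)"
    and dual: "\<And>t s. t < rk \<Longrightarrow> s < rk \<Longrightarrow> dual_pairing \<rho> F (l' t) (p' s) = (if s = t then 1 else 0)"
    using * by simp_all
  have sep: "\<exists>h. hol_vec (ball 0 1) n h \<and> (\<forall>z\<in>ball 0 1. g z = F z *\<^sub>v h z)"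
    if "hol_vec (ball 0 1) n g" "pairing_vec \<rho> F rk l' g = 0\<^sub>v rk" for g
  proof -
    have "dual_pairing \<rho> F (l' t) g = 0" if "t < rk" for t
      using arg_cong[OF \<open>pairing_vec \<rho> F rk l' g = 0\<^sub>v rk\<close>, of "\<lambda>v. v $ t"] that by (simp add: pairing_vec_def)
    then show ?thesis using * that(1) by blast
  qed
  have one: "gram_mat \<rho> F rk l' p' = 1\<^sub>m rk"
    by (rule eq_matI) (auto simp: gram_mat_def dual)
  define M where "M = gram_mat \<rho> F rk l p'"
  have M: "M \<in> carrier_mat rk rk" by (simp add: M_def)
  \<comment> \<open>Subtracting the expansion of \<open>k\<close> in the vectors \<open>p'\<close>
    leaves a function that all \<open>l'\<close> annihilate. It lies in the image of
    \<open>F\<close>, so the functionals \<open>l\<close> annihilate it as well.\<close>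
  have change: "pairing_vec \<rho> F rk l k = M *\<^sub>v pairing_vec \<rho> F rk l' k" if k: "hol_vec (ball 0 1) n k" for k
  proof -
    let ?c = "lin_comb n rk p' (pairing_vec \<rho> F rk l' k)"
    have c: "hol_vec (ball 0 1) n ?c" by (rule hol_lin_comb[OF p'])
    have "pairing_vec \<rho> F rk l' (\<lambda>z. k z - ?c z) = 0\<^sub>v rk"
      unfolding pairing_vec_minus[OF l' k c] pairing_vec_lin_comb[OF l' p' pairing_vec_carrier] one
      by (auto intro!: eq_vecI)
    from sep[OF hol_vec_minus[OF k c] this] obtain h where "hol_vec (ball 0 1) n h" "\<And>z. z \<in> ball 0 1 \<Longrightarrow> k z - ?c z = F z *\<^sub>v h z"
      by blast
    then have "pairing_vec \<rho> F rk l k = pairing_vec \<rho> F rk l ?c"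
      by (rule pairing_vec_eq_if_diff_image[OF l k c])
    then show ?thesis unfolding M_def pairing_vec_lin_comb[OF l p' pairing_vec_carrier] .
  qed
  \<comment> \<open>Column by column, \<open>change\<close> is applied to the vectors
    \<open>p s\<close>; thus \<open>det D\<close> is a multiple of \<open>det M\<close>.\<close>
  have "D = M * mat rk rk (\<lambda>(i, s). pairing_vec \<rho> F rk l' (p s) $ i)"
    using p by (intro eq_mult_if_columns_eq) (auto simp: col_gram_mat M change)
  then have "det D = det M * det (mat rk rk (\<lambda>(i, s). pairing_vec \<rho> F rk l' (p s) $ i))"
    using det_mult[OF M, of "mat rk rk (\<lambda>(i, s). pairing_vec \<rho> F rk l' (p s) $ i)"] by simp
  then have "det M \<noteq> 0" using det_gram by auto
  then have "pairing_vec \<rho> F rk l' g = 0\<^sub>v rk"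
    using zero change[OF g] det_0_iff_vec_prod_zero_field[OF M] pairing_vec_carrier by metis
  from sep[OF g this] that show thesis by blast
qed

text \<open>Modulo the image, \<open>g\<close> is the combination of the \<open>p s\<close> with
  coefficients \<open>mat_inv D *\<^sub>v pairing_vec \<rho> F rk l g\<close>, and multiplication by
  \<open>z\<close> preserves the image. This yields a matrix for \<open>z\<close> that is rational
  in the pairings and so continuous in \<open>F\<close>.\<close>

lemma pairing_vec_z:
  assumes g: "hol_vec (ball 0 1) n g"
  shows "pairing_vec \<rho> F rk l (\<lambda>z. z \<cdot>\<^sub>v g z)
    = (gram_mat \<rho> F rk l (\<lambda>s z. z \<cdot>\<^sub>v p s z) * mat_inv D) *\<^sub>v pairing_vec \<rho> F rk l g"
proof -
  let ?y = "mat_inv D *\<^sub>v pairing_vec \<rho> F rk l g"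
  let ?c = "lin_comb n rk p ?y"
  have y: "?y \<in> carrier_vec rk" by (rule mult_mat_vec_carrier[OF mat_inv_carrier[OF gram_mat_carrier] pairing_vec_carrier])
  have c: "hol_vec (ball 0 1) n ?c" by (rule hol_lin_comb[OF p])
  have "pairing_vec \<rho> F rk l (\<lambda>z. g z - ?c z) = 0\<^sub>v rk"
    unfolding pairing_vec_minus[OF l g c] pairing_vec_lin_comb[OF l p y]
      mat_inv_solve(2)[OF gram_mat_carrier det_gram pairing_vec_carrier] by (auto simp: pairing_vec_def)
  then obtain h where h: "hol_vec (ball 0 1) n h" "\<And>z. z \<in> ball 0 1 \<Longrightarrow> g z - ?c z = F z *\<^sub>v h z"
    using pairing_vec_eq_0D[OF hol_vec_minus[OF g c]] by blast
  have cc: "g z \<in> carrier_vec n" "?c z \<in> carrier_vec n" "h z \<in> carrier_vec n" for z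
    using g c h(1) by (auto simp: holo.C_vec_def)
  have zh: "z \<cdot>\<^sub>v g z - z \<cdot>\<^sub>v ?c z = F z *\<^sub>v (z \<cdot>\<^sub>v h z)" if "z \<in> ball 0 1" for z
    unfolding mult_mat_vec[OF F_carrier cc(3)] h(2)[OF that, symmetric]
    using cc[of z] by (intro eq_vecI) (auto simp: algebra_simps)
  have z: "hol_vec (ball 0 1) n (\<lambda>z. z \<cdot>\<^sub>v k z)" if "hol_vec (ball 0 1) n k" for k
    by (intro holo.smult_vec that) simp
  have "pairing_vec \<rho> F rk l (\<lambda>z. z \<cdot>\<^sub>v g z) = pairing_vec \<rho> F rk l (\<lambda>z. z \<cdot>\<^sub>v ?c z)"
    by (rule pairing_vec_eq_if_diff_image[OF l z[OF g] z[OF c] z[OF h(1)] zh])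
  also have "(\<lambda>z. z \<cdot>\<^sub>v ?c z) = lin_comb n rk (\<lambda>s z. z \<cdot>\<^sub>v p s z) ?y"
  proof
    fix z
    have "dim_vec (p s z) = n" if "s < rk" for s using p that by (auto simp: holo.C_vec_def)
    then show "z \<cdot>\<^sub>v ?c z = lin_comb n rk (\<lambda>s z. z \<cdot>\<^sub>v p s z) ?y z"
      by (auto simp: lin_comb_def sum_distrib_left mult_ac intro!: eq_vecI sum.cong)
  qed
  also have "pairing_vec \<rho> F rk l (lin_comb n rk (\<lambda>s z. z \<cdot>\<^sub>v p s z) ?y) = gram_mat \<rho> F rk l (\<lambda>s z. z \<cdot>\<^sub>v p s z) *\<^sub>v ?y"
    using z p by (intro pairing_vec_lin_comb[OF l _ y]) auto
  also have "\<dots> = (gram_mat \<rho> F rk l (\<lambda>s z. z \<cdot>\<^sub>v p s z) * mat_inv D) *\<^sub>v pairing_vec \<rho> F rk l g"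
    by (rule assoc_mult_mat_vec[OF gram_mat_carrier mat_inv_carrier[OF gram_mat_carrier] pairing_vec_carrier, symmetric])
  finally show ?thesis .
qed

end

section \<open>Global sections of the cokernel sheaf\<close>

context complex_fd_space
begin

section \<open>Coordinates on V\<close>

lemma bij_basis_enum: "bij_betw basis_enum {..<card Basis} Basis"
proof -
  have "\<exists>e. bij_betw e {..<card Basis} Basis"
    using ex_bij_betw_nat_finite[OF finite_Basis] by (simp add: atLeast0LessThan)
  then show ?thesis unfolding basis_enum_def by (rule someI_ex)
qed

lemma basis_enum_in [simp]: "i < card Basis \<Longrightarrow> basis_enum i \<in> Basis"
  using bij_basis_enum by (auto simp: bij_betw_def)

lemma basis_enum_eq_iff [simp]: "i < card Basis \<Longrightarrow> j < card Basis \<Longrightarrow> basis_enum i = basis_enum j \<longleftrightarrow> i = j"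
  using bij_basis_enum by (auto simp: bij_betw_def inj_on_def)

lemma Basis_eq: "Basis = basis_enum ` {..<card Basis}"
  using bij_basis_enum by (simp add: bij_betw_def)

definition coord :: "'v \<Rightarrow> complex vec" where
  "coord v = vec (card Basis) (\<lambda>i. representation Basis v (basis_enum i))"

definition of_coord :: "complex vec \<Rightarrow> 'v" where
  "of_coord w = (\<Sum>i<card Basis. scale (w $ i) (basis_enum i))"

lemma coord_carrier [simp]: "coord v \<in> carrier_vec (card Basis)"
  by (simp add: coord_def)

lemma dim_coord [simp]: "dim_vec (coord v) = card Basis"
  by (simp add: coord_def)

lemma coord_add: "coord (v + w) = coord v + coord w"
  by (auto simp: coord_def representation_add independent_Basis span_Basis intro!: eq_vecI)

lemma coord_scale: "coord (scale c v) = c \<cdot>\<^sub>v coord v"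
  by (auto simp: coord_def representation_scale independent_Basis span_Basis intro!: eq_vecI)

lemma of_coord_coord [simp]: "of_coord (coord v) = v"
proof -
  have "of_coord (coord v) = (\<Sum>i<card Basis. scale (representation Basis v (basis_enum i)) (basis_enum i))"
    by (simp add: of_coord_def coord_def)
  also have "\<dots> = (\<Sum>b\<in>Basis. scale (representation Basis v b) b)"
    by (rule sum.reindex_bij_betw[OF bij_basis_enum])
  also have "\<dots> = v"
    by (rule sum_representation_eq) (auto simp: independent_Basis span_Basis finite_Basis)
  finally show ?thesis .
qed

lemma coord_eq_iff: "coord v = coord w \<longleftrightarrow> v = w"
  by (metis of_coord_coord)

lemma coord_of_coord [simp]:
  assumes "w \<in> carrier_vec (card Basis)"
  shows "coord (of_coord w) = w"
proof (rule eq_vecI)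
  fix j assume "j < dim_vec w"
  then have j: "j < card Basis" using assms by simp
  have "representation Basis (\<Sum>i<m. scale (w $ i) (basis_enum i)) (basis_enum j)
     = (\<Sum>i<m. if i = j then w $ i else 0)" if "m \<le> card Basis" for m
    using that
  proof (induction m)
    case (Suc m)
    then show ?case using j
      by (simp add: representation_add representation_scale representation_basis independent_Basis span_Basis)
  qed (simp add: representation_zero)
  then show "coord (of_coord w) $ j = w $ j"
    using j by (simp add: coord_def of_coord_def)
qed (use assms in auto)

lemma holomorphic_iff_coord:
  "holomorphic g U \<longleftrightarrow> hol_vec U (card Basis) (\<lambda>z. coord (g z))"
proof -
  have "holomorphic g U \<longleftrightarrow> (\<forall>i<card Basis. (\<lambda>z. representation Basis (g z) (basis_enum i)) holomorphic_on U)"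
    unfolding holomorphic_def by (subst Basis_eq) auto
  then show ?thesis by (simp add: holo.C_vec_def coord_def)
qed

lemma holomorphic_of_coord: "hol_vec U (card Basis) g \<Longrightarrow> holomorphic (\<lambda>z. of_coord (g z)) U"
  by (simp add: holomorphic_iff_coord holo.C_vec_def)

lemma holomorphic_diff: "holomorphic g U \<Longrightarrow> holomorphic h U \<Longrightarrow> holomorphic (\<lambda>z. g z - h z) U"
  using holomorphic_add[of g U "\<lambda>z. - h z"] holomorphic_minus by simp

lemma holomorphic_scale:
  "p holomorphic_on U \<Longrightarrow> holomorphic g U \<Longrightarrow> holomorphic (\<lambda>z. scale (p z) (g z)) U"
  by (auto simp: holomorphic_iff_coord coord_scale holo.C_vec_def intro!: holomorphic_intros)

lemma holomorphic_const [simp]: "holomorphic (\<lambda>z. v) U"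
  by (simp add: holomorphic_def)

lemma holomorphic_UN_open:
  assumes "\<And>i. i \<in> I \<Longrightarrow> holomorphic g (A i)" "\<And>i. i \<in> I \<Longrightarrow> open (A i)"
  shows "holomorphic g (\<Union>i\<in>I. A i)"
  using assms unfolding holomorphic_def by (auto intro!: holomorphic_on_UN_open)

lemma holomorphic_cong: "(\<And>z. z \<in> U \<Longrightarrow> g z = h z) \<Longrightarrow> holomorphic g U \<longleftrightarrow> holomorphic h U"
  unfolding holomorphic_def by (auto cong: holomorphic_cong)

end

text \<open>Operations on classes are defined as unions over representatives; this evaluates such a
  union once the result is independent of them.\<close>

lemma UN_all_eq: "A \<noteq> {} \<Longrightarrow> (\<And>x. x \<in> A \<Longrightarrow> f x = c) \<Longrightarrow> (\<Union>x\<in>A. f x) = c"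
  by auto

text \<open>\<open>M\<close> is \<open>F\<close> in coordinates, \<open>xs\<close> lists the zeros
  of the determinant in the disc with multiplicity, and \<open>u\<close> is a unit there. The
  finiteness of \<open>xs\<close> is what allows global sections to be found by polynomial
  interpolation.\<close>

locale coker_data = complex_fd_space scale Basis
  for scale :: "complex \<Rightarrow> 'v::ab_group_add \<Rightarrow> 'v" and Basis :: "'v set" +
  fixes F :: "complex \<Rightarrow> 'v \<Rightarrow> 'v" and M :: "complex \<Rightarrow> complex mat"
    and xs :: "complex list" and u :: "complex \<Rightarrow> complex"
  assumes End: "F z \<in> End" and M: "hol_mat (ball 0 1) (card Basis) M"
    and coord_F: "coord (F z v) = M z *\<^sub>v coord v"
    and u: "u holomorphic_on ball 0 1" "\<And>z. z \<in> ball 0 1 \<Longrightarrow> u z \<noteq> 0"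
    and det_M: "\<And>z. z \<in> ball 0 1 \<Longrightarrow> det (M z) = (\<Prod>x\<leftarrow>xs. z - x) * u z"
    and xs: "set xs \<subseteq> ball 0 1"
begin

lemma M_carrier [simp]: "M z \<in> carrier_mat (card Basis) (card Basis)"
  using M by (simp add: holo.C_mat_def)

lemma module_hom_F: "module_hom scale scale (F z)"
  using End by (simp add: End_def module_hom_iff_linear)

lemmas F_add = module_hom.add[OF module_hom_F]
  and F_scale = module_hom.scale[OF module_hom_F]

lemma det_M_nonzero: "z \<in> ball 0 1 \<Longrightarrow> z \<notin> set xs \<Longrightarrow> det (M z) \<noteq> 0"
  using u(2) by (auto simp: det_M prod_list_zero_iff)

lemma F_inj:
  assumes "z \<in> ball 0 1" "z \<notin> set xs" "F z v = F z w"
  shows "v = w"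
  using mat_inv_solve(1)[OF M_carrier det_M_nonzero[OF assms(1,2)] coord_carrier] assms(3)
  by (metis coord_F coord_eq_iff)

text \<open>Cramer's rule: \<open>M\<close> times its adjugate is \<open>det M\<close>, which is the
  product over the zeros times the unit \<open>u\<close>. So a class in the cokernel depends only on
  the values of a function up to the order of the zeros.\<close>

lemma prod_mult_in_image:
  assumes q: "hol_vec W (card Basis) q" and W: "W \<subseteq> ball 0 1"
  obtains h where "holomorphic h W" "\<And>z. z \<in> W \<Longrightarrow> of_coord ((\<Prod>x\<leftarrow>xs. z - x) \<cdot>\<^sub>v q z) = F z (h z)"
proof
  let ?k = "\<lambda>z. (1 / u z) \<cdot>\<^sub>v (adj_mat (M z) *\<^sub>v q z)"
  have adj: "hol_vec W (card Basis) (\<lambda>z. adj_mat (M z) *\<^sub>v q z)"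
    by (intro holo.mult_mat_vec holo.adj_mat hol_mat_subset[OF M W] q)
  have "(\<lambda>z. 1 / u z) holomorphic_on W"
    using W u by (intro holomorphic_intros holomorphic_on_subset[OF u(1)]) auto
  then have k: "hol_vec W (card Basis) ?k"
    by (rule holo.smult_vec[OF _ adj])
  show "holomorphic (\<lambda>z. of_coord (?k z)) W" by (rule holomorphic_of_coord[OF k])
  fix z assume z: "z \<in> W"
  have qz: "q z \<in> carrier_vec (card Basis)" and kz: "?k z \<in> carrier_vec (card Basis)"
    using q k by (simp_all add: holo.C_vec_def)
  have adjz: "adj_mat (M z) *\<^sub>v q z \<in> carrier_vec (card Basis)" using adj by (simp add: holo.C_vec_def)
  have "coord (F z (of_coord (?k z))) = (1 / u z) \<cdot>\<^sub>v ((M z * adj_mat (M z)) *\<^sub>v q z)"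
    unfolding coord_F coord_of_coord[OF kz] mult_mat_vec[OF M_carrier adjz]
      assoc_mult_mat_vec[OF M_carrier adj_mat(1)[OF M_carrier] qz] ..
  also have "(M z * adj_mat (M z)) *\<^sub>v q z = det (M z) \<cdot>\<^sub>v q z"
    using qz unfolding adj_mat(2)[OF M_carrier]
    by (intro eq_vecI) (auto simp: scalar_prod_def if_distrib[of "\<lambda>x. _ * x * _"] cong: if_cong)
  also have "(1 / u z) \<cdot>\<^sub>v (det (M z) \<cdot>\<^sub>v q z) = (\<Prod>x\<leftarrow>xs. z - x) \<cdot>\<^sub>v q z"
    using W z u(2)[of z] by (auto simp: det_M smult_smult_assoc)
  also have "\<dots> = coord (of_coord ((\<Prod>x\<leftarrow>xs. z - x) \<cdot>\<^sub>v q z))"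
    using qz by simp
  finally show "of_coord ((\<Prod>x\<leftarrow>xs. z - x) \<cdot>\<^sub>v q z) = F z (of_coord (?k z))"
    by (simp only: coord_eq_iff)
qed

lemma Newton_interpolation_vec:
  assumes "holomorphic g U" "open U"
  obtains c q where "hol_vec U (card Basis) q"
    "\<And>z. z \<in> U \<Longrightarrow> g z = (\<Sum>i<length xs. scale (z ^ i) (c i)) + of_coord ((\<Prod>x\<leftarrow>xs. z - x) \<cdot>\<^sub>v q z)"
proof -
  have "\<exists>c q. q holomorphic_on U \<and> (\<forall>z\<in>U. coord (g z) $ k = (\<Sum>i<length xs. c i * z ^ i) + (\<Prod>x\<leftarrow>xs. z - x) * q z)"
    if "k < card Basis" for k
    by (rule Newton_interpolation[of "\<lambda>z. coord (g z) $ k" U xs])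
      (use assms that in \<open>auto simp: holomorphic_iff_coord holo.C_vec_def\<close>)
  then obtain c q where cq: "\<And>k. k < card Basis \<Longrightarrow> q k holomorphic_on U"
    "\<And>k z. k < card Basis \<Longrightarrow> z \<in> U \<Longrightarrow> coord (g z) $ k = (\<Sum>i<length xs. c k i * z ^ i) + (\<Prod>x\<leftarrow>xs. z - x) * q k z"
    by metis
  let ?c = "\<lambda>i. of_coord (vec (card Basis) (\<lambda>k. c k i))" and ?q = "\<lambda>z. vec (card Basis) (\<lambda>k. q k z)"
  have sum: "coord (\<Sum>i<m. scale (z ^ i) (?c i)) = vec (card Basis) (\<lambda>k. \<Sum>i<m. c k i * z ^ i)" for m z
  proof (induction m)
    case 0
    show ?case by (auto simp: coord_def representation_zero)
  qed (auto simp: coord_add coord_scale)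
  show thesis
  proof (rule that)
    show "hol_vec U (card Basis) ?q" using cq(1) by (simp add: holo.C_vec_def)
    fix z assume z: "z \<in> U"
    have "coord (g z) = coord ((\<Sum>i<length xs. scale (z ^ i) (?c i)) + of_coord ((\<Prod>x\<leftarrow>xs. z - x) \<cdot>\<^sub>v ?q z))"
      unfolding coord_add sum using cq(2)[OF _ z] by (intro eq_vecI) auto
    then show "g z = (\<Sum>i<length xs. scale (z ^ i) (?c i)) + of_coord ((\<Prod>x\<leftarrow>xs. z - x) \<cdot>\<^sub>v ?q z)"
      by (simp only: coord_eq_iff)
  qed
qed

lemma holomorphic_sum_powers: "holomorphic (\<lambda>z. \<Sum>i<m. scale (z ^ i) (c i)) U"
  by (induction m) (auto intro!: holomorphic_add holomorphic_scale holomorphic_intros)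

section \<open>Global sections as a quotient of holomorphic functions\<close>

lemma equiv_rel: "equiv (local_sections y) (coker_rel F y)"
  by (intro equiv_coker_rel End)

lemma coker_germ_eq_iff:
  assumes "p \<in> local_sections y" "q \<in> local_sections y"
  shows "coker_germ F y p = coker_germ F y q \<longleftrightarrow> (p, q) \<in> coker_rel F y"
  unfolding coker_germ_def using eq_equiv_class_iff[OF equiv_rel assms] .

lemma coker_germ_eqI: "(p, q) \<in> coker_rel F y \<Longrightarrow> coker_germ F y p = coker_germ F y q"
  unfolding coker_germ_def by (rule equiv_class_eq[OF equiv_rel])

lemma global_section: "holomorphic g (ball 0 1) \<Longrightarrow> y \<in> ball 0 1 \<Longrightarrow> (ball 0 1, g) \<in> local_sections y"
  by (simp add: local_sections_def)

lemma coker_proj_in_H0: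
  assumes "holomorphic g (ball 0 1)"
  shows "coker_proj F g \<in> H0_coker F"
  unfolding H0_coker_def
proof (intro CollectI conjI ballI)
  show "coker_proj F g \<in> (\<Pi>\<^sub>E y\<in>ball 0 1. coker_stalk F y)"
    using assms by (auto simp: coker_proj_def coker_stalk_def coker_germ_def intro!: quotientI global_section)
  show "\<exists>U k. (U, k) \<in> local_sections x \<and> (\<forall>y\<in>U. coker_proj F g y = coker_germ F y (U, k))"
    if "x \<in> ball 0 1" for x
    using global_section[OF assms that] by (intro exI[of _ "ball 0 1"] exI[of _ g]) (auto simp: coker_proj_def)
qed

text \<open>Equality of sections yields preimages under \<open>F\<close> only locally. They glue
  because they are unique: off the zeros by injectivity of \<open>F z\<close>, at the zeros by
  continuity.\<close>

lemma coker_proj_eq_iff: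
  assumes g: "holomorphic g (ball 0 1)" and g': "holomorphic g' (ball 0 1)"
  shows "coker_proj F g = coker_proj F g' \<longleftrightarrow>
    (\<exists>h. holomorphic h (ball 0 1) \<and> (\<forall>z\<in>ball 0 1. g z - g' z = F z (h z)))"
proof
  assume eq: "coker_proj F g = coker_proj F g'"
  have "\<exists>W h. open W \<and> y \<in> W \<and> W \<subseteq> ball 0 1 \<and> holomorphic h W \<and> (\<forall>z\<in>W. g z - g' z = F z (h z))"
    if y: "y \<in> ball 0 1" for y
  proof -
    have "coker_germ F y (ball 0 1, g) = coker_germ F y (ball 0 1, g')"
      using fun_cong[OF eq, of y] y by (simp add: coker_proj_def)
    then show ?thesis
      using coker_germ_eq_iff[OF global_section[OF g y] global_section[OF g' y]]
      by (auto simp: coker_rel_def)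
  qed
  then have "\<forall>y\<in>ball 0 1. \<exists>W h. open W \<and> y \<in> W \<and> W \<subseteq> ball 0 1 \<and> holomorphic h W \<and> (\<forall>z\<in>W. g z - g' z = F z (h z))"
    by blast
  from bchoice[OF this] obtain W where "\<forall>y\<in>ball 0 1. \<exists>h. open (W y) \<and> y \<in> W y \<and> W y \<subseteq> ball 0 1 \<and> holomorphic h (W y) \<and> (\<forall>z\<in>W y. g z - g' z = F z (h z))" ..
  from bchoice[OF this] obtain k where Wk: "\<forall>y\<in>ball 0 1. open (W y) \<and> y \<in> W y \<and> W y \<subseteq> ball 0 1 \<and> holomorphic (k y) (W y) \<and> (\<forall>z\<in>W y. g z - g' z = F z (k y z))" ..
  have W: "\<And>y. y \<in> ball 0 1 \<Longrightarrow> open (W y)" "\<And>y. y \<in> ball 0 1 \<Longrightarrow> y \<in> W y"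
      "\<And>y. y \<in> ball 0 1 \<Longrightarrow> W y \<subseteq> ball 0 1"
    and k: "\<And>y. y \<in> ball 0 1 \<Longrightarrow> holomorphic (k y) (W y)"
      "\<And>y z. y \<in> ball 0 1 \<Longrightarrow> z \<in> W y \<Longrightarrow> g z - g' z = F z (k y z)" using Wk by blast+
  \<comment> \<open>The glued function takes its value at \<open>z\<close> from the local solution
    attached to \<open>z\<close> itself, that is \<open>k z z\<close>.\<close>
  have agree: "k z z = k y z" if y: "y \<in> ball 0 1" and z: "z \<in> W y" for y z
  proof -
    have zB: "z \<in> ball 0 1" using W(3)[OF y] z by auto
    \<comment> \<open>Without the other zeros, \<open>F\<close> is injective at every point of this
      neighbourhood except possibly \<open>z\<close>.\<close>
    let ?U = "(W z \<inter> W y) - (set xs - {z})"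
    have U: "open ?U" "z \<in> ?U" using W(1)[OF zB] W(1)[OF y] W(2)[OF zB] z
      by (auto intro!: open_Diff finite_imp_closed)
    have "coord (k z z) $ i = coord (k y z) $ i" if i: "i < card Basis" for i
    proof (rule continuous_on_eq_at[OF _ _ U, where f = "\<lambda>w. coord (k z w) $ i" and g = "\<lambda>w. coord (k y w) $ i"])
      show "continuous_on ?U (\<lambda>w. coord (k z w) $ i)" "continuous_on ?U (\<lambda>w. coord (k y w) $ i)"
        using k(1)[OF zB] k(1)[OF y] i
        by (auto simp: holomorphic_iff_coord holo.C_vec_def intro!: holomorphic_on_imp_continuous_on
            intro: holomorphic_on_subset)
      show "coord (k z w) $ i = coord (k y w) $ i" if w: "w \<in> ?U" "w \<noteq> z" for w
      proof -
        have "k z w = k y w"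
        proof (rule F_inj)
          show "w \<in> ball 0 1" "w \<notin> set xs" using w W(3)[OF y] by auto
          show "F w (k z w) = F w (k y w)" using w k(2)[OF zB, of w] k(2)[OF y, of w] by simp
        qed
        then show ?thesis by simp
      qed
    qed
    then have "coord (k z z) = coord (k y z)" by (intro eq_vecI) auto
    then show ?thesis by (simp only: coord_eq_iff)
  qed
  have "holomorphic (\<lambda>z. k z z) (\<Union>y\<in>ball 0 1. W y)"
  proof (rule holomorphic_UN_open)
    show "holomorphic (\<lambda>z. k z z) (W y)" if y: "y \<in> ball 0 1" for y
      using k(1)[OF y] agree[OF y] holomorphic_cong[of "W y" "\<lambda>z. k z z" "k y"] by simp
  qed (rule W(1))
  moreover have "(\<Union>y\<in>ball 0 1. W y) = ball 0 1" using W(2,3) by blast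
  ultimately show "\<exists>h. holomorphic h (ball 0 1) \<and> (\<forall>z\<in>ball 0 1. g z - g' z = F z (h z))"
    using k(2)[OF _ W(2)] by (intro exI[of _ "\<lambda>z. k z z"] conjI ballI) simp_all
next
  assume "\<exists>h. holomorphic h (ball 0 1) \<and> (\<forall>z\<in>ball 0 1. g z - g' z = F z (h z))"
  then obtain h where h: "holomorphic h (ball 0 1)" "\<And>z. z \<in> ball 0 1 \<Longrightarrow> g z - g' z = F z (h z)" by blast
  have "((ball 0 1, g), (ball 0 1, g')) \<in> coker_rel F y" if y: "y \<in> ball 0 1" for y
    unfolding coker_rel_def using global_section[OF g y] global_section[OF g' y] h y
    by (auto intro!: exI[of _ "ball 0 1"] exI[of _ h])
  then show "coker_proj F g = coker_proj F g'"
    unfolding coker_proj_def by (intro restrict_ext coker_germ_eqI)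
qed

text \<open>Stalks away from the zeros vanish, so a section is determined by its germs at the zeros.
  There agreement up to the order of the determinant is enough by \<open>prod_mult_in_image\<close>,
  and a single polynomial can match all local representatives to that order.\<close>

lemma coker_proj_surj:
  assumes s: "s \<in> H0_coker F"
  obtains g where "holomorphic g (ball 0 1)" "coker_proj F g = s"
proof -
  have "\<forall>x\<in>ball 0 1. \<exists>U k. (U, k) \<in> local_sections x \<and> (\<forall>y\<in>U. s y = coker_germ F y (U, k))"
    using s unfolding H0_coker_def by blast
  from bchoice[OF this] obtain U where
    "\<forall>x\<in>ball 0 1. \<exists>k. (U x, k) \<in> local_sections x \<and> (\<forall>y\<in>U x. s y = coker_germ F y (U x, k))" ..
  from bchoice[OF this] obtain k where *:
    "\<forall>x\<in>ball 0 1. (U x, k x) \<in> local_sections x \<and> (\<forall>y\<in>U x. s y = coker_germ F y (U x, k x))" ..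
  have Uk: "\<And>x. x \<in> ball 0 1 \<Longrightarrow> (U x, k x) \<in> local_sections x"
    "\<And>x y. x \<in> ball 0 1 \<Longrightarrow> y \<in> U x \<Longrightarrow> s y = coker_germ F y (U x, k x)"
    using * by blast+
  have U: "open (U x)" "x \<in> U x" "U x \<subseteq> ball 0 1" "holomorphic (k x) (U x)" if "x \<in> ball 0 1" for x
    using Uk(1)[OF that] by (auto simp: local_sections_def)
  have "\<exists>e>0. ball x e \<subseteq> U x - (set xs - {x})" if "x \<in> set xs" for x
  proof -
    have "open (U x - (set xs - {x}))" "x \<in> U x - (set xs - {x})"
      using that xs U[of x] by (auto intro!: open_Diff finite_imp_closed)
    then show ?thesis by (meson open_contains_ball)
  qed
  then obtain \<delta> where \<delta>: "\<And>x. x \<in> set xs \<Longrightarrow> \<delta> x > 0" "\<And>x. x \<in> set xs \<Longrightarrow> ball x (\<delta> x) \<subseteq> U x - (set xs - {x})"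
    by metis
  \<comment> \<open>Each ball of radius \<open>\<delta> x\<close> omits the other zeros, so two
    zeros are at least as far apart as the larger of their radii, and the balls of half the radius
    are disjoint.\<close>
  define N where "N x = ball x (\<delta> x / 2)" for x
  have N: "open (N x)" for x by (simp add: N_def)
  have N_sub: "N x \<subseteq> U x" "x \<in> N x" if "x \<in> set xs" for x
  proof -
    have "N x \<subseteq> ball x (\<delta> x)" using \<delta>(1)[OF that] by (auto simp: N_def)
    then show "N x \<subseteq> U x" "x \<in> N x" using \<delta>[OF that] by (auto simp: N_def)
  qed
  have disj: "x = y" if "x \<in> set xs" "y \<in> set xs" "z \<in> N x" "z \<in> N y" for x y z
  proof (rule ccontr)
    assume "x \<noteq> y"
    then have "y \<notin> ball x (\<delta> x)" "x \<notin> ball y (\<delta> y)" using \<delta>(2) that by blast+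
    moreover have "dist x y \<le> dist x z + dist y z" by (metis dist_commute dist_triangle)
    ultimately show False using that by (auto simp: N_def dist_commute)
  qed
  \<comment> \<open>On the disjoint neighbourhoods the local representatives form one holomorphic
    function, so that one interpolation treats all zeros together.\<close>
  define G where "G z = k (THE x. x \<in> set xs \<and> z \<in> N x) z" for z
  have G: "G z = k x z" if "x \<in> set xs" "z \<in> N x" for x z
  proof -
    have "(THE x. x \<in> set xs \<and> z \<in> N x) = x" using that disj by (intro the_equality) auto
    then show ?thesis by (simp add: G_def)
  qed
  define W where "W = (\<Union>x\<in>set xs. N x)"
  have W: "open W" "W \<subseteq> ball 0 1" using N N_sub U(3) xs by (fastforce simp: W_def)+
  have hol_G: "holomorphic G W"
    unfolding W_def
  proof (rule holomorphic_UN_open)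
    show "holomorphic G (N x)" if x: "x \<in> set xs" for x
      using holomorphic_subset[OF U(4) N_sub(1)[OF x]] x xs G holomorphic_cong[of "N x" G "k x"] by auto
  qed (rule N)
  obtain c q where q: "hol_vec W (card Basis) q"
    "\<And>z. z \<in> W \<Longrightarrow> G z = (\<Sum>i<length xs. scale (z ^ i) (c i)) + of_coord ((\<Prod>x\<leftarrow>xs. z - x) \<cdot>\<^sub>v q z)"
    by (rule Newton_interpolation_vec[OF hol_G W(1)]) blast
  obtain h where h: "holomorphic h W" "\<And>z. z \<in> W \<Longrightarrow> of_coord ((\<Prod>x\<leftarrow>xs. z - x) \<cdot>\<^sub>v q z) = F z (h z)"
    by (rule prod_mult_in_image[OF q(1) W(2)]) blast
  define g where "g z = (\<Sum>i<length xs. scale (z ^ i) (c i))" for z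
  have g: "holomorphic g (ball 0 1)" unfolding g_def by (rule holomorphic_sum_powers)
  have "coker_germ F y (ball 0 1, g) = s y" if y: "y \<in> ball 0 1" for y
  proof (cases "y \<in> set xs")
    case True
    have "k y z - g z = F z (h z)" if z: "z \<in> N y" for z
    proof -
      have "z \<in> W" using z True by (auto simp: W_def)
      then show ?thesis using q(2)[of z] h(2)[of z] G[OF True z] by (simp add: g_def)
    qed
    moreover have "holomorphic h (N y)" using True by (intro holomorphic_subset[OF h(1)]) (auto simp: W_def)
    ultimately have "((U y, k y), (ball 0 1, g)) \<in> coker_rel F y"
      unfolding coker_rel_def using Uk(1)[OF y] global_section[OF g y] N N_sub[OF True] U(3)[OF y]
      by (auto intro!: exI[of _ "N y"] exI[of _ h])
    then show ?thesis using coker_germ_eqI Uk(2)[OF y U(2)[OF y]] by simp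
  next
    case False
    \<comment> \<open>Off the zeros \<open>F\<close> is invertible, so any two local functions
      differ by an element of the image.\<close>
    let ?V = "U y - set xs" and ?h = "\<lambda>z. of_coord (mat_inv (M z) *\<^sub>v coord (k y z - g z))"
    have V: "?V \<subseteq> ball 0 1" using U(3)[OF y] by auto
    have "holomorphic (\<lambda>z. k y z - g z) ?V"
      using holomorphic_subset[OF U(4)[OF y]] holomorphic_subset[OF g V] by (intro holomorphic_diff) auto
    then have "holomorphic ?h ?V"
      using det_M_nonzero V by (intro holomorphic_of_coord holo.mult_mat_vec holo.mat_inv hol_mat_subset[OF M V])
        (auto simp: holomorphic_iff_coord)
    moreover have "k y z - g z = F z (?h z)" if "z \<in> ?V" for z
    proof -
      have "det (M z) \<noteq> 0" using det_M_nonzero that V by blast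
      then have "coord (F z (?h z)) = coord (k y z - g z)"
        using mult_mat_vec_carrier[OF mat_inv_carrier[OF M_carrier] coord_carrier]
        by (simp add: coord_F mat_inv_solve(2)[OF M_carrier])
      then show ?thesis by (simp only: coord_eq_iff)
    qed
    moreover have "open ?V" using U(1)[OF y] by (auto intro!: open_Diff finite_imp_closed)
    ultimately have "((U y, k y), (ball 0 1, g)) \<in> coker_rel F y"
      unfolding coker_rel_def using Uk(1)[OF y] global_section[OF g y] V U(2)[OF y] False
      by (auto intro!: exI[of _ ?V] exI[of _ ?h])
    then show ?thesis using coker_germ_eqI Uk(2)[OF y U(2)[OF y]] by simp
  qed
  then have "coker_proj F g = s"
    using s by (auto simp: coker_proj_def H0_coker_def PiE_def extensional_def fun_eq_iff)
  then show thesis by (rule that[OF g])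
qed

lemma coker_rel_add:
  assumes "((U, g), (V, k)) \<in> coker_rel F y" "((U', g'), (V', k')) \<in> coker_rel F y"
  shows "((U \<inter> U', \<lambda>z. g z + g' z), (V \<inter> V', \<lambda>z. k z + k' z)) \<in> coker_rel F y"
proof -
  obtain W h where W: "open W" "y \<in> W" "W \<subseteq> U \<inter> V" "holomorphic h W" "\<And>z. z \<in> W \<Longrightarrow> g z - k z = F z (h z)"
    using assms(1) by (auto simp: coker_rel_def)
  obtain W' h' where W': "open W'" "y \<in> W'" "W' \<subseteq> U' \<inter> V'" "holomorphic h' W'" "\<And>z. z \<in> W' \<Longrightarrow> g' z - k' z = F z (h' z)"
    using assms(2) by (auto simp: coker_rel_def)
  have "g z + g' z - (k z + k' z) = F z (h z + h' z)" if "z \<in> W \<inter> W'" for z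
  proof -
    have "g z + g' z - (k z + k' z) = (g z - k z) + (g' z - k' z)" by simp
    also have "\<dots> = F z (h z) + F z (h' z)" using W(5)[of z] W'(5)[of z] that by simp
    finally show ?thesis by (simp add: F_add)
  qed
  moreover have "holomorphic (\<lambda>z. h z + h' z) (W \<inter> W')"
    by (intro holomorphic_add holomorphic_subset[OF W(4)] holomorphic_subset[OF W'(4)]) auto
  moreover have "open (W \<inter> W')" "y \<in> W \<inter> W'" "W \<inter> W' \<subseteq> (U \<inter> U') \<inter> (V \<inter> V')" using W W' by auto
  moreover have local: "(U \<inter> U', \<lambda>z. g z + g' z) \<in> local_sections y" "(V \<inter> V', \<lambda>z. k z + k' z) \<in> local_sections y"
    using assms holomorphic_add[OF holomorphic_subset holomorphic_subset, of g U "U \<inter> U'" g' U']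
      holomorphic_add[OF holomorphic_subset holomorphic_subset, of k V "V \<inter> V'" k' V']
    unfolding coker_rel_def local_sections_def by auto
  ultimately have "\<exists>X f. open X \<and> y \<in> X \<and> X \<subseteq> (U \<inter> U') \<inter> (V \<inter> V') \<and> holomorphic f X \<and>
      (\<forall>z\<in>X. g z + g' z - (k z + k' z) = F z (f z))"
    by (intro exI[of _ "W \<inter> W'"] exI[of _ "\<lambda>z. h z + h' z"]) blast
  with local show ?thesis unfolding coker_rel_def by simp
qed

lemma coker_rel_mult:
  assumes "((U, g), (V, k)) \<in> coker_rel F y" and p: "p holomorphic_on ball 0 1"
  shows "((U, \<lambda>z. scale (p z) (g z)), (V, \<lambda>z. scale (p z) (k z))) \<in> coker_rel F y"
proof -
  obtain W h where W: "open W" "y \<in> W" "W \<subseteq> U \<inter> V" "holomorphic h W" "\<And>z. z \<in> W \<Longrightarrow> g z - k z = F z (h z)"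
    using assms(1) by (auto simp: coker_rel_def)
  have UV: "U \<subseteq> ball 0 1" "V \<subseteq> ball 0 1" using assms(1) by (auto simp: coker_rel_def local_sections_def)
  have "scale (p z) (g z) - scale (p z) (k z) = F z (scale (p z) (h z))" if "z \<in> W" for z
    unfolding F_scale W(5)[OF that, symmetric] scale_right_diff_distrib ..
  moreover have "holomorphic (\<lambda>z. scale (p z) (h z)) W"
    using UV W(3) by (intro holomorphic_scale W(4) holomorphic_on_subset[OF p]) auto
  moreover have "(U, \<lambda>z. scale (p z) (g z)) \<in> local_sections y" "(V, \<lambda>z. scale (p z) (k z)) \<in> local_sections y"
    using assms(1) holomorphic_scale holomorphic_on_subset[OF p UV(1)] holomorphic_on_subset[OF p UV(2)]
    unfolding coker_rel_def local_sections_def by auto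
  ultimately show ?thesis unfolding coker_rel_def using W(1-3) by blast
qed

lemma H0_add_coker_proj:
  assumes g: "holomorphic g (ball 0 1)" and g': "holomorphic g' (ball 0 1)"
  shows "H0_add F (coker_proj F g) (coker_proj F g') = coker_proj F (\<lambda>z. g z + g' z)"
proof
  fix y
  show "H0_add F (coker_proj F g) (coker_proj F g') y = coker_proj F (\<lambda>z. g z + g' z) y"
  proof (cases "y \<in> ball 0 1")
    case y: True
    have "coker_germ F y (U \<inter> U', \<lambda>z. k z + k' z) = coker_germ F y (ball 0 1, \<lambda>z. g z + g' z)"
      if "(U, k) \<in> coker_germ F y (ball 0 1, g)" "(U', k') \<in> coker_germ F y (ball 0 1, g')" for U U' k k'
    proof -
      have "((ball 0 1, g), (U, k)) \<in> coker_rel F y" "((ball 0 1, g'), (U', k')) \<in> coker_rel F y"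
        using that by (simp_all add: coker_germ_def)
      from coker_germ_eqI[OF coker_rel_add[OF this]] show ?thesis by simp
    qed
    moreover have "(ball 0 1, g) \<in> coker_germ F y (ball 0 1, g)" "(ball 0 1, g') \<in> coker_germ F y (ball 0 1, g')"
      unfolding coker_germ_def by (intro equiv_class_self[OF equiv_rel] global_section y g g')+
    ultimately have "(\<Union>(U, k)\<in>coker_germ F y (ball 0 1, g). \<Union>(U', k')\<in>coker_germ F y (ball 0 1, g').
        coker_germ F y (U \<inter> U', \<lambda>z. k z + k' z)) = coker_germ F y (ball 0 1, \<lambda>z. g z + g' z)"
      by (intro UN_all_eq; clarify?; (intro UN_all_eq)?; blast)
    then show ?thesis using y by (simp add: H0_add_def coker_proj_def)
  qed (simp add: H0_add_def coker_proj_def)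
qed

lemma H0_mult_coker_proj:
  assumes g: "holomorphic g (ball 0 1)" and p: "p holomorphic_on ball 0 1"
  shows "H0_mult F p (coker_proj F g) = coker_proj F (\<lambda>z. scale (p z) (g z))"
proof
  fix y
  show "H0_mult F p (coker_proj F g) y = coker_proj F (\<lambda>z. scale (p z) (g z)) y"
  proof (cases "y \<in> ball 0 1")
    case y: True
    have "coker_germ F y (U, \<lambda>z. scale (p z) (k z)) = coker_germ F y (ball 0 1, \<lambda>z. scale (p z) (g z))"
      if "(U, k) \<in> coker_germ F y (ball 0 1, g)" for U k
    proof -
      have "((ball 0 1, g), (U, k)) \<in> coker_rel F y" using that by (simp add: coker_germ_def)
      from coker_germ_eqI[OF coker_rel_mult[OF this p]] show ?thesis by simp
    qed
    moreover have "(ball 0 1, g) \<in> coker_germ F y (ball 0 1, g)"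
      unfolding coker_germ_def by (intro equiv_class_self[OF equiv_rel] global_section y g)
    ultimately have "(\<Union>(U, k)\<in>coker_germ F y (ball 0 1, g). coker_germ F y (U, \<lambda>z. scale (p z) (k z)))
        = coker_germ F y (ball 0 1, \<lambda>z. scale (p z) (g z))"
      by (intro UN_all_eq; clarify?; blast)
    then show ?thesis using y by (simp add: H0_mult_def coker_proj_def)
  qed (simp add: H0_mult_def coker_proj_def)
qed

end

section \<open>The configuration of a presented quotient\<close>

definition matrix_of :: "nat \<Rightarrow> (complex vec \<Rightarrow> complex vec) \<Rightarrow> complex mat" where
  "matrix_of r f = mat r r (\<lambda>(i, j). f (unit_vec r j) $ i)"

lemma matrix_of_carrier [simp]: "matrix_of r f \<in> carrier_mat r r"
  by (simp add: matrix_of_def)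

lemma matrix_of_mult_vec:
  assumes f: "\<And>x. x \<in> carrier_vec r \<Longrightarrow> f x \<in> carrier_vec r"
    and add: "\<And>x y. x \<in> carrier_vec r \<Longrightarrow> y \<in> carrier_vec r \<Longrightarrow> f (x + y) = f x + f y"
    and scale: "\<And>c x. x \<in> carrier_vec r \<Longrightarrow> f (c \<cdot>\<^sub>v x) = c \<cdot>\<^sub>v f x"
    and w: "w \<in> carrier_vec r"
  shows "matrix_of r f *\<^sub>v w = f w"
proof -
  \<comment> \<open>Induction on the number \<open>m\<close> of coordinates kept: with the others
    set to 0, each step adds one multiple of a unit vector.\<close>
  have "f (vec r (\<lambda>i. if i < m then w $ i else 0)) = vec r (\<lambda>i. \<Sum>j<m. f (unit_vec r j) $ i * w $ j)"
    if "m \<le> r" for m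
    using that
  proof (induction m)
    case 0
    have "vec r (\<lambda>i. 0) = 0 \<cdot>\<^sub>v (0\<^sub>v r :: complex vec)" by auto
    then show ?case using scale[of "0\<^sub>v r" 0] f[of "0\<^sub>v r"] by (auto intro!: eq_vecI)
  next
    case (Suc m)
    have "vec r (\<lambda>i. if i < Suc m then w $ i else 0) =
        vec r (\<lambda>i. if i < m then w $ i else 0) + w $ m \<cdot>\<^sub>v unit_vec r m"
      using Suc.prems by (auto intro!: eq_vecI simp: less_Suc_eq)
    then have "f (vec r (\<lambda>i. if i < Suc m then w $ i else 0)) =
        vec r (\<lambda>i. \<Sum>j<m. f (unit_vec r j) $ i * w $ j) + w $ m \<cdot>\<^sub>v f (unit_vec r m)"
      using Suc by (simp add: add scale)
    then show ?case using f[of "unit_vec r m"] by (auto intro!: eq_vecI)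
  qed
  from this[of r] have "f (vec r (\<lambda>i. if i < r then w $ i else 0)) = matrix_of r f *\<^sub>v w"
    using w by (auto simp: matrix_of_def scalar_prod_def atLeast0LessThan intro!: eq_vecI)
  moreover have "vec r (\<lambda>i. if i < r then w $ i else 0) = w" using w by auto
  ultimately show ?thesis by simp
qed

lemma mat_eqI_mult_vec:
  assumes "A \<in> carrier_mat r r" "B \<in> carrier_mat r r"
    and eq: "\<And>w. w \<in> carrier_vec r \<Longrightarrow> A *\<^sub>v w = B *\<^sub>v (w :: complex vec)"
  shows "A = B"
proof (rule eq_matI)
  fix i j assume "i < dim_row B" "j < dim_col B"
  then have ij: "i < r" "j < r" using assms by auto
  have "(A *\<^sub>v unit_vec r j) $ i = (B *\<^sub>v unit_vec r j) $ i" by (simp only: eq[OF unit_vec_carrier])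
  then show "A $$ (i, j) = B $$ (i, j)"
    unfolding mult_mat_unit_vec[OF assms(1) ij] mult_mat_unit_vec[OF assms(2) ij] .
qed (use assms in auto)

context complex_fd_space
begin

section \<open>Independence of the chosen isomorphism\<close>

lemma Conf_class_conj_subset:
  assumes T: "T \<in> carrier_mat r r" "T' \<in> carrier_mat r r" "T * T' = 1\<^sub>m r" "T' * T = 1\<^sub>m r"
    and A: "A \<in> carrier_mat r r" and \<iota>: "\<And>v. \<iota> v \<in> carrier_vec r"
  shows "Conf_class r (T * A * T', \<lambda>v. T *\<^sub>v \<iota> v) \<subseteq> Conf_class r (A, \<iota>)"
proof
  fix p assume "p \<in> Conf_class r (T * A * T', \<lambda>v. T *\<^sub>v \<iota> v)"
  then obtain g g' where p: "p = (g * (T * A * T') * g', \<lambda>v. g *\<^sub>v (T *\<^sub>v \<iota> v))"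
    and g: "g \<in> carrier_mat r r" "g' \<in> carrier_mat r r" "g * g' = 1\<^sub>m r" "g' * g = 1\<^sub>m r"
    by (auto simp: Conf_class_def)
  note a = assoc_mult_mat[where n\<^sub>1=r and n\<^sub>2=r and n\<^sub>3=r and n\<^sub>4=r]
  have "p = (g * T * A * (T' * g'), \<lambda>v. (g * T) *\<^sub>v \<iota> v)"
    using T g A \<iota> by (simp add: p a)
  moreover have "(g * T) * (T' * g') = 1\<^sub>m r"
  proof -
    have "(g * T) * (T' * g') = g * (T * T') * g'" using T(1,2) g(1,2) by (simp add: a)
    also have "\<dots> = 1\<^sub>m r" unfolding T(3) using g by simp
    finally show ?thesis .
  qed
  moreover have "(T' * g') * (g * T) = 1\<^sub>m r"
  proof -
    have "(T' * g') * (g * T) = T' * (g' * g) * T" using T(1,2) g(1,2) by (simp add: a)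
    also have "\<dots> = 1\<^sub>m r" unfolding g(4) using T by simp
    finally show ?thesis .
  qed
  moreover have "g * T \<in> carrier_mat r r" "T' * g' \<in> carrier_mat r r" using T(1,2) g(1,2) by auto
  ultimately show "p \<in> Conf_class r (A, \<iota>)"
    unfolding Conf_class_def by blast
qed

lemma Conf_class_conj:
  assumes T: "T \<in> carrier_mat r r" "T' \<in> carrier_mat r r" "T * T' = 1\<^sub>m r" "T' * T = 1\<^sub>m r"
    and A: "A \<in> carrier_mat r r" and \<iota>: "\<And>v. \<iota> v \<in> carrier_vec r"
  shows "Conf_class r (T * A * T', \<lambda>v. T *\<^sub>v \<iota> v) = Conf_class r (A, \<iota>)"
proof
  show "Conf_class r (T * A * T', \<lambda>v. T *\<^sub>v \<iota> v) \<subseteq> Conf_class r (A, \<iota>)"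
    by (rule Conf_class_conj_subset[OF assms])
  let ?A = "T * A * T'" and ?\<iota> = "\<lambda>v. T *\<^sub>v \<iota> v"
  note a = assoc_mult_mat[where n\<^sub>1=r and n\<^sub>2=r and n\<^sub>3=r and n\<^sub>4=r]
  have "T' * ?A * T = (T' * T) * A * (T' * T)" using T(1,2) A by (simp add: a)
  also have "\<dots> = A" using T A by simp
  finally have 1: "T' * ?A * T = A" .
  have 2: "T' *\<^sub>v (T *\<^sub>v \<iota> v) = \<iota> v" for v
    using T \<iota>[of v] by (simp flip: assoc_mult_mat_vec[OF T(2,1) \<iota>])
  show "Conf_class r (A, \<iota>) \<subseteq> Conf_class r (T * A * T', \<lambda>v. T *\<^sub>v \<iota> v)"
    using Conf_class_conj_subset[OF T(2,1,4,3), of ?A ?\<iota>] T A \<iota> unfolding 1 2 by auto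
qed

end

text \<open>The map \<open>\<phi>\<close> lives on holomorphic functions instead of sections: it is
  a linear surjection onto the coordinate space whose kernel is the image of \<open>F\<close>, and
  it turns multiplication by \<open>z\<close> into \<open>A\<close>. These properties determine the
  configuration, whatever formula defines \<open>\<phi>\<close>.\<close>

locale config_data = coker_data scale Basis F M xs u
  for scale :: "complex \<Rightarrow> 'v::ab_group_add \<Rightarrow> 'v" and Basis F M xs u +
  fixes \<phi> :: "(complex \<Rightarrow> 'v) \<Rightarrow> complex vec" and A :: "complex mat" and r :: nat
  assumes r: "r = length xs"
    and \<phi>_carrier [simp]: "holomorphic g (ball 0 1) \<Longrightarrow> \<phi> g \<in> carrier_vec r"
    and \<phi>_add: "holomorphic g (ball 0 1) \<Longrightarrow> holomorphic h (ball 0 1) \<Longrightarrow> \<phi> (\<lambda>z. g z + h z) = \<phi> g + \<phi> h"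
    and \<phi>_scale: "holomorphic g (ball 0 1) \<Longrightarrow> \<phi> (\<lambda>z. scale c (g z)) = c \<cdot>\<^sub>v \<phi> g"
    and \<phi>_surj: "w \<in> carrier_vec r \<Longrightarrow> \<exists>g. holomorphic g (ball 0 1) \<and> \<phi> g = w"
    and \<phi>_eq_0_iff: "holomorphic g (ball 0 1) \<Longrightarrow>
      \<phi> g = 0\<^sub>v r \<longleftrightarrow> (\<exists>h. holomorphic h (ball 0 1) \<and> (\<forall>z\<in>ball 0 1. g z = F z (h z)))"
    and A [simp]: "A \<in> carrier_mat r r"
    and \<phi>_z: "holomorphic g (ball 0 1) \<Longrightarrow> \<phi> (\<lambda>z. scale z (g z)) = A *\<^sub>v \<phi> g"
begin

lemma \<phi>_eq_iff:
  assumes g: "holomorphic g (ball 0 1)" and h: "holomorphic h (ball 0 1)"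
  shows "\<phi> g = \<phi> h \<longleftrightarrow> coker_proj F g = coker_proj F h"
proof -
  have "\<phi> (\<lambda>z. g z + scale (-1) (h z)) = \<phi> g + (-1) \<cdot>\<^sub>v \<phi> h"
    using \<phi>_add[OF g holomorphic_scale[OF _ h, of "\<lambda>_. -1"]] \<phi>_scale[OF h, of "-1"] by simp
  then have "\<phi> (\<lambda>z. g z - h z) = \<phi> g - \<phi> h"
    using \<phi>_carrier[OF g] \<phi>_carrier[OF h] by (auto intro!: eq_vecI)
  moreover have "\<phi> g - \<phi> h = 0\<^sub>v r \<longleftrightarrow> \<phi> g = \<phi> h"
    using \<phi>_carrier[OF g] \<phi>_carrier[OF h] by (auto simp: vec_eq_iff)
  ultimately show ?thesis
    using \<phi>_eq_0_iff[OF holomorphic_diff[OF g h]] coker_proj_eq_iff[OF g h] by simp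
qed

text \<open>The map induced by \<open>\<phi>\<close> on sections. The representative chosen does not
  matter by \<open>\<phi>_eq_iff\<close>.\<close>

definition \<Phi> :: "(complex \<Rightarrow> (complex set \<times> (complex \<Rightarrow> 'v)) set) \<Rightarrow> complex vec" where
  "\<Phi> s = \<phi> (SOME g. holomorphic g (ball 0 1) \<and> coker_proj F g = s)"

lemma \<Phi>_coker_proj:
  assumes "holomorphic g (ball 0 1)"
  shows "\<Phi> (coker_proj F g) = \<phi> g"
proof -
  have "holomorphic (SOME h. holomorphic h (ball 0 1) \<and> coker_proj F h = coker_proj F g) (ball 0 1) \<and>
    coker_proj F (SOME h. holomorphic h (ball 0 1) \<and> coker_proj F h = coker_proj F g) = coker_proj F g"
    by (rule someI[of _ g]) (use assms in simp)
  then show ?thesis unfolding \<Phi>_def using \<phi>_eq_iff[OF _ assms] by blast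
qed

text \<open>Besides carrying the coordinates to sections, this supplies the existence that makes the
  choice in \<open>config\<close> meaningful.\<close>

lemma H0_iso_\<Phi>: "H0_iso F r \<Phi>"
  unfolding H0_iso_def
proof (intro conjI ballI allI)
  show "bij_betw \<Phi> (H0_coker F) (carrier_vec r)"
    unfolding bij_betw_def
  proof (intro conjI inj_onI subset_antisym subsetI)
    fix s t assume st: "s \<in> H0_coker F" "t \<in> H0_coker F" "\<Phi> s = \<Phi> t"
    obtain g where g: "holomorphic g (ball 0 1)" "coker_proj F g = s" using coker_proj_surj[OF st(1)] .
    obtain h where h: "holomorphic h (ball 0 1)" "coker_proj F h = t" using coker_proj_surj[OF st(2)] .
    show "s = t"
      using st(3) \<Phi>_coker_proj[OF g(1)] \<Phi>_coker_proj[OF h(1)] \<phi>_eq_iff[OF g(1) h(1)] g(2) h(2) by simp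
  next
    fix w assume "w \<in> \<Phi> ` H0_coker F"
    then obtain s where s: "s \<in> H0_coker F" "w = \<Phi> s" by blast
    obtain g where "holomorphic g (ball 0 1)" "coker_proj F g = s" using coker_proj_surj[OF s(1)] .
    then show "w \<in> carrier_vec r" using s \<Phi>_coker_proj by auto
  next
    fix w :: "complex vec" assume "w \<in> carrier_vec r"
    then obtain g where "holomorphic g (ball 0 1)" "\<phi> g = w" using \<phi>_surj by blast
    then show "w \<in> \<Phi> ` H0_coker F"
      by (intro image_eqI[of _ _ "coker_proj F g"] coker_proj_in_H0) (simp_all add: \<Phi>_coker_proj)
  qed
  show "\<Phi> (H0_add F s t) = \<Phi> s + \<Phi> t" if st: "s \<in> H0_coker F" "t \<in> H0_coker F" for s t
  proof -
    obtain g where g: "holomorphic g (ball 0 1)" "coker_proj F g = s" using coker_proj_surj[OF st(1)] .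
    obtain h where h: "holomorphic h (ball 0 1)" "coker_proj F h = t" using coker_proj_surj[OF st(2)] .
    show ?thesis
      unfolding g(2)[symmetric] h(2)[symmetric]
      by (simp add: H0_add_coker_proj g(1) h(1) \<Phi>_coker_proj holomorphic_add \<phi>_add)
  qed
  show "\<Phi> (H0_mult F (\<lambda>_. c) s) = c \<cdot>\<^sub>v \<Phi> s" if s: "s \<in> H0_coker F" for c s
  proof -
    obtain g where g: "holomorphic g (ball 0 1)" "coker_proj F g = s" using coker_proj_surj[OF s] .
    show ?thesis
      unfolding g(2)[symmetric]
      by (simp add: H0_mult_coker_proj g(1) \<Phi>_coker_proj holomorphic_scale \<phi>_scale)
  qed
qed

lemma H0_add_closed: "s \<in> H0_coker F \<Longrightarrow> t \<in> H0_coker F \<Longrightarrow> H0_add F s t \<in> H0_coker F"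
  by (elim coker_proj_surj) (auto simp: H0_add_coker_proj coker_proj_in_H0 holomorphic_add)

lemma H0_mult_closed: "s \<in> H0_coker F \<Longrightarrow> p holomorphic_on ball 0 1 \<Longrightarrow> H0_mult F p s \<in> H0_coker F"
  by (elim coker_proj_surj) (auto simp: H0_mult_coker_proj coker_proj_in_H0 holomorphic_scale)

lemma transition_matrix:
  assumes "H0_iso F r \<psi>" "H0_iso F r \<theta>"
  shows "s \<in> H0_coker F \<Longrightarrow> matrix_of r (\<lambda>w. \<theta> (inv_into (H0_coker F) \<psi> w)) *\<^sub>v \<psi> s = \<theta> s"
proof -
  have bij: "bij_betw \<psi> (H0_coker F) (carrier_vec r)" "bij_betw \<theta> (H0_coker F) (carrier_vec r)"
    and add: "\<And>s t. s \<in> H0_coker F \<Longrightarrow> t \<in> H0_coker F \<Longrightarrow> \<psi> (H0_add F s t) = \<psi> s + \<psi> t"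
      "\<And>s t. s \<in> H0_coker F \<Longrightarrow> t \<in> H0_coker F \<Longrightarrow> \<theta> (H0_add F s t) = \<theta> s + \<theta> t"
    and scale: "\<And>c s. s \<in> H0_coker F \<Longrightarrow> \<psi> (H0_mult F (\<lambda>_. c) s) = c \<cdot>\<^sub>v \<psi> s"
      "\<And>c s. s \<in> H0_coker F \<Longrightarrow> \<theta> (H0_mult F (\<lambda>_. c) s) = c \<cdot>\<^sub>v \<theta> s"
    using assms by (auto simp: H0_iso_def)
  let ?i = "inv_into (H0_coker F) \<psi>"
  have i: "?i w \<in> H0_coker F" "\<psi> (?i w) = w" if "w \<in> carrier_vec r" for w
    using that bij(1) by (auto simp: bij_betw_def inv_into_into f_inv_into_f)
  have i': "?i (\<psi> s) = s" if "s \<in> H0_coker F" for s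
    using that bij(1) by (simp add: bij_betw_def)
  assume s: "s \<in> H0_coker F"
  have "matrix_of r (\<lambda>w. \<theta> (?i w)) *\<^sub>v \<psi> s = \<theta> (?i (\<psi> s))"
  proof (rule matrix_of_mult_vec)
    show "\<theta> (?i x) \<in> carrier_vec r" if "x \<in> carrier_vec r" for x
      using i(1)[OF that] bij(2) by (auto simp: bij_betw_def)
    show "\<theta> (?i (x + y)) = \<theta> (?i x) + \<theta> (?i y)" if "x \<in> carrier_vec r" "y \<in> carrier_vec r" for x y
    proof -
      have "?i (x + y) = H0_add F (?i x) (?i y)"
        using i'[OF H0_add_closed[OF i(1)[OF that(1)] i(1)[OF that(2)]]] add(1)[OF i(1)[OF that(1)] i(1)[OF that(2)]]
        by (simp add: i(2) that)
      then show ?thesis using add(2)[OF i(1)[OF that(1)] i(1)[OF that(2)]] by simp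
    qed
    show "\<theta> (?i (c \<cdot>\<^sub>v x)) = c \<cdot>\<^sub>v \<theta> (?i x)" if "x \<in> carrier_vec r" for c x
    proof -
      have "?i (c \<cdot>\<^sub>v x) = H0_mult F (\<lambda>_. c) (?i x)"
        using i'[OF H0_mult_closed[OF i(1)[OF that], of "\<lambda>_. c"]] scale(1)[OF i(1)[OF that], of c]
        by (simp add: i(2) that)
      then show ?thesis using scale(2)[OF i(1)[OF that]] by simp
    qed
    show "\<psi> s \<in> carrier_vec r" using s bij(1) by (auto simp: bij_betw_def)
  qed
  then show ?thesis by (simp add: i'[OF s])
qed

lemma \<Phi>_z:
  assumes "s \<in> H0_coker F"
  shows "\<Phi> (H0_mult F (\<lambda>z. z) s) = A *\<^sub>v \<Phi> s"
proof -
  obtain g where g: "holomorphic g (ball 0 1)" "coker_proj F g = s" using coker_proj_surj[OF assms] .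
  show ?thesis
    unfolding g(2)[symmetric]
    by (simp add: H0_mult_coker_proj g(1) \<Phi>_coker_proj holomorphic_scale \<phi>_z)
qed

text \<open>An arbitrary isomorphism \<open>\<psi>\<close> differs from \<open>\<Phi>\<close> by an
  invertible matrix, and this matrix moves one pair to the other inside a single orbit. Hence the
  discontinuous choice in \<open>config\<close> can be replaced by the explicit pair.\<close>

lemma Conf_class_config_pair:
  assumes \<psi>: "H0_iso F r \<psi>"
  shows "Conf_class r (config_pair F r \<psi>) = Conf_class r (A, \<lambda>v. \<phi> (\<lambda>_. v))"
proof -
  let ?H = "H0_coker F"
  let ?i = "inv_into ?H \<psi>"
  define T where "T = matrix_of r (\<lambda>w. \<Phi> (inv_into ?H \<psi> w))"
  define T' where "T' = matrix_of r (\<lambda>w. \<psi> (inv_into ?H \<Phi> w))"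
  define B where "B = matrix_of r (\<lambda>w. \<psi> (H0_mult F (\<lambda>z. z) (?i w)))"
  have c: "T \<in> carrier_mat r r" "T' \<in> carrier_mat r r" "B \<in> carrier_mat r r"
    by (simp_all add: T_def T'_def B_def)
  have T: "T *\<^sub>v \<psi> s = \<Phi> s" and T': "T' *\<^sub>v \<Phi> s = \<psi> s" if "s \<in> ?H" for s
    unfolding T_def T'_def using transition_matrix[OF \<psi> H0_iso_\<Phi> that] transition_matrix[OF H0_iso_\<Phi> \<psi> that] by auto
  have bij: "\<psi> ` ?H = carrier_vec r" "\<Phi> ` ?H = carrier_vec r" "inj_on \<psi> ?H"
    using \<psi> H0_iso_\<Phi> by (auto simp: H0_iso_def bij_betw_def)
  have \<psi>c: "\<psi> s \<in> carrier_vec r" and \<Phi>c: "\<Phi> s \<in> carrier_vec r" if "s \<in> ?H" for s using bij that by auto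
  have TT': "T * T' = 1\<^sub>m r"
  proof (rule mat_eqI_mult_vec)
    fix w :: "complex vec" assume w: "w \<in> carrier_vec r"
    then obtain s where s: "s \<in> ?H" "w = \<Phi> s" using bij by blast
    then show "(T * T') *\<^sub>v w = 1\<^sub>m r *\<^sub>v w" using w c by (simp add: T T')
  qed (use c in auto)
  have T'T: "T' * T = 1\<^sub>m r"
  proof (rule mat_eqI_mult_vec)
    fix w :: "complex vec" assume w: "w \<in> carrier_vec r"
    then obtain s where s: "s \<in> ?H" "w = \<psi> s" using bij by blast
    then show "(T' * T) *\<^sub>v w = 1\<^sub>m r *\<^sub>v w" using w c by (simp add: T T')
  qed (use c in auto)
  have z: "H0_mult F (\<lambda>z. z) s \<in> ?H" if "s \<in> ?H" for s by (intro H0_mult_closed that holomorphic_intros)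
  have "B *\<^sub>v unit_vec r j = (T' * A * T) *\<^sub>v unit_vec r j" if "j < r" for j
  proof -
    let ?s = "?i (unit_vec r j)"
    have "unit_vec r j \<in> \<psi> ` ?H" using bij(1) by simp
    then have s: "?s \<in> ?H" "\<psi> ?s = unit_vec r j" by (rule inv_into_into, rule f_inv_into_f)
    have "(T' * A * T) *\<^sub>v unit_vec r j = T' *\<^sub>v (A *\<^sub>v (T *\<^sub>v unit_vec r j))"
      using c by (simp add: assoc_mult_mat_vec[where n\<^sub>1=r and n\<^sub>2=r and n\<^sub>3=r])
    also have "T *\<^sub>v unit_vec r j = \<Phi> ?s" using T[OF s(1)] s(2) by simp
    also have "T' *\<^sub>v (A *\<^sub>v \<Phi> ?s) = \<psi> (H0_mult F (\<lambda>z. z) ?s)"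
      using T'[OF z[OF s(1)]] \<Phi>_z[OF s(1)] by simp
    also have "\<dots> = B *\<^sub>v unit_vec r j"
      using that \<psi>c[OF z[OF s(1)]] by (auto simp: B_def matrix_of_def intro!: eq_vecI)
    finally show ?thesis by simp
  qed
  then have "B $$ (i, j) = (T' * A * T) $$ (i, j)" if "i < r" "j < r" for i j
    using that c mult_mat_unit_vec[OF c(3) that] mult_mat_unit_vec[of "T' * A * T" r r, OF _ that]
    by (metis A mult_carrier_mat)
  then have "B = T' * A * T"
    using c by (intro eq_matI) auto
  moreover have "\<psi> (coker_proj F (\<lambda>_. v)) = T' *\<^sub>v \<phi> (\<lambda>_. v)" for v
    using T'[OF coker_proj_in_H0, of "\<lambda>_. v"] \<Phi>_coker_proj[of "\<lambda>_. v"] by simp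
  ultimately have "config_pair F r \<psi> = (T' * A * T, \<lambda>v. T' *\<^sub>v \<phi> (\<lambda>_. v))"
    by (simp add: config_pair_def B_def matrix_of_def)
  then show ?thesis using Conf_class_conj[OF c(2,1) T'T TT' A, of "\<lambda>v. \<phi> (\<lambda>_. v)"] by simp
qed

text \<open>The argument of \<open>\<phi>\<close> is a function on the whole plane, but the kernel
  condition looks only at the disc: the difference is the image of 0 there.\<close>

lemma \<phi>_cong:
  assumes g: "holomorphic g (ball 0 1)" and h: "holomorphic h (ball 0 1)" and "\<And>z. z \<in> ball 0 1 \<Longrightarrow> g z = h z"
  shows "\<phi> g = \<phi> h"
  unfolding \<phi>_eq_iff[OF g h] coker_proj_eq_iff[OF g h] using assms module_hom.zero[OF module_hom_F]
  by (intro exI[of _ "\<lambda>_. 0"]) simp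

lemma \<phi>_prod_mult_eq_0:
  assumes q: "hol_vec (ball 0 1) (card Basis) q"
  shows "\<phi> (\<lambda>z. of_coord ((\<Prod>x\<leftarrow>xs. z - x) \<cdot>\<^sub>v q z)) = 0\<^sub>v r"
proof -
  have "(\<lambda>z. \<Prod>x\<leftarrow>ys. z - x) holomorphic_on ball 0 1" for ys
    by (induction ys) (auto intro!: holomorphic_intros)
  then have "holomorphic (\<lambda>z. of_coord ((\<Prod>x\<leftarrow>xs. z - x) \<cdot>\<^sub>v q z)) (ball 0 1)"
    by (intro holomorphic_of_coord holo.smult_vec q)
  from \<phi>_eq_0_iff[OF this] show ?thesis using prod_mult_in_image[OF q subset_refl] by metis
qed

text \<open>Let \<open>g\<close> represent an eigenvector \<open>w\<close>. Each factor
  \<open>z - x\<close> acts on \<open>w\<close> as \<open>k - x\<close>, while the product over all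
  zeros maps \<open>g\<close> into the image of \<open>F\<close>. So the product of the
  \<open>k - x\<close> annihilates \<open>w\<close> and must vanish.\<close>

lemma eigenvalue_in_zeros:
  assumes "eigenvalue A k"
  shows "k \<in> set xs"
proof -
  obtain w where w: "w \<in> carrier_vec r" "w \<noteq> 0\<^sub>v r" "A *\<^sub>v w = k \<cdot>\<^sub>v w"
    using assms A by (auto simp: eigenvalue_def eigenvector_def)
  obtain g where g: "holomorphic g (ball 0 1)" "\<phi> g = w" using \<phi>_surj[OF w(1)] by blast
  have *: "holomorphic (\<lambda>z. scale (\<Prod>x\<leftarrow>ys. z - x) (g z)) (ball 0 1) \<and>
    \<phi> (\<lambda>z. scale (\<Prod>x\<leftarrow>ys. z - x) (g z)) = (\<Prod>x\<leftarrow>ys. k - x) \<cdot>\<^sub>v w" for ys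
  proof (induction ys)
    case (Cons y ys)
    let ?h = "\<lambda>z. scale (\<Prod>x\<leftarrow>ys. z - x) (g z)"
    have h: "holomorphic ?h (ball 0 1)" "\<phi> ?h = (\<Prod>x\<leftarrow>ys. k - x) \<cdot>\<^sub>v w" using Cons by auto
    have eq: "scale (\<Prod>x\<leftarrow>y # ys. z - x) (g z) = scale z (?h z) + scale (-y) (?h z)" for z
      by (simp add: scale_left_diff_distrib left_diff_distrib)
    have h': "holomorphic (\<lambda>z. scale z (?h z)) (ball 0 1)" "holomorphic (\<lambda>z. scale (-y) (?h z)) (ball 0 1)"
      by (intro holomorphic_scale h holomorphic_intros)+
    have "\<phi> (\<lambda>z. scale z (?h z) + scale (-y) (?h z)) = A *\<^sub>v \<phi> ?h + (-y) \<cdot>\<^sub>v \<phi> ?h"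
      unfolding \<phi>_add[OF h'] \<phi>_z[OF h(1)] \<phi>_scale[OF h(1)] ..
    also have "\<dots> = (\<Prod>x\<leftarrow>y # ys. k - x) \<cdot>\<^sub>v w"
      unfolding h(2) using w by (auto simp: mult_mat_vec[OF A] algebra_simps intro!: eq_vecI)
    finally show ?case unfolding eq using holomorphic_add[OF h'] by simp
  qed (use g in simp)
  have "(\<Prod>x\<leftarrow>xs. k - x) \<cdot>\<^sub>v w = 0\<^sub>v r"
  proof -
    have "\<phi> (\<lambda>z. of_coord ((\<Prod>x\<leftarrow>xs. z - x) \<cdot>\<^sub>v coord (g z))) = 0\<^sub>v r"
      using g(1) by (intro \<phi>_prod_mult_eq_0) (simp add: holomorphic_iff_coord)
    then show ?thesis using *[of xs] by (simp flip: coord_scale)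
  qed
  moreover obtain i where "i < r" "w $ i \<noteq> 0" using w(1,2) by (metis carrier_vecD eq_vecI index_zero_vec)
  ultimately have "(\<Prod>x\<leftarrow>xs. k - x) = 0"
    using w(1) by (metis carrier_vecD index_smult_vec(1) index_zero_vec(1) mult_eq_0_iff)
  then show ?thesis by (auto simp: prod_list_zero_iff)
qed

lemma \<phi>_power:
  assumes "holomorphic g (ball 0 1)"
  shows "\<phi> (\<lambda>z. scale (z ^ i) (g z)) = (A ^\<^sub>m i) *\<^sub>v \<phi> g"
  using assms
proof (induction i arbitrary: g)
  case 0
  then show ?case using \<phi>_carrier[OF 0] carrier_matD(1)[OF A] by simp
next
  case (Suc i)
  have "holomorphic (\<lambda>z. scale z (g z)) (ball 0 1)"
    by (intro holomorphic_scale Suc holomorphic_intros)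
  from Suc.IH[OF this] show ?case
    using \<phi>_z[OF Suc.prems] assoc_mult_mat_vec[OF pow_carrier_mat[OF A] A \<phi>_carrier[OF Suc.prems]]
    by (simp add: mult.commute)
qed

text \<open>Translates polynomials in \<open>z\<close> with coefficients in V into the sums that
  occur in the surjectivity condition of \<open>Conf_tilde\<close>.\<close>

lemma \<phi>_sum_powers:
  "\<phi> (\<lambda>z. \<Sum>i<m. scale (z ^ i) (c i)) = finsum_vec TYPE(complex) r (\<lambda>i. (A ^\<^sub>m i) *\<^sub>v \<phi> (\<lambda>_. c i)) {..<m}"
proof (induction m)
  case 0
  have "\<phi> (\<lambda>z. 0) = 0\<^sub>v r"
    unfolding \<phi>_eq_0_iff[OF holomorphic_const] using module_hom.zero[OF module_hom_F]
    by (intro exI[of _ "\<lambda>_. 0"]) simp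
  then show ?case by (simp add: finsum_vec_empty)
next
  case (Suc m)
  have c: "(A ^\<^sub>m i) *\<^sub>v \<phi> (\<lambda>_. c i) \<in> carrier_vec r" for i
    by (rule mult_mat_vec_carrier[OF pow_carrier_mat[OF A]]) simp
  have "\<phi> (\<lambda>z. (\<Sum>i<m. scale (z ^ i) (c i)) + scale (z ^ m) (c m))
    = \<phi> (\<lambda>z. \<Sum>i<m. scale (z ^ i) (c i)) + (A ^\<^sub>m m) *\<^sub>v \<phi> (\<lambda>_. c m)"
    using \<phi>_add[OF holomorphic_sum_powers holomorphic_scale] \<phi>_power[of "\<lambda>_. c m" m]
    by (simp add: holomorphic_intros)
  also have "\<dots> = (A ^\<^sub>m m) *\<^sub>v \<phi> (\<lambda>_. c m) + finsum_vec TYPE(complex) r (\<lambda>i. (A ^\<^sub>m i) *\<^sub>v \<phi> (\<lambda>_. c i)) {..<m}"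
    unfolding Suc using c by (intro comm_add_vec[where n=r] finsum_vec_closed) auto
  also have "\<dots> = finsum_vec TYPE(complex) r (\<lambda>i. (A ^\<^sub>m i) *\<^sub>v \<phi> (\<lambda>_. c i)) {..<Suc m}"
    unfolding lessThan_Suc using c by (subst finsum_vec_insert) auto
  finally show ?case by simp
qed

text \<open>Surjectivity is Newton interpolation at the zeros: modulo the image of \<open>F\<close>,
  every function is a polynomial in \<open>z\<close> of degree below \<open>r\<close> with
  coefficients in V.\<close>

lemma in_Conf_tilde: "(A, \<lambda>v. \<phi> (\<lambda>_. v)) \<in> Conf_tilde (ball 0 1) r"
  unfolding Conf_tilde_def
proof (intro CollectI case_prodI conjI allI impI ballI)
  show "(\<lambda>v. \<phi> (\<lambda>_. v)) \<in> Hom_vec r"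
    using \<phi>_add[of "\<lambda>_. _" "\<lambda>_. _"] \<phi>_scale[of "\<lambda>_. _"] by (simp add: Hom_vec_def)
  show "k \<in> ball 0 1" if "eigenvalue A k" for k using eigenvalue_in_zeros[OF that] xs by auto
  fix w :: "complex vec" assume "w \<in> carrier_vec r"
  then obtain g where g: "holomorphic g (ball 0 1)" "\<phi> g = w" using \<phi>_surj by blast
  obtain c q where q: "hol_vec (ball 0 1) (card Basis) q" and
    eq: "\<And>z. z \<in> ball 0 1 \<Longrightarrow> g z = (\<Sum>i<length xs. scale (z ^ i) (c i)) + of_coord ((\<Prod>x\<leftarrow>xs. z - x) \<cdot>\<^sub>v q z)"
    by (rule Newton_interpolation_vec[OF g(1) open_ball]) blast
  have "(\<lambda>z. \<Prod>x\<leftarrow>ys. z - x) holomorphic_on ball 0 1" for ys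
    by (induction ys) (auto intro!: holomorphic_intros)
  then have h: "holomorphic (\<lambda>z. of_coord ((\<Prod>x\<leftarrow>xs. z - x) \<cdot>\<^sub>v q z)) (ball 0 1)"
    by (intro holomorphic_of_coord holo.smult_vec q)
  have "w = \<phi> (\<lambda>z. (\<Sum>i<length xs. scale (z ^ i) (c i)) + of_coord ((\<Prod>x\<leftarrow>xs. z - x) \<cdot>\<^sub>v q z))"
    unfolding g(2)[symmetric] using eq by (intro \<phi>_cong g holomorphic_add holomorphic_sum_powers h)
  also have "\<dots> = \<phi> (\<lambda>z. \<Sum>i<length xs. scale (z ^ i) (c i))"
    using \<phi>_add[OF holomorphic_sum_powers h] \<phi>_prod_mult_eq_0[OF q]
      \<phi>_carrier[OF holomorphic_sum_powers] by simp
  finally show "\<exists>v. finsum_vec TYPE(complex) r (\<lambda>i. (A ^\<^sub>m i) *\<^sub>v \<phi> (\<lambda>_. v i)) {..<r} = w"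
    unfolding \<phi>_sum_powers r by metis
qed simp

end

section \<open>Continuity of the configuration map\<close>

text \<open>The roots with multiplicity form a multiset, which is split by membership in
  \<open>S\<close>. The leading coefficient and the roots outside \<open>S\<close> go into
  \<open>u\<close>.\<close>

lemma poly_split_zeros:
  fixes q :: "complex poly"
  assumes "q \<noteq> 0"
  obtains xs u where "length xs = (\<Sum>z | poly q z = 0 \<and> z \<in> S. order z q)" "set xs \<subseteq> S"
    "\<And>z. poly q z = (\<Prod>x\<leftarrow>xs. z - x) * poly u z" "\<And>z. z \<in> S \<Longrightarrow> poly u z \<noteq> 0"
proof -
  define Z where "Z = filter_mset (\<lambda>z. z \<in> S) (proots q)"
  define W where "W = filter_mset (\<lambda>z. z \<notin> S) (proots q)"
  obtain xs where xs: "mset xs = Z" using ex_mset by blast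
  show thesis
  proof (rule that)
    have "length xs = size Z" by (simp flip: xs)
    also have "\<dots> = (\<Sum>z\<in>set_mset Z. count Z z)" by (rule size_multiset_overloaded_eq)
    also have "\<dots> = (\<Sum>z | poly q z = 0 \<and> z \<in> S. order z q)"
      using assms by (intro sum.cong) (auto simp: Z_def)
    finally show "length xs = (\<Sum>z | poly q z = 0 \<and> z \<in> S. order z q)" .
    have "set xs = set_mset Z" by (simp flip: xs)
    then show "set xs \<subseteq> S" by (auto simp: Z_def)
    let ?u = "Polynomial.smult (lead_coeff q) (\<Prod>x\<in>#W. [:-x, 1:])"
    have prod: "poly (\<Prod>x\<in>#M. [:-x, 1:]) z = (\<Prod>x\<in>#M. z - x)" for M and z :: complex
      by (induction M) (auto simp: left_diff_distrib)
    have "proots q = Z + W" by (simp add: Z_def W_def)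
    then have "q = Polynomial.smult (lead_coeff q) ((\<Prod>x\<in>#Z. [:-x, 1:]) * (\<Prod>x\<in>#W. [:-x, 1:]))"
      using complex_poly_decompose_multiset[of q] by simp
    then have "poly q z = poly (Polynomial.smult (lead_coeff q) ((\<Prod>x\<in>#Z. [:-x, 1:]) * (\<Prod>x\<in>#W. [:-x, 1:]))) z" for z
      by (rule arg_cong)
    moreover have "(\<Prod>x\<in>#Z. z - x) = (\<Prod>x\<leftarrow>xs. z - x)" for z
      by (simp add: prod_mset_prod_list flip: xs mset_map)
    ultimately show "poly q z = (\<Prod>x\<leftarrow>xs. z - x) * poly ?u z" for z
      by (simp add: prod)
    show "poly ?u z \<noteq> 0" if "z \<in> S" for z
      using that assms by (auto simp: prod prod_mset_zero_iff W_def)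
  qed
qed

text \<open>The coefficients are a separate argument because they are the parameter to be varied. As
  functions on the naturals they form a type with the product topology; the entries beyond
  \<open>n\<close> and \<open>l\<close> are ignored.\<close>

definition poly_mat :: "nat \<Rightarrow> nat \<Rightarrow> (nat \<Rightarrow> nat \<Rightarrow> nat \<Rightarrow> complex) \<Rightarrow> complex \<Rightarrow> complex mat" where
  "poly_mat n l c z = mat n n (\<lambda>(i, j). \<Sum>k\<le>l. z ^ k * c k i j)"

lemma hol_poly_mat: "hol_mat U n (poly_mat n l c)"
  by (auto simp: holo.C_mat_def poly_mat_def intro!: holomorphic_intros)

lemma cont_poly_mat: "cont.C_mat S n (\<lambda>(c, z). poly_mat n l c z)"
  unfolding cont.C_mat_def
proof (intro conjI allI impI)
  fix i j assume ij: "i < n" "j < n"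
  have "continuous_on S (\<lambda>p. fst p k i j)" for k
    by (rule continuous_on_product_then_coordinatewise[OF continuous_on_product_then_coordinatewise[OF
        continuous_on_product_then_coordinatewise[OF continuous_on_fst[OF continuous_on_id]]]])
  then have "continuous_on S (\<lambda>p. \<Sum>k\<le>l. snd p ^ k * fst p k i j)"
    by (intro continuous_intros)
  then show "continuous_on S (\<lambda>x. (case x of (c, z) \<Rightarrow> poly_mat n l c z) $$ (i, j))"
    using ij by (simp add: poly_mat_def case_prod_unfold)
qed (auto simp: poly_mat_def)

text \<open>The determinant is jointly continuous in coefficients and point, and the tube lemma
  makes the bound uniform over the compact set \<open>K\<close>.\<close>

lemma open_det_nonzero:
  assumes "compact K"
  shows "open {c. \<forall>z\<in>K. det (poly_mat n l c z) \<noteq> 0}"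
proof -
  let ?W = "{p. det (case p of (c, z) \<Rightarrow> poly_mat n l c z) \<noteq> 0}"
  have W: "open ?W"
    by (intro open_Collect_neq cont.det[OF cont_poly_mat] continuous_intros)
  show ?thesis
    unfolding open_subopen[of "{c. \<forall>z\<in>K. det (poly_mat n l c z) \<noteq> 0}"]
  proof clarify
    fix c assume "\<forall>z\<in>K. det (poly_mat n l c z) \<noteq> 0"
    then have "{c} \<times> K \<subseteq> ?W" by auto
    from Elementary_Topology.tube_lemma[OF assms W this] obtain X where "c \<in> X" "open X" "X \<times> K \<subseteq> ?W" by blast
    then show "\<exists>T. open T \<and> c \<in> T \<and> T \<subseteq> {c. \<forall>z\<in>K. det (poly_mat n l c z) \<noteq> 0}"
      by (intro exI[of _ X]) auto
  qed
qed

lemma continuous_on_dual_pairing: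
  assumes "0 < \<rho>" and "hol_vec (ball 0 1) n m" "hol_vec (ball 0 1) n g" and \<rho>: "\<rho> < 1"
    and S: "\<And>c z. c \<in> S \<Longrightarrow> norm z = \<rho> \<Longrightarrow> det (poly_mat n l c z) \<noteq> 0"
  shows "continuous_on S (\<lambda>c. dual_pairing \<rho> (poly_mat n l c) m g)"
proof -
  let ?T = "S \<times> sphere 0 \<rho>"
  have cont: "cont.C_vec ?T n (\<lambda>p. h (snd p))" if "hol_vec (ball 0 1) n h" for h
    unfolding cont.C_vec_def
  proof (intro conjI allI impI)
    fix i assume "i < n"
    then have "(\<lambda>z. h z $ i) holomorphic_on ball 0 1" using that by (simp add: holo.C_vec_def)
    then have "continuous_on (ball 0 1) (\<lambda>z. h z $ i)" by (rule holomorphic_on_imp_continuous_on)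
    moreover have "continuous_on ?T snd" by (rule continuous_on_snd[OF continuous_on_id])
    moreover have "snd ` ?T \<subseteq> ball 0 1" using \<rho> by auto
    ultimately show "continuous_on ?T (\<lambda>p. h (snd p) $ i)" by (rule continuous_on_compose2)
  qed (use that in \<open>auto simp: holo.C_vec_def\<close>)
  have "cont.C_mat ?T n (\<lambda>p. mat_inv (case p of (c, z) \<Rightarrow> poly_mat n l c z))"
    using S by (intro cont.mat_inv cont_poly_mat) auto
  from cont.scalar_prod[OF cont[OF assms(2)] cont.mult_mat_vec[OF this cont[OF assms(3)]]]
  have "continuous_on ?T (\<lambda>(c, z). m z \<bullet> (mat_inv (poly_mat n l c z) *\<^sub>v g z))"
    by (simp add: case_prod_unfold)
  then show ?thesis
    unfolding dual_pairing_def by (intro continuous_on_circle_mean assms(1))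
qed

lemma continuous_on_gram_mat:
  assumes "0 < \<rho>" and m: "\<forall>s<r. hol_vec (ball 0 1) n (m s)" and g: "\<forall>s<r. hol_vec (ball 0 1) n (g s)" and "\<rho> < 1"
    and "\<And>c z. c \<in> S \<Longrightarrow> norm z = \<rho> \<Longrightarrow> det (poly_mat n l c z) \<noteq> 0"
  shows "cont.C_mat S r (\<lambda>c. gram_mat \<rho> (poly_mat n l c) r m g)"
  using assms by (auto simp: cont.C_mat_def gram_mat_def intro!: continuous_on_dual_pairing)

context complex_fd_space
begin

section \<open>Operator polynomials in coordinates\<close>

lemma coord_End:
  assumes "h \<in> End"
  shows "coord (h v) = mat (card Basis) (card Basis)
    (\<lambda>(i, j). representation Basis (h (basis_enum j)) (basis_enum i)) *\<^sub>v coord v"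
proof -
  interpret h: module_hom scale scale h using assms by (simp add: End_def module_hom_iff_linear)
  have "h v = h (of_coord (coord v))" by simp
  also have "\<dots> = (\<Sum>j<card Basis. scale (coord v $ j) (h (basis_enum j)))"
    unfolding of_coord_def by (simp add: h.sum h.scale)
  finally have "representation Basis (h v) b = (\<Sum>j<card Basis. coord v $ j * representation Basis (h (basis_enum j)) b)" for b
    by (simp add: representation_sum representation_scale independent_Basis span_Basis)
  then have "coord (h v) $ i = (\<Sum>j<card Basis. coord v $ j * representation Basis (h (basis_enum j)) (basis_enum i))"
    if "i < card Basis" for i using that by (simp add: coord_def)
  then show ?thesis
    by (intro eq_vecI) (auto simp: scalar_prod_def atLeast0LessThan mult.commute)
qed

text \<open>Padding by 0 gives a total function into the product space; the padded coordinates are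
  constant and so trivially continuous.\<close>

definition coeff_array :: "nat \<Rightarrow> (nat \<Rightarrow> 'v \<Rightarrow> 'v) \<Rightarrow> nat \<Rightarrow> nat \<Rightarrow> nat \<Rightarrow> complex" where
  "coeff_array l a k i j = (if k \<le> l \<and> i < card Basis \<and> j < card Basis
     then representation Basis (a k (basis_enum j)) (basis_enum i) else 0)"

abbreviation "coeff_mat l a \<equiv> poly_mat (card Basis) l (coeff_array l a)"

lemma eval_in_End:
  assumes "a \<in> {..l} \<rightarrow>\<^sub>E End"
  shows "eval l a z \<in> End"
proof -
  have a: "module_hom scale scale (a j)" if "j \<le> l" for j
    using assms that by (auto simp: End_def module_hom_iff_linear)
  have "module_hom scale scale (eval l a z)"
    unfolding module_hom_iff
  proof (intro conjI allI)
    show "eval l a z (x + y) = eval l a z x + eval l a z y" for x y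
      unfolding eval_def sum.distrib[symmetric]
      by (intro sum.cong refl) (simp add: module_hom.add[OF a] scale_right_distrib)
    show "eval l a z (scale c x) = scale c (eval l a z x)" for c x
      unfolding eval_def scale_sum_right
      by (intro sum.cong refl) (simp add: module_hom.scale[OF a] mult.commute)
  qed unfold_locales
  then show ?thesis by (simp add: End_def module_hom_iff_linear)
qed

lemma coeff_mat_eq:
  assumes "a \<in> {..l} \<rightarrow>\<^sub>E End"
  shows "coeff_mat l a z = mat (card Basis) (card Basis)
    (\<lambda>(i, j). representation Basis (eval l a z (basis_enum j)) (basis_enum i))"
  unfolding representation_eval[OF assms] poly_mat_def
  by (rule cong_mat) (auto simp: coeff_array_def)

lemma coord_eval:
  assumes "a \<in> {..l} \<rightarrow>\<^sub>E End"
  shows "coord (eval l a z v) = coeff_mat l a z *\<^sub>v coord v"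
  unfolding coeff_mat_eq[OF assms] by (rule coord_End[OF eval_in_End[OF assms]])

lemma det_coeff_mat:
  assumes "a \<in> {..l} \<rightarrow>\<^sub>E End"
  shows "det (coeff_mat l a z) = poly (det_poly l a) z"
  unfolding poly_det_poly[OF assms] End_det_def coeff_mat_eq[OF assms] ..

lemma Poly_S1_D:
  assumes "a \<in> Poly_S1 l r"
  shows "a \<in> {..l} \<rightarrow>\<^sub>E End" "norm z = 1 \<Longrightarrow> det (coeff_mat l a z) \<noteq> 0"
proof -
  show a: "a \<in> {..l} \<rightarrow>\<^sub>E End" using assms by (simp add: Poly_S1_def)
  assume "norm z = 1"
  then have inj: "inj (eval l a z)" using assms by (auto simp: Poly_S1_def bij_def)
  show "det (coeff_mat l a z) \<noteq> 0"
  proof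
    have M: "coeff_mat l a z \<in> carrier_mat (card Basis) (card Basis)" by (simp add: poly_mat_def)
    assume "det (coeff_mat l a z) = 0"
    then obtain w where w: "w \<in> carrier_vec (card Basis)" "w \<noteq> 0\<^sub>v (card Basis)" "coeff_mat l a z *\<^sub>v w = 0\<^sub>v (card Basis)"
      using det_0_iff_vec_prod_zero_field[OF M] by blast
    have zero: "coord 0 = 0\<^sub>v (card Basis)" by (auto simp: coord_def representation_zero)
    have "coeff_mat l a z *\<^sub>v 0\<^sub>v (card Basis) = 0\<^sub>v (card Basis)" using M by (intro eq_vecI) auto
    then have "coord (eval l a z (of_coord w)) = coord (eval l a z 0)"
      using w(1,3) zero by (simp add: coord_eval[OF a])
    then have "of_coord w = 0" using inj by (simp only: coord_eq_iff inj_eq)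
    then have "w = coord 0" using coord_of_coord[OF w(1)] by simp
    then show False using w(2) zero by simp
  qed
qed

lemma Poly_S1_zeros:
  assumes "a \<in> Poly_S1 l r"
  obtains xs u where "length xs = r" "coker_data scale Basis (eval l a) (coeff_mat l a) xs u"
proof -
  note a = Poly_S1_D(1)[OF assms]
  \<comment> \<open>Any point of the unit circle would do: a value different from 0 shows that the
    determinant is not the zero polynomial, so its roots have finite orders.\<close>
  have "poly (det_poly l a) 1 \<noteq> 0"
    using Poly_S1_D(2)[OF assms, of 1] by (simp add: det_coeff_mat[OF a])
  then have "det_poly l a \<noteq> 0" by auto
  then obtain xs u where
    len: "length xs = (\<Sum>z | poly (det_poly l a) z = 0 \<and> z \<in> ball 0 1. order z (det_poly l a))" and
    xs: "set xs \<subseteq> ball 0 1" and prod: "\<And>z. poly (det_poly l a) z = (\<Prod>x\<leftarrow>xs. z - x) * poly u z" and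
    u: "\<And>z. z \<in> ball 0 1 \<Longrightarrow> poly u z \<noteq> 0"
    by (rule poly_split_zeros[of "det_poly l a" "ball 0 1"]) blast
  show thesis
  proof (rule that)
    show "length xs = r" using assms len by (simp add: Poly_S1_def)
    show "coker_data scale Basis (eval l a) (coeff_mat l a) xs (poly u)"
      using u prod xs
      by unfold_locales (auto simp: eval_in_End[OF a] coord_eval[OF a] det_coeff_mat[OF a]
         intro!: hol_poly_mat holomorphic_intros)
  qed
qed

lemma config_data_pairing:
  assumes "coker_data scale Basis F M xs u" and "dual_basis (card Basis) \<rho> M xs u m p"
  shows "config_data scale Basis F M xs u (\<lambda>g. pairing_vec \<rho> M (length xs) m (\<lambda>z. coord (g z)))
    (gram_mat \<rho> M (length xs) m (\<lambda>s z. z \<cdot>\<^sub>v p s z) * mat_inv (gram_mat \<rho> M (length xs) m p)) (length xs)"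
proof -
  interpret coker_data scale Basis F M xs u by fact
  interpret dual: dual_basis "card Basis" \<rho> M xs u m p by fact
  show ?thesis
  \<comment> \<open>The goals are, in order, the assumptions that \<open>config_data\<close> adds to
    \<open>coker_data\<close>.\<close>
  proof (unfold_locales, goal_cases)
    case 1 show ?case ..
  next
    case (2 g) show ?case by simp
  next
    case (3 g h)
    then show ?case
      unfolding coord_add holomorphic_iff_coord by (rule dual.pairing_vec_add[OF dual.l])
  next
    case (4 g c)
    then show ?case
      unfolding coord_scale holomorphic_iff_coord by (rule dual.pairing_vec_smult[OF dual.l])
  next
    case (5 w)
    from dual.pairing_vec_surj[OF this] obtain g where
      g: "hol_vec (ball 0 1) (card Basis) g" "pairing_vec \<rho> M (length xs) m g = w" by blast
    have "coord (of_coord (g z)) = g z" for z using g(1) by (simp add: holo.C_vec_def)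
    then have "pairing_vec \<rho> M (length xs) m (\<lambda>z. coord (of_coord (g z))) = w" using g(2) by simp
    with holomorphic_of_coord[OF g(1)] show ?case by blast
  next
    case (6 g)
    then have g: "hol_vec (ball 0 1) (card Basis) (\<lambda>z. coord (g z))" by (simp add: holomorphic_iff_coord)
    show ?case
    proof
      assume "pairing_vec \<rho> M (length xs) m (\<lambda>z. coord (g z)) = 0\<^sub>v (length xs)"
      from dual.pairing_vec_eq_0D[OF g this] obtain h where
        h: "hol_vec (ball 0 1) (card Basis) h" "\<And>z. z \<in> ball 0 1 \<Longrightarrow> coord (g z) = M z *\<^sub>v h z" by blast
      have "coord (of_coord (h z)) = h z" for z using h(1) by (simp add: holo.C_vec_def)
      then have "coord (g z) = coord (F z (of_coord (h z)))" if "z \<in> ball 0 1" for z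
        using h(2)[OF that] by (simp add: coord_F)
      then have "g z = F z (of_coord (h z))" if "z \<in> ball 0 1" for z
        using that by (simp only: coord_eq_iff)
      with holomorphic_of_coord[OF h(1)]
      show "\<exists>h. holomorphic h (ball 0 1) \<and> (\<forall>z\<in>ball 0 1. g z = F z (h z))" by blast
    next
      assume "\<exists>h. holomorphic h (ball 0 1) \<and> (\<forall>z\<in>ball 0 1. g z = F z (h z))"
      then obtain h where h: "holomorphic h (ball 0 1)" "\<And>z. z \<in> ball 0 1 \<Longrightarrow> g z = F z (h z)" by blast
      have "pairing_vec \<rho> M (length xs) m (\<lambda>z. coord (g z)) = pairing_vec \<rho> M (length xs) m (\<lambda>z. M z *\<^sub>v coord (h z))"
        using h(2) by (intro dual.pairing_vec_cong) (simp add: coord_F)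
      then show "pairing_vec \<rho> M (length xs) m (\<lambda>z. coord (g z)) = 0\<^sub>v (length xs)"
        using dual.pairing_vec_image[OF dual.l h(1)[unfolded holomorphic_iff_coord]] by simp
    qed
  next
    case 7 show ?case by (rule mult_carrier_mat[OF gram_mat_carrier mat_inv_carrier[OF gram_mat_carrier]])
  next
    case (8 g)
    then show ?case
      unfolding coord_scale holomorphic_iff_coord by (rule dual.pairing_vec_z)
  qed
qed

lemma continuous_map_coeff_array: "continuous_map (Poly_S1_topology l r) euclidean (coeff_array l)"
proof -
  have "continuous_map (Poly_S1_topology l r) euclidean (\<lambda>a. coeff_array l a k i j)" for k i j
  proof (cases "k \<le> l \<and> i < card Basis \<and> j < card Basis")
    case True
    have "continuous_map (product_topology (\<lambda>_. euclidean) (Basis \<times> Basis)) euclidean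
        (\<lambda>f. f (basis_enum j, basis_enum i) :: complex)"
      using True by (intro continuous_map_product_projection[of _ _ "\<lambda>_. euclidean"]) simp
    from continuous_map_pullback[OF this, of End "\<lambda>h. \<lambda>(b, c)\<in>Basis \<times> Basis. representation Basis (h b) c"] True
    have "continuous_map End_topology euclidean (\<lambda>h. representation Basis (h (basis_enum j)) (basis_enum i))"
      unfolding End_topology_def by (simp add: o_def)
    moreover have "continuous_map (Poly_topology l) End_topology (\<lambda>a. a k)"
      unfolding Poly_topology_def using True by (intro continuous_map_product_projection) simp
    ultimately have "continuous_map (Poly_topology l) euclidean
        (\<lambda>a. representation Basis (a k (basis_enum j)) (basis_enum i))"
      using continuous_map_compose[of "Poly_topology l" End_topology "\<lambda>a. a k" euclidean] by (simp add: o_def)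
    then show ?thesis using True
      by (simp add: Poly_S1_topology_def coeff_array_def continuous_map_from_subtopology)
  qed (auto simp: coeff_array_def)
  then show ?thesis
    by (simp add: continuous_map_componentwise_UNIV flip: euclidean_product_topology)
qed

text \<open>Reduces continuity for the abstract topologies on matrices and homomorphisms to
  entrywise continuity on the set \<open>S\<close> of coefficient arrays, through which the map
  factors.\<close>

lemma continuous_map_into_Conf_tilde:
  assumes A: "cont.C_mat S r A" "continuous_map X (top_of_set S) f"
    and \<iota>: "\<And>b. b \<in> Basis \<Longrightarrow> cont.C_vec S r (\<lambda>c. \<iota> c b)"
    and Conf: "\<And>a. a \<in> topspace X \<Longrightarrow> (A (f a), \<iota> (f a)) \<in> Conf_tilde U r"
  shows "continuous_map X (Conf_tilde_topology U r) (\<lambda>a. (A (f a), \<iota> (f a)))"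
proof -
  have comp: "continuous_map X euclidean (\<lambda>a. h (f a))" if "continuous_on S h" for h :: "_ \<Rightarrow> complex"
    using continuous_map_compose[OF A(2), of euclidean h] that by (simp add: o_def)
  have "continuous_map X (mat_topology r) (\<lambda>a. A (f a))"
    unfolding mat_topology_def
  proof (rule continuous_map_pullback')
    show "continuous_map X (product_topology (\<lambda>_. euclidean) ({..<r} \<times> {..<r}))
       ((\<lambda>A. \<lambda>(i, j)\<in>{..<r} \<times> {..<r}. A $$ (i, j)) \<circ> (\<lambda>a. A (f a)))"
      using A(1) by (auto simp: continuous_map_componentwise cont.C_mat_def intro!: comp)
  qed (use A(1) in \<open>auto simp: cont.C_mat_def\<close>)
  moreover have "continuous_map X (Hom_vec_topology r) (\<lambda>a. \<iota> (f a))"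
    unfolding Hom_vec_topology_def
  proof (rule continuous_map_pullback')
    show "continuous_map X (product_topology (\<lambda>_. euclidean) ({..<r} \<times> Basis))
       ((\<lambda>\<iota>. \<lambda>(i, b)\<in>{..<r} \<times> Basis. \<iota> b $ i) \<circ> (\<lambda>a. \<iota> (f a)))"
      using \<iota> by (auto simp: continuous_map_componentwise cont.C_vec_def intro!: comp)
  qed (use Conf in \<open>auto simp: Conf_tilde_def\<close>)
  ultimately show ?thesis
    unfolding Conf_tilde_topology_def
    using Conf by (auto simp: continuous_map_in_subtopology continuous_map_paired)
qed

lemma local_section:
  assumes a0: "a0 \<in> Poly_S1 l r"
  obtains N \<sigma> where "openin (Poly_S1_topology l r) N" "a0 \<in> N"
    "continuous_map (subtopology (Poly_S1_topology l r) N) (Conf_tilde_topology (ball 0 1) r) \<sigma>"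
    "\<And>a. a \<in> N \<Longrightarrow> config l r a = Conf_class r (\<sigma> a)"
proof -
  let ?n = "card Basis"
  obtain xs0 u0 where len0: "length xs0 = r" and data0: "coker_data scale Basis (eval l a0) (coeff_mat l a0) xs0 u0"
    by (rule Poly_S1_zeros[OF a0])
  interpret c0: coker_data scale Basis "eval l a0" "coeff_mat l a0" xs0 u0 by (rule data0)
  \<comment> \<open>The largest modulus of a zero in the disc. The inserted 0 covers the case
    without zeros and keeps \<open>\<rho>\<close>, the midpoint of \<open>\<mu>\<close> and 1,
    positive.\<close>
  define \<mu> where "\<mu> = Max (insert 0 (norm ` set xs0))"
  define \<rho> where "\<rho> = (1 + \<mu>) / 2"
  have "\<mu> < 1" "0 \<le> \<mu>" using c0.xs by (auto simp: \<mu>_def)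
  then have \<rho>: "0 < \<rho>" "\<rho> < 1" and "\<mu> < \<rho>" by (auto simp: \<rho>_def)
  then have xs0: "norm x < \<rho>" if "x \<in> set xs0" for x using that by (auto simp: \<mu>_def)
  \<comment> \<open>The closed annulus up to and including the unit circle. It is compact and free
    of zeros for \<open>a0\<close>, so it stays free of zeros nearby; this confines the zeros in the
    disc to radius \<open>\<rho>\<close>.\<close>
  define K where "K = cball (0::complex) 1 - ball 0 \<rho>"
  have K: "compact K" by (simp add: K_def compact_diff)
  define N0 where "N0 = {c. \<forall>z\<in>K. det (poly_mat ?n l c z) \<noteq> 0}"
  have N0: "open N0" unfolding N0_def by (rule open_det_nonzero[OF K])
  have circle: "det (poly_mat ?n l c z) \<noteq> 0" if "c \<in> N0" "norm z = \<rho>" for c z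
    using that \<rho> by (auto simp: N0_def K_def)
  have a0_N0: "coeff_array l a0 \<in> N0"
    unfolding N0_def
  proof (intro CollectI ballI)
    fix z assume z: "z \<in> K"
    show "det (coeff_mat l a0 z) \<noteq> 0"
    proof (cases "norm z = 1")
      case False
      then show ?thesis using z xs0[of z] c0.det_M_nonzero[of z] by (auto simp: K_def)
    qed (use Poly_S1_D(2)[OF a0] in auto)
  qed
  have "\<exists>m p. (\<forall>s<length xs0. hol_vec (ball 0 1) ?n (m s) \<and> hol_vec (ball 0 1) ?n (p s)) \<and>
    (\<forall>t<length xs0. \<forall>s<length xs0. dual_pairing \<rho> (coeff_mat l a0) (m t) (p s) = (if s = t then 1 else 0)) \<and>
    (\<forall>g. hol_vec (ball 0 1) ?n g \<longrightarrow> (\<forall>t<length xs0. dual_pairing \<rho> (coeff_mat l a0) (m t) g = 0) \<longrightarrow>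
      (\<exists>h. hol_vec (ball 0 1) ?n h \<and> (\<forall>z\<in>ball 0 1. g z = coeff_mat l a0 z *\<^sub>v h z)))"
    by (rule dual_system[OF \<rho> c0.M c0.u(1)]) (fact c0.u(2) c0.det_M xs0)+
  then obtain m p where *: "\<forall>s<length xs0. hol_vec (ball 0 1) ?n (m s) \<and> hol_vec (ball 0 1) ?n (p s)"
    "\<forall>t<length xs0. \<forall>s<length xs0. dual_pairing \<rho> (coeff_mat l a0) (m t) (p s) = (if s = t then 1 else 0)"
    by (elim exE conjE)
  have m: "\<forall>s<r. hol_vec (ball 0 1) ?n (m s)" and p: "\<forall>s<r. hol_vec (ball 0 1) ?n (p s)"
    using * len0 by auto
  have zp: "\<forall>s<r. hol_vec (ball 0 1) ?n (\<lambda>z. z \<cdot>\<^sub>v p s z)"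
    using p by (auto intro!: holo.smult_vec)
  define D where "D c = gram_mat \<rho> (poly_mat ?n l c) r m p" for c
  define D' where "D' c = gram_mat \<rho> (poly_mat ?n l c) r m (\<lambda>s z. z \<cdot>\<^sub>v p s z)" for c
  have contD: "cont.C_mat N0 r D" and contD': "cont.C_mat N0 r D'"
    unfolding D_def D'_def
    by (rule continuous_on_gram_mat[OF \<rho>(1) m p \<rho>(2)] continuous_on_gram_mat[OF \<rho>(1) m zp \<rho>(2)], fact circle)+
  \<comment> \<open>At \<open>a0\<close> the Gram matrix is the identity, so a nonzero determinant
    cuts out an open neighbourhood.\<close>
  define N1 where "N1 = {c \<in> N0. det (D c) \<noteq> 0}"
  have "N1 = N0 \<inter> (\<lambda>c. det (D c)) -` (- {0})" by (auto simp: N1_def)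
  then have "open N1" using continuous_open_preimage[OF cont.det[OF contD] N0, of "- {0}"] by auto
  have "D (coeff_array l a0) = 1\<^sub>m r"
    unfolding D_def gram_mat_def using *(2) len0 by (intro eq_matI) auto
  then have a0_N1: "coeff_array l a0 \<in> N1" using a0_N0 by (simp add: N1_def)
  define A where "A c = D' c * mat_inv (D c)" for c
  define \<iota> where "\<iota> c v = pairing_vec \<rho> (poly_mat ?n l c) r m (\<lambda>_. coord v)" for c v
  define N where "N = {a \<in> Poly_S1 l r. coeff_array l a \<in> N1}"
  \<comment> \<open>The zeros \<open>xs\<close> and the unit \<open>u\<close> are found separately
    for each \<open>a\<close>, without continuity. Only \<open>A\<close> and \<open>\<iota>\<close>
    have to be given by formulas in the coefficients.\<close>
  have data: "\<exists>F M xs u \<phi>. config_data scale Basis F M xs u \<phi> (A (coeff_array l a)) r \<and>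
      F = eval l a \<and> (\<lambda>v. \<phi> (\<lambda>_. v)) = \<iota> (coeff_array l a)" if a: "a \<in> N" for a
  proof -
    have aP: "a \<in> Poly_S1 l r" and aN: "coeff_array l a \<in> N0" "det (D (coeff_array l a)) \<noteq> 0"
      using a by (auto simp: N_def N1_def)
    obtain xs u where len: "length xs = r" and data: "coker_data scale Basis (eval l a) (coeff_mat l a) xs u"
      by (rule Poly_S1_zeros[OF aP])
    interpret c: coker_data scale Basis "eval l a" "coeff_mat l a" xs u by (rule data)
    \<comment> \<open>A zero of modulus at least \<open>\<rho>\<close> would lie in
      \<open>K\<close>, where the determinant does not vanish by the choice of
      \<open>N0\<close>.\<close>
    have norm_xs: "norm x < \<rho>" if "x \<in> set xs" for x
    proof (rule ccontr)
      assume "\<not> norm x < \<rho>"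
      moreover have "x \<in> ball 0 1" using c.xs that by auto
      ultimately have "x \<in> K" by (auto simp: K_def)
      moreover have "det (coeff_mat l a x) = 0"
        using that by (auto simp: c.det_M[OF \<open>x \<in> ball 0 1\<close>] prod_list_zero_iff)
      ultimately show False using aN by (auto simp: N0_def)
    qed
    have mp: "\<forall>s<length xs. hol_vec (ball 0 1) ?n (m s)" "\<forall>s<length xs. hol_vec (ball 0 1) ?n (p s)"
      "det (gram_mat \<rho> (coeff_mat l a) (length xs) m p) \<noteq> 0"
      unfolding len using m p aN(2) by (simp_all add: D_def)
    have "dual_basis ?n \<rho> (coeff_mat l a) xs u m p"
      by unfold_locales (fact c.M \<rho> circle[OF aN(1)] c.u c.det_M norm_xs mp)+
    from config_data_pairing[OF data this] show ?thesis
      unfolding len A_def D_def D'_def \<iota>_def by (intro exI conjI) (auto simp: fun_eq_iff)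
  qed
  have N_open: "openin (Poly_S1_topology l r) N"
    using openin_continuous_map_preimage[OF continuous_map_coeff_array, of N1 l r] \<open>open N1\<close>
    by (simp add: N_def topspace_Poly_S1_topology)
  have N_top: "topspace (subtopology (Poly_S1_topology l r) N) = N"
    by (auto simp: topspace_Poly_S1_topology N_def)
  show thesis
  proof (rule that[OF N_open])
    show "a0 \<in> N" using a0 a0_N1 by (simp add: N_def)
    show "continuous_map (subtopology (Poly_S1_topology l r) N) (Conf_tilde_topology (ball 0 1) r)
        (\<lambda>a. (A (coeff_array l a), \<iota> (coeff_array l a)))"
    proof (rule continuous_map_into_Conf_tilde[where A = A and \<iota> = \<iota> and f = "coeff_array l"])
      show "continuous_map (subtopology (Poly_S1_topology l r) N) (top_of_set N1) (coeff_array l)"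
        using continuous_map_from_subtopology[OF continuous_map_coeff_array]
        by (auto simp: continuous_map_in_subtopology N_def)
      show "(A (coeff_array l a), \<iota> (coeff_array l a)) \<in> Conf_tilde (ball 0 1) r"
        if "a \<in> topspace (subtopology (Poly_S1_topology l r) N)" for a
        using data that config_data.in_Conf_tilde unfolding N_top by metis
      have mono: "cont.C_mat N1 r B" if "cont.C_mat N0 r B" for B
        using that unfolding cont.C_mat_def N1_def by (blast intro: continuous_on_subset)
      have "cont.C_mat N1 r (\<lambda>c. mat_inv (D c))"
        by (intro cont.mat_inv mono contD) (simp add: N1_def)
      then show "cont.C_mat N1 r A"
        unfolding A_def by (rule cont.mult_mat[OF mono[OF contD']])
      show "cont.C_vec N1 r (\<lambda>c. \<iota> c b)" for b
        unfolding \<iota>_def cont.C_vec_def pairing_vec_def using m circle \<rho>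
        by (auto simp: N1_def holo.C_vec_def intro!: continuous_on_dual_pairing)
    qed
    show "config l r a = Conf_class r (A (coeff_array l a), \<iota> (coeff_array l a))" if "a \<in> N" for a
    proof -
      obtain F M xs u \<phi> where d: "config_data scale Basis F M xs u \<phi> (A (coeff_array l a)) r"
        and F: "F = eval l a" and \<phi>: "(\<lambda>v. \<phi> (\<lambda>_. v)) = \<iota> (coeff_array l a)" using data[OF \<open>a \<in> N\<close>] by blast
      have "H0_iso F r (SOME \<psi>. H0_iso F r \<psi>)"
        by (rule someI[of "H0_iso F r"]) (rule config_data.H0_iso_\<Phi>[OF d])
      from config_data.Conf_class_config_pair[OF d this] show ?thesis
        unfolding config_def F \<phi> .
    qed
  qed
qed

text \<open>Near each point the map is a continuous lift followed by the quotient map. The lifts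
  depend on the base point and need not agree with each other; their classes do.\<close>

lemma continuous_map_config:
  "continuous_map (Poly_S1_topology l r) (Conf_topology (ball 0 1) r) (config l r)"
proof -
  have local_sec: "\<exists>N \<sigma>. openin (Poly_S1_topology l r) N \<and> a \<in> N \<and>
    continuous_map (subtopology (Poly_S1_topology l r) N) (Conf_tilde_topology (ball 0 1) r) \<sigma> \<and>
    (\<forall>a\<in>N. config l r a = Conf_class r (\<sigma> a))" if "a \<in> Poly_S1 l r" for a
    by (rule local_section[OF that]) blast
  have q: "continuous_map (Conf_tilde_topology (ball 0 1) r) (Conf_topology (ball 0 1) r) (Conf_class r)"
    unfolding Conf_topology_def by (intro quotient_imp_continuous_map quotient_map_quotient_topology)
  have "\<exists>N. openin (Poly_S1_topology l r) N \<and> a \<in> N \<and>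
    continuous_map (subtopology (Poly_S1_topology l r) N) (Conf_topology (ball 0 1) r) (config l r)"
    if "a \<in> Poly_S1 l r" for a
  proof -
    obtain N \<sigma> where N: "openin (Poly_S1_topology l r) N" "a \<in> N"
      and \<sigma>: "continuous_map (subtopology (Poly_S1_topology l r) N) (Conf_tilde_topology (ball 0 1) r) \<sigma>"
      "\<And>a. a \<in> N \<Longrightarrow> config l r a = Conf_class r (\<sigma> a)" using local_sec[OF \<open>a \<in> Poly_S1 l r\<close>] by blast
    have "continuous_map (subtopology (Poly_S1_topology l r) N) (Conf_topology (ball 0 1) r) (config l r)"
      by (rule continuous_map_eq[OF continuous_map_compose[OF \<sigma>(1) q]]) (simp add: \<sigma>(2))
    with N show ?thesis by blast
  qed
  then obtain N where "\<And>a. a \<in> Poly_S1 l r \<Longrightarrow> openin (Poly_S1_topology l r) (N a) \<and> a \<in> N a \<and>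
    continuous_map (subtopology (Poly_S1_topology l r) (N a)) (Conf_topology (ball 0 1) r) (config l r)"
    by metis
  then show ?thesis
    \<comment> \<open>Every piece is a restriction of the same map, so the compatibility on overlaps
      is trivial.\<close>
    by (intro pasting_lemma[of "Poly_S1 l r" "Poly_S1_topology l r" N _ "\<lambda>_. config l r" "config l r"])
      (auto simp: topspace_Poly_S1_topology)
qed

end

theorem theorem1p1:
  fixes scale :: "complex \<Rightarrow> 'v::ab_group_add \<Rightarrow> 'v" and Basis :: "'v set"
    and l r :: nat
  assumes "complex_fd_space scale Basis"
  shows "continuous_map
    (complex_fd_space.Poly_S1_topology scale Basis l r)
    (complex_fd_space.Conf_topology scale Basis (ball 0 1) r)
    (complex_fd_space.config scale Basis l r)"
  using complex_fd_space.continuous_map_config[OF assms] .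

end
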